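(* Let $C$ be an analytic reduced plane curve defined by $f=\prod_{i\in I}f_i\in\mathbb{C}\{X,Y\}$ with $I=\{1,\ldots,r\}$, $r>1$, where the $f_i$ are irreducible and $\langle f_i\rangle\neq\langle f_j\rangle$ for $i\neq j$, and let $C_i$ be the branch defined by $f_i$. Let $J$ be a non-empty proper subset of $I$, let $K=I\setminus J$, and let $C_J$ and $C_K$ be the plane curves defined by $\prod_{j\in J}f_j$ and $\prod_{k\in K}f_k$, respectively. Then $$\tau(C)-(\tau(C_J)+\tau(C_K))\leq 2\cdot \mathrm{I}(C_J,C_K)-1.$$ In particular, $$\tau(C)-\sum_{i\in I}\tau(C_{i})\leq 2\sum_{1\leq i<j\leq r}\mathrm{I}(C_i,C_j)-r+1=\mu(C)-\sum_{i\in I}\mu(C_{i}).$$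
   Context: $\mathbb{C}\{X,Y\}$ is the ring of convergent power series; irreducible elements are in particular non-units. For a reduced plane curve germ $D$ defined by $g\in\mathbb{C}\{X,Y\}$, the Tjurina number is $\tau(D)=\dim_{\mathbb{C}}\mathbb{C}\{X,Y\}/\langle g,g_X,g_Y\rangle$ and the Milnor number is $\mu(D)=\mathrm{I}(g_X,g_Y)$. For $g,h\in\mathbb{C}\{X,Y\}$, $\mathrm{I}(g,h)=\dim_{\mathbb{C}}\mathbb{C}\{X,Y\}/\langle g,h\rangle$; the intersection multiplicity of two curve germs is $\mathrm{I}$ of their defining equations, so that $\mathrm{I}(C_J,C_K)=\sum_{j\in J,\,k\in K}\mathrm{I}(f_j,f_k)$. *)

theory Defs
  imports
    "HOL-Analysis.Infinite_Sum"
    "HOL-Computational_Algebra.Formal_Power_Series"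
    "HOL-Algebra.Algebraic_Closure_Type"
    "HOL-Algebra.Embedded_Algebras"
    "HOL-Algebra.QuotRing"
begin

section \<open>The ring of convergent power series in two variables\<close>

text \<open>
  A formal power series in \<open>X\<close>, \<open>Y\<close> is a series in \<open>X\<close> whose coefficients are series in \<open>Y\<close>:
  \<open>F $ i $ j\<close> is the coefficient of the monomial \<open>X\<^sup>i Y\<^sup>j\<close>.
\<close>

definition convergent_fps2 :: "complex fps fps \<Rightarrow> bool" where
  "convergent_fps2 F \<longleftrightarrow>
     (\<exists>\<rho>>0. \<forall>x y. norm x < \<rho> \<longrightarrow> norm y < \<rho> \<longrightarrow>
        (\<lambda>(i, j). F $ i $ j * x ^ i * y ^ j) summable_on UNIV)"

lemma geometric2_summable:
  fixes a :: real
  assumes "0 \<le> a" "a < 1"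
  shows "(\<lambda>(i, j). a ^ i * a ^ j) summable_on (UNIV :: (nat \<times> nat) set)"
proof -
  have "(\<lambda>i. a ^ i) abs_summable_on (UNIV :: nat set)"
    using assms by (intro norm_summable_imp_summable_on) (simp add: summable_geometric)
  hence *: "(\<lambda>i. a ^ i) summable_on (UNIV :: nat set)"
    by (rule abs_summable_summable)
  have "(\<lambda>(i, j). a ^ i * a ^ j) summable_on (UNIV \<times> (UNIV :: nat set))"
    using * assms by (intro summable_on_SigmaI[where g = "\<lambda>i. a ^ i * (\<Sum>\<^sub>\<infinity>j. a ^ j)"])
      (auto intro!: has_sum_cmult_right summable_on_cmult_left has_sum_infsum)
  thus ?thesis by simp
qed

lemma convergent_fps2_iff_bound:
  "convergent_fps2 F \<longleftrightarrow> (\<exists>M s. M \<ge> 0 \<and> s > 0 \<and> (\<forall>i j. norm (F $ i $ j) \<le> M * s ^ (i + j)))"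
proof
  assume "convergent_fps2 F"
  then obtain \<rho> where \<rho>: "\<rho> > 0"
    and sm: "\<And>x y. norm x < \<rho> \<Longrightarrow> norm y < \<rho> \<Longrightarrow>
               (\<lambda>(i, j). F $ i $ j * x ^ i * y ^ j) summable_on UNIV"
    unfolding convergent_fps2_def by blast
  define x :: complex where "x = of_real (\<rho> / 2)"
  have nx: "norm x = \<rho> / 2" using \<rho> by (simp add: x_def)
  have "(\<lambda>(i, j). F $ i $ j * x ^ i * x ^ j) abs_summable_on UNIV"
    using sm[of x x] nx \<rho> by (simp add: summable_on_iff_abs_summable_on_complex)
  then obtain M where M: "\<And>A. finite A \<Longrightarrow>
      (\<Sum>p\<in>A. norm (case p of (i, j) \<Rightarrow> F $ i $ j * x ^ i * x ^ j)) \<le> M"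
    unfolding abs_summable_iff_bdd_above bdd_above_def by auto
  have b: "norm (F $ i $ j) \<le> M * (2 / \<rho>) ^ (i + j)" for i j
  proof -
    have "norm (F $ i $ j) * (\<rho> / 2) ^ (i + j) \<le> M"
      using M[of "{(i, j)}"] nx by (simp add: norm_mult norm_power power_add mult.assoc)
    thus ?thesis using \<rho> by (simp add: field_simps)
  qed
  have "M \<ge> 0" using M[of "{}"] by simp
  thus "\<exists>M s. M \<ge> 0 \<and> s > 0 \<and> (\<forall>i j. norm (F $ i $ j) \<le> M * s ^ (i + j))"
    using b \<rho> by (intro exI[of _ M] exI[of _ "2 / \<rho>"]) auto
next
  assume "\<exists>M s. M \<ge> 0 \<and> s > 0 \<and> (\<forall>i j. norm (F $ i $ j) \<le> M * s ^ (i + j))"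
  then obtain M s where M: "M \<ge> 0" and s: "s > 0"
    and b: "\<And>i j. norm (F $ i $ j) \<le> M * s ^ (i + j)" by blast
  have "(\<lambda>(i, j). F $ i $ j * x ^ i * y ^ j) summable_on UNIV"
    if x: "norm x < 1 / (2 * s)" and y: "norm y < 1 / (2 * s)" for x y
  proof -
    have "(\<lambda>p. M * (case p of (i, j) \<Rightarrow> (1/2) ^ i * (1/2) ^ j)) summable_on (UNIV :: (nat \<times> nat) set)"
      by (intro summable_on_cmult_right geometric2_summable) auto
    moreover have "norm (F $ i $ j * x ^ i * y ^ j) \<le> M * ((1/2) ^ i * (1/2) ^ j)" for i j
    proof -
      have "norm (F $ i $ j * x ^ i * y ^ j) = norm (F $ i $ j) * norm x ^ i * norm y ^ j"
        by (simp add: norm_mult norm_power)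
      also have "\<dots> \<le> (M * s ^ (i + j)) * (1 / (2 * s)) ^ i * (1 / (2 * s)) ^ j"
        using x y b[of i j] M s by (intro mult_mono power_mono) auto
      also have "\<dots> = M * ((1/2) ^ i * (1/2) ^ j)"
        using s by (simp add: power_add power_divide power_mult_distrib field_simps)
      finally show ?thesis .
    qed
    ultimately have "(\<lambda>p. case p of (i, j) \<Rightarrow> F $ i $ j * x ^ i * y ^ j) abs_summable_on UNIV"
      by (intro Infinite_Sum.abs_summable_on_comparison_test'[where g = "\<lambda>p. M * (case p of (i, j) \<Rightarrow> (1/2) ^ i * (1/2) ^ j)"])
         auto
    thus ?thesis by (rule abs_summable_summable)
  qed
  thus "convergent_fps2 F" unfolding convergent_fps2_def using s
    by (intro exI[of _ "1 / (2 * s)"]) auto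
qed

lemma convergent_fps2E:
  assumes "convergent_fps2 F"
  obtains M s where "M \<ge> 0" "s \<ge> 1" "\<And>i j. norm (F $ i $ j) \<le> M * s ^ (i + j)"
proof -
  obtain M s where M: "M \<ge> 0" "s > 0" "\<And>i j. norm (F $ i $ j) \<le> M * s ^ (i + j)"
    using assms unfolding convergent_fps2_iff_bound by blast
  have "norm (F $ i $ j) \<le> M * max 1 s ^ (i + j)" for i j
    by (rule order_trans[OF M(3)]) (use M in \<open>auto intro!: mult_left_mono power_mono\<close>)
  thus ?thesis using M(1) by (intro that[of M "max 1 s"]) auto
qed

lemma convergent_fps2I:
  assumes "M \<ge> 0" "s > 0" "\<And>i j. norm (F $ i $ j) \<le> M * s ^ (i + j)"
  shows "convergent_fps2 F"
  using assms unfolding convergent_fps2_iff_bound by blast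

lemma convergent_fps2_const: "convergent_fps2 (fps_const (fps_const c))"
  by (rule convergent_fps2I[of "norm c" 1]) auto

lemma convergent_fps2_add:
  assumes "convergent_fps2 F" "convergent_fps2 G"
  shows "convergent_fps2 (F + G)"
proof -
  obtain M s where F: "M \<ge> 0" "s \<ge> 1" "\<And>i j. norm (F $ i $ j) \<le> M * s ^ (i + j)"
    using assms(1) by (rule convergent_fps2E) blast
  obtain N t where G: "N \<ge> 0" "t \<ge> 1" "\<And>i j. norm (G $ i $ j) \<le> N * t ^ (i + j)"
    using assms(2) by (rule convergent_fps2E) blast
  have "norm ((F + G) $ i $ j) \<le> (M + N) * max s t ^ (i + j)" for i j
  proof -
    have "norm ((F + G) $ i $ j) \<le> M * s ^ (i + j) + N * t ^ (i + j)"
      using norm_triangle_le[OF add_mono[OF F(3) G(3)]] by simp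
    also have "\<dots> \<le> M * max s t ^ (i + j) + N * max s t ^ (i + j)"
      using F G by (intro add_mono mult_left_mono power_mono) auto
    finally show ?thesis by (simp add: algebra_simps)
  qed
  thus ?thesis using F G by (intro convergent_fps2I[of "M + N" "max s t"]) auto
qed

lemma convergent_fps2_uminus: "convergent_fps2 F \<Longrightarrow> convergent_fps2 (- F)"
  unfolding convergent_fps2_iff_bound by simp

lemma convergent_fps2_diff:
  "convergent_fps2 F \<Longrightarrow> convergent_fps2 G \<Longrightarrow> convergent_fps2 (F - G)"
  using convergent_fps2_add[of F "- G"] convergent_fps2_uminus[of G] by simp

lemma Suc_le_two_power: "real (Suc n) \<le> 2 ^ n"
  using Suc_leI[OF less_exp[of n]] by (metis of_nat_le_iff of_nat_numeral of_nat_power)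

lemma convergent_fps2_mult:
  assumes "convergent_fps2 F" "convergent_fps2 G"
  shows "convergent_fps2 (F * G)"
proof -
  obtain M s where F: "M \<ge> 0" "s \<ge> 1" "\<And>i j. norm (F $ i $ j) \<le> M * s ^ (i + j)"
    using assms(1) by (rule convergent_fps2E) blast
  obtain N t where G: "N \<ge> 0" "t \<ge> 1" "\<And>i j. norm (G $ i $ j) \<le> N * t ^ (i + j)"
    using assms(2) by (rule convergent_fps2E) blast
  define u where "u = max s t"
  have u: "u \<ge> 1" using F by (simp add: u_def)
  have Fu: "norm (F $ i $ j) \<le> M * u ^ (i + j)" for i j
    by (rule order_trans[OF F(3)]) (use F in \<open>auto simp: u_def intro!: mult_left_mono power_mono\<close>)
  have Gu: "norm (G $ i $ j) \<le> N * u ^ (i + j)" for i j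
    by (rule order_trans[OF G(3)]) (use G in \<open>auto simp: u_def intro!: mult_left_mono power_mono\<close>)
  have "norm ((F * G) $ n $ m) \<le> (M * N) * (2 * u) ^ (n + m)" for n m
  proof -
    have "(F * G) $ n $ m = (\<Sum>i=0..n. \<Sum>j=0..m. F $ i $ j * G $ (n - i) $ (m - j))"
      by (simp add: fps_mult_nth fps_sum_nth)
    also have "norm \<dots> \<le> (\<Sum>i=0..n. \<Sum>j=0..m. M * N * u ^ (n + m))"
    proof (intro order_trans[OF norm_sum] sum_mono)
      fix i j assume ij: "i \<in> {0..n}" "j \<in> {0..m}"
      have "norm (F $ i $ j * G $ (n - i) $ (m - j)) \<le>
              (M * u ^ (i + j)) * (N * u ^ ((n - i) + (m - j)))"
        unfolding norm_mult using F G u Fu Gu by (intro mult_mono) auto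
      also have "\<dots> = M * N * u ^ ((i + j) + ((n - i) + (m - j)))"
        by (simp only: power_add) (simp add: algebra_simps)
      also have "(i + j) + ((n - i) + (m - j)) = n + m" using ij by auto
      finally show "norm (F $ i $ j * G $ (n - i) $ (m - j)) \<le> M * N * u ^ (n + m)" .
    qed
    also have "\<dots> = (real (Suc n) * real (Suc m)) * (M * N * u ^ (n + m))"
      by (simp add: algebra_simps)
    also have "\<dots> \<le> (2 ^ n * 2 ^ m) * (M * N * u ^ (n + m))"
      using F G u by (intro mult_right_mono mult_mono Suc_le_two_power) auto
    also have "\<dots> = (M * N) * (2 * u) ^ (n + m)"
      by (simp add: power_add power_mult_distrib)
    finally show ?thesis .
  qed
  thus ?thesis using F G u by (intro convergent_fps2I[of "M * N" "2 * u"]) auto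
qed

lemma convergent_fps2_deriv_X:
  assumes "convergent_fps2 F"
  shows "convergent_fps2 (fps_deriv F)"
proof -
  obtain M s where F: "M \<ge> 0" "s \<ge> 1" "\<And>i j. norm (F $ i $ j) \<le> M * s ^ (i + j)"
    using assms(1) by (rule convergent_fps2E) blast
  have "norm (fps_deriv F $ i $ j) \<le> (M * s) * (2 * s) ^ (i + j)" for i j
  proof -
    have eq: "fps_deriv F $ i $ j = of_nat (Suc i) * F $ Suc i $ j"
      by (simp only: fps_deriv_nth fps_of_nat[symmetric] fps_mult_left_const_nth) simp
    have "norm (fps_deriv F $ i $ j) \<le> real (Suc i) * (M * s ^ (Suc i + j))"
      unfolding eq norm_mult norm_of_nat by (intro mult_left_mono F) auto
    also have "\<dots> \<le> 2 ^ (i + j) * (M * s ^ (Suc i + j))"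
      using F Suc_le_two_power[of i]
      by (intro mult_right_mono) (auto intro: order_trans power_increasing)
    also have "\<dots> = (M * s) * (2 * s) ^ (i + j)" by (simp add: power_mult_distrib)
    finally show ?thesis .
  qed
  thus ?thesis using F by (intro convergent_fps2I[of "M * s" "2 * s"]) auto
qed

lemma convergent_fps2_deriv_Y:
  assumes "convergent_fps2 F"
  shows "convergent_fps2 (Abs_fps (\<lambda>i. fps_deriv (F $ i)))"
proof -
  obtain M s where F: "M \<ge> 0" "s \<ge> 1" "\<And>i j. norm (F $ i $ j) \<le> M * s ^ (i + j)"
    using assms(1) by (rule convergent_fps2E) blast
  have "norm (Abs_fps (\<lambda>i. fps_deriv (F $ i)) $ i $ j) \<le> (M * s) * (2 * s) ^ (i + j)" for i j
  proof -
    have eq: "Abs_fps (\<lambda>i. fps_deriv (F $ i)) $ i $ j = of_nat (Suc j) * F $ i $ Suc j"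
      by simp
    have "norm (Abs_fps (\<lambda>i. fps_deriv (F $ i)) $ i $ j) \<le> real (Suc j) * (M * s ^ (i + Suc j))"
      unfolding eq norm_mult norm_of_nat by (intro mult_left_mono F) auto
    also have "\<dots> \<le> 2 ^ (i + j) * (M * s ^ (i + Suc j))"
      using F Suc_le_two_power[of j]
      by (intro mult_right_mono) (auto intro: order_trans power_increasing)
    also have "\<dots> = (M * s) * (2 * s) ^ (i + j)" by (simp add: power_mult_distrib)
    finally show ?thesis .
  qed
  thus ?thesis using F by (intro convergent_fps2I[of "M * s" "2 * s"]) auto
qed

typedef conv_series = "{F :: complex fps fps. convergent_fps2 F}"
  morphisms fps2_of Abs_conv_series
  using convergent_fps2_const[of 0] by blast

setup_lifting type_definition_conv_series

instantiation conv_series :: idom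
begin

lift_definition zero_conv_series :: conv_series is 0
  using convergent_fps2_const[of 0] by simp

lift_definition one_conv_series :: conv_series is 1
  using convergent_fps2_const[of 1] by simp

lift_definition plus_conv_series :: "conv_series \<Rightarrow> conv_series \<Rightarrow> conv_series" is "(+)"
  by (rule convergent_fps2_add)

lift_definition minus_conv_series :: "conv_series \<Rightarrow> conv_series \<Rightarrow> conv_series" is "(-)"
  by (rule convergent_fps2_diff)

lift_definition uminus_conv_series :: "conv_series \<Rightarrow> conv_series" is uminus
  by (rule convergent_fps2_uminus)

lift_definition times_conv_series :: "conv_series \<Rightarrow> conv_series \<Rightarrow> conv_series" is "(*)"
  by (rule convergent_fps2_mult)

instance
  by standard (transfer, simp add: algebra_simps)+

end

lift_definition const_series :: "complex \<Rightarrow> conv_series" is "\<lambda>c. fps_const (fps_const c)"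
  by (rule convergent_fps2_const)

lift_definition deriv_X :: "conv_series \<Rightarrow> conv_series" is fps_deriv
  by (rule convergent_fps2_deriv_X)

lift_definition deriv_Y :: "conv_series \<Rightarrow> conv_series" is "\<lambda>F. Abs_fps (\<lambda>i. fps_deriv (F $ i))"
  by (rule convergent_fps2_deriv_Y)


section \<open>Ideals, codimension, and the invariants of plane curve germs\<close>

abbreviation series_ring :: "conv_series ring" where
  "series_ring \<equiv> ring_of_type_algebra"

definition ideal_gen :: "conv_series set \<Rightarrow> conv_series set" where
  "ideal_gen S = genideal series_ring S"

text \<open>
  The complex dimension of the quotient ring by the ideal \<open>A\<close>, where the field of scalars is the
  image of the constant series in the quotient.  The library's \<^const>\<open>ring.dim\<close> is
  specified only in finite dimension.
\<close>

definition quot_dim :: "conv_series set \<Rightarrow> nat" where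
  "quot_dim A =
     ring.dim (series_ring Quot A)
       (range (\<lambda>c. A +>\<^bsub>series_ring\<^esub> const_series c))
       (carrier (series_ring Quot A))"

definition intersection_mult :: "conv_series \<Rightarrow> conv_series \<Rightarrow> nat" where
  "intersection_mult g h = quot_dim (ideal_gen {g, h})"

definition tjurina :: "conv_series \<Rightarrow> nat" where
  "tjurina g = quot_dim (ideal_gen {g, deriv_X g, deriv_Y g})"

definition milnor :: "conv_series \<Rightarrow> nat" where
  "milnor g = intersection_mult (deriv_X g) (deriv_Y g)"

end

theory Submission
  imports Defs "HOL-Computational_Algebra.Fundamental_Theorem_Algebra"
begin

text \<open>
  Both statements reduce to orders of vanishing along Puiseux parametrizations \<open>X = t\<^sup>N\<close>, \<open>Y = y(t)\<close>.
  For \<open>Q\<close> not divisible by \<open>X\<close> one has \<open>Q(t\<^sup>N, Y) = unit * \<Prod>\<^sub>k (Y - y\<^sub>k(t))\<close>, and therefore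
  \<open>N * I(Q, h) = \<Sum>\<^sub>k ord h(t\<^sup>N, y\<^sub>k(t))\<close>.  Applied to \<open>Q = f\<^sub>Y\<close> this gives Teissier's formula
  \<open>I(f, f\<^sub>Y) = \<mu>(f) + I(f, X) - 1\<close>, and since \<open>I(fg, (fg)\<^sub>Y) = I(f, f\<^sub>Y) + I(g, g\<^sub>Y) + 2 I(f, g)\<close> one gets
  \<open>\<mu>(fg) + 1 = \<mu>(f) + \<mu>(g) + 2 I(f, g)\<close>.  A component \<open>X\<close> is treated separately.

  For the Tjurina number write \<open>T(h) = \<langle>h, h\<^sub>X, h\<^sub>Y\<rangle>\<close> and \<open>S = f T(g) + g T(f)\<close>, an ideal between \<open>T(fg)\<close> and
  \<open>\<langle>f, g\<rangle>\<close> with \<open>dim \<langle>f, g\<rangle>/S \<le> \<tau>(f) + \<tau>(g)\<close>.  Multiplication by \<open>g\<close> maps \<open>T(f)\<close> onto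
  \<open>S/T(fg)\<close> and kills \<open>g T(f) + \<langle>f\<rangle>\<close> as well as the Jacobian determinant \<open>\<delta> = f\<^sub>X g\<^sub>Y - f\<^sub>Y g\<^sub>X\<close>.
  The quotient of \<open>T(f)\<close> by \<open>g T(f) + \<langle>f\<rangle>\<close> has dimension at most \<open>I(f, g)\<close>, and \<open>\<delta>\<close> is not zero in it,
  because \<open>dg/g\<close> has a pole on the branches of \<open>f\<close>.  This gives \<open>dim S/T(fg) \<le> I(f, g) - 1\<close>.

  All dimensions are computed in the formal power series ring.  Convergence only enters through
  Weierstrass division, which shows that coprime convergent series generate an ideal of finite
  codimension.
\<close>

section \<open>Relative dimension of complex subspaces\<close>

text \<open>The invariants are natural numbers that are specified only in finite dimension, so no
  equation between them can be proved before finiteness is known. Hence the conditions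
  \<open>cofin\<close> and \<open>cofinF\<close> (powers of X and of Y lie in the ideal) accompany
  the whole proof. Dimensions are counted by chains of subspaces of the ring itself, without
  quotient spaces, and for all complex algebras at once, because convergent series, formal series in
  two variables and formal series in one variable are compared with each other. Irreducibility in
  the convergent ring gives no direct control over formal divisors. Finiteness is therefore proved
  for convergent series; an ideal that contains powers of X and Y keeps its quotient under
  completion, and from there on the Puiseux parametrizations may be formal. A parametrization X =
  t^N does not see the component X, whence the conditions \<open>at0 f\<close> \<noteq> 0. In the
  Tjurina bound the two curves can be exchanged. The Milnor number of X g is computed from its
  derivatives g + X g_X and X g_Y.\<close>

class calg = comm_ring_1 +
  fixes sc :: "complex \<Rightarrow> 'a"
  assumes sc_add: "sc (a + b) = sc a + sc b"
    and sc_mult: "sc (a * b) = sc a * sc b"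
    and sc_1 [simp]: "sc 1 = 1"
begin

lemma sc_0 [simp]: "sc 0 = 0"
  using sc_add[of 0 0] by simp

lemma sc_uminus: "sc (- a) = - sc a"
  using sc_add[of a "- a"] by (simp add: eq_neg_iff_add_eq_0 add.commute)

lemma sc_inverse_mult: "c \<noteq> 0 \<Longrightarrow> sc (inverse c) * (sc c * v) = v"
  by (metis mult.assoc mult.left_neutral sc_1 sc_mult left_inverse)

end

definition csub :: "'a :: calg set \<Rightarrow> bool" where
  "csub V \<longleftrightarrow> 0 \<in> V \<and> (\<forall>x\<in>V. \<forall>y\<in>V. x + y \<in> V) \<and> (\<forall>c. \<forall>x\<in>V. sc c * x \<in> V)"

lemma csubI:
  "0 \<in> V \<Longrightarrow> (\<And>x y. x \<in> V \<Longrightarrow> y \<in> V \<Longrightarrow> x + y \<in> V) \<Longrightarrow> (\<And>c x. x \<in> V \<Longrightarrow> sc c * x \<in> V) \<Longrightarrow> csub V"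
  unfolding csub_def by blast

lemma csubD:
  assumes "csub V"
  shows "0 \<in> V" "x \<in> V \<Longrightarrow> y \<in> V \<Longrightarrow> x + y \<in> V" "x \<in> V \<Longrightarrow> sc c * x \<in> V"
    "x \<in> V \<Longrightarrow> - x \<in> V" "x \<in> V \<Longrightarrow> y \<in> V \<Longrightarrow> x - y \<in> V"
proof -
  show "0 \<in> V" "x \<in> V \<Longrightarrow> y \<in> V \<Longrightarrow> x + y \<in> V" "x \<in> V \<Longrightarrow> sc c * x \<in> V" for x y c
    using assms unfolding csub_def by auto
  show neg: "- x \<in> V" if "x \<in> V" for x
    using assms that unfolding csub_def by (metis mult_minus1 sc_1 sc_uminus)
  show "x - y \<in> V" if "x \<in> V" "y \<in> V" for x y
    using assms that neg[of y] unfolding csub_def by (metis diff_conv_add_uminus)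
qed

lemma csub_UNIV [simp]: "csub UNIV"
  by (simp add: csub_def)

lemma csub_Int: "csub U \<Longrightarrow> csub V \<Longrightarrow> csub (U \<inter> V)"
  unfolding csub_def by blast

definition line_ext :: "'a :: calg set \<Rightarrow> 'a \<Rightarrow> 'a set" where
  "line_ext U v = {u + sc c * v | u c. u \<in> U}"

lemma line_extI: "u \<in> U \<Longrightarrow> u + sc c * v \<in> line_ext U v"
  unfolding line_ext_def by blast

lemma line_extE:
  assumes "x \<in> line_ext U v"
  obtains u c where "u \<in> U" "x = u + sc c * v"
  using assms unfolding line_ext_def by blast

lemma csub_line_ext:
  assumes "csub U" shows "csub (line_ext U v)"
proof (rule csubI)
  show "0 \<in> line_ext U v" using line_extI[OF csubD(1)[OF assms], of 0 v] by simp
next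
  fix x y assume "x \<in> line_ext U v" "y \<in> line_ext U v"
  then obtain a c b d where "a \<in> U" "x = a + sc c * v" "b \<in> U" "y = b + sc d * v"
    by (metis line_extE)
  thus "x + y \<in> line_ext U v"
    using line_extI[of "a + b" U "c + d" v] csubD(2)[OF assms]
    by (simp add: sc_add algebra_simps)
next
  fix d x assume "x \<in> line_ext U v"
  then obtain a c where "a \<in> U" "x = a + sc c * v"
    by (metis line_extE)
  thus "sc d * x \<in> line_ext U v"
    using line_extI[of "sc d * a" U "d * c" v] csubD(3)[OF assms]
    by (simp add: sc_mult algebra_simps)
qed

lemma line_ext_superset: "U \<subseteq> line_ext U v"
  using line_extI[of _ U 0 v] by auto

lemma line_ext_mem: "csub U \<Longrightarrow> v \<in> line_ext U v"
  using line_extI[of 0 U 1 v] csubD(1) by auto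

lemma line_ext_least: "csub W \<Longrightarrow> U \<subseteq> W \<Longrightarrow> v \<in> W \<Longrightarrow> line_ext U v \<subseteq> W"
  unfolding line_ext_def using csubD(2,3) by blast

lemma line_ext_eq:
  assumes "csub U" "w \<in> line_ext U v" "w \<notin> U"
  shows "line_ext U w = line_ext U v"
proof
  show "line_ext U w \<subseteq> line_ext U v"
    using assms by (intro line_ext_least csub_line_ext line_ext_superset)
  obtain u c where uc: "u \<in> U" "w = u + sc c * v" using assms(2) by (rule line_extE)
  have "c \<noteq> 0" using uc assms(3) by auto
  hence "v = sc (inverse c) * (w - u)"
    using uc by (simp add: sc_inverse_mult)
  moreover have "sc (inverse c) * (w - u) \<in> line_ext U w"
    using csubD[OF csub_line_ext[OF assms(1), of w]] line_ext_mem[OF assms(1)] line_ext_superset uc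
    by (meson subsetD)
  ultimately show "line_ext U v \<subseteq> line_ext U w"
    using assms by (intro line_ext_least csub_line_ext line_ext_superset) auto
qed

text \<open>For subspaces V of U this is dim U/V = n, as a chain of lines adjoined one at a time. It
  copies the library's inductive \<open>dimension\<close> with V in the place of zero, so that
  \<open>quot_dim_eqI\<close> can match the two rule by rule.\<close>

inductive reldim :: "'a :: calg set \<Rightarrow> nat \<Rightarrow> 'a set \<Rightarrow> bool" for V where
  reldim_0: "reldim V 0 V"
| reldim_Suc: "reldim V n U \<Longrightarrow> v \<notin> U \<Longrightarrow> reldim V (Suc n) (line_ext U v)"

lemma reldim_csub: "reldim V n U \<Longrightarrow> csub V \<Longrightarrow> csub U"
  by (induction rule: reldim.induct) (auto intro: csub_line_ext)

lemma reldim_subset: "reldim V n U \<Longrightarrow> V \<subseteq> U"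
  by (induction rule: reldim.induct) (use line_ext_superset in blast)+

lemma reldim_trans: "reldim U n T \<Longrightarrow> reldim V m U \<Longrightarrow> reldim V (m + n) T"
  by (induction rule: reldim.induct) (auto intro: reldim_Suc)

lemma reldim_0_iff: "reldim V 0 U \<longleftrightarrow> U = V"
  by (auto intro: reldim_0 elim: reldim.cases)

definition clin :: "('a :: calg \<Rightarrow> 'b :: calg) \<Rightarrow> bool" where
  "clin L \<longleftrightarrow> (\<forall>x y. L (x + y) = L x + L y) \<and> (\<forall>c x. L (sc c * x) = sc c * L x)"

lemma clin_mult [simp]: "clin ((*) a)"
  by (auto simp: clin_def algebra_simps)

lemma clin_0: "clin L \<Longrightarrow> L 0 = 0"
  unfolding clin_def by (metis add_cancel_right_right add_0)

definition im_sum :: "('a :: calg \<Rightarrow> 'b :: calg) \<Rightarrow> 'a set \<Rightarrow> 'b set \<Rightarrow> 'b set" where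
  "im_sum L U V = {L u + v | u v. u \<in> U \<and> v \<in> V}"

lemma csub_im_sum:
  assumes "clin L" "csub U" "csub V" shows "csub (im_sum L U V)"
proof (rule csubI)
  show "0 \<in> im_sum L U V"
    unfolding im_sum_def using clin_0[OF assms(1)] csubD(1)[OF assms(2)] csubD(1)[OF assms(3)]
    by force
next
  fix x y assume "x \<in> im_sum L U V" "y \<in> im_sum L U V"
  then obtain a b c d where "a \<in> U" "b \<in> V" "x = L a + b" "c \<in> U" "d \<in> V" "y = L c + d"
    unfolding im_sum_def by blast
  moreover have "L (a + c) = L a + L c" using assms(1) by (simp add: clin_def)
  ultimately have "a + c \<in> U" "b + d \<in> V" "x + y = L (a + c) + (b + d)"
    using csubD(2)[OF assms(2)] csubD(2)[OF assms(3)] by (auto simp: algebra_simps)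
  thus "x + y \<in> im_sum L U V" unfolding im_sum_def by blast
next
  fix e x assume "x \<in> im_sum L U V"
  then obtain a b where "a \<in> U" "b \<in> V" "x = L a + b"
    unfolding im_sum_def by blast
  moreover have "L (sc e * a) = sc e * L a" using assms(1) by (simp add: clin_def)
  ultimately have "sc e * a \<in> U" "sc e * b \<in> V" "sc e * x = L (sc e * a) + sc e * b"
    using csubD(3)[OF assms(2)] csubD(3)[OF assms(3)] by (auto simp: algebra_simps)
  thus "sc e * x \<in> im_sum L U V" unfolding im_sum_def by blast
qed

lemma im_sum_line_ext:
  assumes "clin L" shows "im_sum L (line_ext U v) V = line_ext (im_sum L U V) (L v)"
proof -
  have "L (u + sc c * v) + w = (L u + w) + sc c * L v" for u c w
    using assms by (simp add: clin_def)
  thus ?thesis unfolding im_sum_def line_ext_def by (auto; metis)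
qed

text \<open>L induces a map from U/V onto (L U + V')/V'. The dimension can only drop, and it does
  not drop when this map is injective, which is the premise of the inner implication.\<close>

lemma reldim_image:
  assumes "reldim V n U" "csub V" "clin L" "csub V'" "L ` V \<subseteq> V'"
  shows "\<exists>k\<le>n. reldim V' k (im_sum L U V') \<and> ((\<forall>u\<in>U. L u \<in> V' \<longrightarrow> u \<in> V) \<longrightarrow> k = n)"
  using assms(1)
proof (induction rule: reldim.induct)
  case reldim_0
  have "im_sum L V V' = V'"
    unfolding im_sum_def
  proof safe
    fix u v assume "u \<in> V" "v \<in> V'"
    thus "L u + v \<in> V'" using assms(5) csubD(2)[OF assms(4)] by blast
  next
    fix x assume "x \<in> V'"
    thus "\<exists>u v. x = L u + v \<and> u \<in> V \<and> v \<in> V'"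
      using clin_0[OF assms(3)] csubD(1)[OF assms(2)] by (intro exI[of _ 0] exI[of _ x]) auto
  qed
  thus ?case by (auto intro: reldim.reldim_0)
next
  case (reldim_Suc n U v)
  then obtain k where k: "k \<le> n" "reldim V' k (im_sum L U V')"
      "(\<forall>u\<in>U. L u \<in> V' \<longrightarrow> u \<in> V) \<longrightarrow> k = n" by blast
  have csU: "csub U" using reldim_csub[OF reldim_Suc(1) assms(2)] .
  have csI: "csub (im_sum L U V')" by (rule csub_im_sum[OF assms(3) csU assms(4)])
  show ?case
  proof (cases "L v \<in> im_sum L U V'")
    case True
    hence "line_ext (im_sum L U V') (L v) = im_sum L U V'"
      using line_ext_least[OF csI order_refl True] line_ext_superset by blast
    \<comment> \<open>If L v = L u + w with u in U and w in V', then v - u is sent into V' without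
      lying in V, so the induced map is not injective.\<close>
    moreover have "\<not> (\<forall>u\<in>line_ext U v. L u \<in> V' \<longrightarrow> u \<in> V)"
    proof
      assume *: "\<forall>u\<in>line_ext U v. L u \<in> V' \<longrightarrow> u \<in> V"
      obtain u w where uw: "u \<in> U" "w \<in> V'" "L v = L u + w"
        using True unfolding im_sum_def by blast
      have "L v = L (v - u) + L u"
        using assms(3) unfolding clin_def by (metis diff_add_cancel)
      hence "L (v - u) = w" using uw by (simp add: algebra_simps)
      moreover have "v - u \<in> line_ext U v"
        using csubD(5)[OF csub_line_ext[OF csU]] line_ext_mem[OF csU] line_ext_superset uw(1) by blast
      ultimately have "v - u \<in> V" using * uw by blast
      hence "v - u \<in> U" using reldim_subset[OF reldim_Suc(1)] by blast
      hence "v \<in> U" using csubD(2)[OF csU \<open>v - u \<in> U\<close> uw(1)] by simp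
      thus False using reldim_Suc by blast
    qed
    ultimately show ?thesis using k im_sum_line_ext[OF assms(3), of U v V']
      by (intro exI[of _ k]) auto
  next
    case False
    hence "reldim V' (Suc k) (line_ext (im_sum L U V') (L v))"
      using k by (intro reldim.reldim_Suc)
    moreover have "(\<forall>u\<in>line_ext U v. L u \<in> V' \<longrightarrow> u \<in> V) \<longrightarrow> k = n"
      using k(3) line_ext_superset[of U v] by blast
    ultimately show ?thesis using k im_sum_line_ext[OF assms(3), of U v V']
      by (intro exI[of _ "Suc k"]) auto
  qed
qed

text \<open>Additivity of dimension. In the induction step, if W is not contained in the last proper
  space U of the chain, some w in W can replace the last vector v. Then W is W \<inter> U plus the
  line of w, and U/(W \<inter> U) is isomorphic to (U + W)/W.\<close>

lemma reldim_between:
  assumes "reldim V n U" "csub V" "csub W" "V \<subseteq> W" "W \<subseteq> U"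
  shows "\<exists>k l. n = k + l \<and> reldim V k W \<and> reldim W l U"
  using assms(1,3-5)
proof (induction arbitrary: W rule: reldim.induct)
  case reldim_0
  thus ?case using reldim.reldim_0[of V] by auto
next
  case (reldim_Suc n U v)
  have csU: "csub U" using reldim_csub[OF reldim_Suc(1) assms(2)] .
  show ?case
  proof (cases "W \<subseteq> U")
    case True
    then obtain k l where "n = k + l" "reldim V k W" "reldim W l U"
      using reldim_Suc by blast
    thus ?thesis using reldim_Suc(2) by (intro exI[of _ k] exI[of _ "Suc l"]) (auto intro: reldim.reldim_Suc)
  next
    case False
    then obtain w where w: "w \<in> W" "w \<notin> U" by blast
    have UwUv: "line_ext U w = line_ext U v"
      using line_ext_eq[OF csU _ w(2)] w(1) reldim_Suc by blast
    define W' where "W' = W \<inter> U"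
    have csW': "csub W'" unfolding W'_def using csU reldim_Suc by (intro csub_Int)
    have "V \<subseteq> W'" using reldim_subset[OF reldim_Suc(1)] reldim_Suc unfolding W'_def by blast
    then obtain k l where kl: "n = k + l" "reldim V k W'" "reldim W' l U"
      using reldim_Suc.IH[OF csW'] unfolding W'_def by blast
    have W: "W = line_ext W' w"
    proof
      show "line_ext W' w \<subseteq> W"
        by (rule line_ext_least) (use reldim_Suc w in \<open>auto simp: W'_def\<close>)
      show "W \<subseteq> line_ext W' w"
      proof
        fix x assume x: "x \<in> W"
        then obtain u c where uc: "u \<in> U" "x = u + sc c * w"
          using reldim_Suc UwUv by (metis line_extE subsetD)
        have "u = x - sc c * w" using uc by simp
        hence "u \<in> W" using csubD[OF reldim_Suc(4)] x w by blast
        thus "x \<in> line_ext W' w" using uc unfolding W'_def by (auto intro: line_extI)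
      qed
    qed
    have "reldim V (Suc k) W" unfolding W using kl w by (intro reldim.reldim_Suc) (auto simp: W'_def)
    moreover have "\<exists>j\<le>l. reldim W j (im_sum (\<lambda>x. x) U W) \<and> ((\<forall>u\<in>U. u \<in> W \<longrightarrow> u \<in> W') \<longrightarrow> j = l)"
      by (rule reldim_image[OF kl(3) csW'])
        (use reldim_Suc in \<open>auto simp: clin_def W'_def\<close>)
    hence "reldim W l (im_sum (\<lambda>x. x) U W)" unfolding W'_def by blast
    moreover have "im_sum (\<lambda>x. x) U W = line_ext U v"
    proof
      show "im_sum (\<lambda>x. x) U W \<subseteq> line_ext U v"
      proof
        fix x assume "x \<in> im_sum (\<lambda>x. x) U W"
        then obtain u y where "u \<in> U" "y \<in> W" "x = u + y" unfolding im_sum_def by blast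
        moreover have "u \<in> line_ext U v" "y \<in> line_ext U v"
          using calculation line_ext_superset[of U v] reldim_Suc(6) by blast+
        ultimately show "x \<in> line_ext U v" using csubD(2)[OF csub_line_ext[OF csU, of v]] by simp
      qed
      show "line_ext U v \<subseteq> im_sum (\<lambda>x. x) U W"
      proof
        fix x assume "x \<in> line_ext U v"
        then obtain u c where "u \<in> U" "x = u + sc c * w" unfolding UwUv[symmetric] by (rule line_extE)
        moreover have "sc c * w \<in> W" using csubD(3)[OF reldim_Suc(4) w(1)] .
        ultimately show "x \<in> im_sum (\<lambda>x. x) U W" unfolding im_sum_def by blast
      qed
    qed
    ultimately show ?thesis using kl by (intro exI[of _ "Suc k"] exI[of _ l]) auto
  qed
qed

text \<open>The last proper space of the first chain is intermediate for the second one, and the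
  step above it takes at least one dimension.\<close>

lemma reldim_le:
  assumes "reldim V m U" "reldim V n U" "csub V"
  shows "m \<le> n"
  using assms(1,2)
proof (induction arbitrary: n rule: reldim.induct)
  case (reldim_Suc m U v)
  have csU: "csub U" using reldim_csub[OF reldim_Suc(1) assms(3)] .
  obtain k l where kl: "n = k + l" "reldim V k U" "reldim U l (line_ext U v)"
    using reldim_between[OF reldim_Suc.prems assms(3) csU reldim_subset[OF reldim_Suc(1)] line_ext_superset] by blast
  have "l \<noteq> 0"
    using kl(3) line_ext_mem[OF csU, of v] reldim_Suc(2) by (metis reldim_0_iff)
  thus ?case using reldim_Suc.IH[OF kl(2)] kl(1) by simp
qed simp

lemma reldim_unique: "reldim V n U \<Longrightarrow> reldim V m U \<Longrightarrow> csub V \<Longrightarrow> n = m"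
  by (intro order_antisym reldim_le)

definition fincod :: "'a :: calg set \<Rightarrow> bool" where
  "fincod V \<longleftrightarrow> csub V \<and> (\<exists>n. reldim V n UNIV)"

definition codim :: "'a :: calg set \<Rightarrow> nat" where
  "codim V = (THE n. reldim V n UNIV)"

lemma codim_eqI: "csub V \<Longrightarrow> reldim V n UNIV \<Longrightarrow> codim V = n"
  unfolding codim_def using reldim_unique by blast

lemma fincodI: "csub V \<Longrightarrow> reldim V n UNIV \<Longrightarrow> fincod V"
  unfolding fincod_def by blast

lemma fincod_reldim: "fincod V \<Longrightarrow> reldim V (codim V) UNIV"
  unfolding fincod_def using codim_eqI by blast

lemma fincod_csub: "fincod V \<Longrightarrow> csub V"
  unfolding fincod_def by blast

lemma codim_mono:
  assumes "fincod V" "V \<subseteq> U" "csub U"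
  shows "fincod U" "reldim V (codim V - codim U) U" "codim U \<le> codim V"
proof -
  obtain k l where kl: "codim V = k + l" "reldim V k U" "reldim U l UNIV"
    using reldim_between[OF fincod_reldim[OF assms(1)] fincod_csub[OF assms(1)] assms(3,2)] by auto
  show "fincod U" using kl assms fincodI by blast
  have "codim U = l" using kl assms codim_eqI by blast
  thus "reldim V (codim V - codim U) U" "codim U \<le> codim V" using kl by auto
qed

lemma codim_less:
  assumes "fincod V" "V \<subset> U" "csub U"
  shows "codim U < codim V"
proof (rule ccontr)
  assume "\<not> codim U < codim V"
  hence "reldim V 0 U" using codim_mono(2)[OF assms(1) _ assms(3)] assms(2) by (simp add: psubset_imp_subset)
  thus False using assms(2) by (simp add: reldim_0_iff)
qed

lemma codim_add:
  assumes "fincod U" "reldim V n U" "csub V"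
  shows "fincod V" "codim V = n + codim U"
proof -
  have "reldim V (n + codim U) UNIV" using reldim_trans[OF fincod_reldim[OF assms(1)] assms(2)] .
  thus "fincod V" "codim V = n + codim U" using assms(3) fincodI codim_eqI by blast+
qed

text \<open>This is dim (L U + V')/V' \<le> dim U/V, in a form without subtraction of natural
  numbers.\<close>

lemma codim_image_le:
  assumes "clin L" "fincod V" "V \<subseteq> U" "csub U" "csub V'" "L ` V \<subseteq> V'" "fincod (im_sum L U V')"
  shows "fincod V'" "codim V' + codim U \<le> codim (im_sum L U V') + codim V"
proof -
  note r = codim_mono[OF assms(2-4)]
  obtain k where k: "k \<le> codim V - codim U" "reldim V' k (im_sum L U V')"
    using reldim_image[OF r(2) fincod_csub[OF assms(2)] assms(1,5,6)] by blast
  note s = codim_add[OF assms(7) k(2) assms(5)]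
  show "fincod V'" by (rule s(1))
  show "codim V' + codim U \<le> codim (im_sum L U V') + codim V" using s(2) k(1) r(3) by linarith
qed

text \<open>The exact sequence 0 -> A/V -> B/V' -> B/(L A + V') -> 0 for the two algebras A and B.
  Additivity of intersection numbers, invariance under completion and the effect of ramification are
  all instances.\<close>

lemma codim_image_eq:
  assumes "clin L" "fincod V" "csub V'" "\<And>x. L x \<in> V' \<longleftrightarrow> x \<in> V" "fincod (im_sum L UNIV V')"
  shows "fincod V'" "codim V' = codim (im_sum L UNIV V') + codim V"
proof -
  obtain k where k: "k \<le> codim V" "reldim V' k (im_sum L UNIV V')"
      "(\<forall>u\<in>UNIV. L u \<in> V' \<longrightarrow> u \<in> V) \<longrightarrow> k = codim V"
    using reldim_image[OF fincod_reldim[OF assms(2)] fincod_csub[OF assms(2)] assms(1,3)] assms(4) by blast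
  note s = codim_add[OF assms(5) k(2) assms(3)]
  show "fincod V'" by (rule s(1))
  show "codim V' = codim (im_sum L UNIV V') + codim V" using s(2) k(3) assms(4) by simp
qed

lemma codim_UNIV [simp]: "codim (UNIV :: 'a :: calg set) = 0" and fincod_UNIV [simp]: "fincod (UNIV :: 'a :: calg set)"
  using codim_eqI[OF csub_UNIV reldim_0] fincodI[OF csub_UNIV reldim_0] by auto

section \<open>Ideals and their codimension\<close>

definition isidl :: "'a :: comm_ring_1 set \<Rightarrow> bool" where
  "isidl V \<longleftrightarrow> 0 \<in> V \<and> (\<forall>x\<in>V. \<forall>y\<in>V. x + y \<in> V) \<and> (\<forall>r. \<forall>x\<in>V. r * x \<in> V)"

lemma isidlD:
  assumes "isidl V"
  shows "0 \<in> V" "x \<in> V \<Longrightarrow> y \<in> V \<Longrightarrow> x + y \<in> V" "x \<in> V \<Longrightarrow> r * x \<in> V" "x \<in> V \<Longrightarrow> x * r \<in> V"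
    "x \<in> V \<Longrightarrow> - x \<in> V" "x \<in> V \<Longrightarrow> y \<in> V \<Longrightarrow> x - y \<in> V"
proof -
  show "0 \<in> V" "x \<in> V \<Longrightarrow> y \<in> V \<Longrightarrow> x + y \<in> V" "x \<in> V \<Longrightarrow> r * x \<in> V" for x y r
    using assms unfolding isidl_def by auto
  thus "x \<in> V \<Longrightarrow> x * r \<in> V" for x r by (metis mult.commute)
  show neg: "x \<in> V \<Longrightarrow> - x \<in> V" for x
    using assms unfolding isidl_def by (metis mult_minus1)
  show "x \<in> V \<Longrightarrow> y \<in> V \<Longrightarrow> x - y \<in> V" for x y
    using assms neg[of y] unfolding isidl_def by (metis diff_conv_add_uminus)
qed

lemma isidl_csub: "isidl V \<Longrightarrow> csub V"
  unfolding isidl_def csub_def by blast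

lemma isidl_UNIV_iff: "isidl V \<Longrightarrow> V = UNIV \<longleftrightarrow> 1 \<in> V"
  by (metis UNIV_I UNIV_eq_I isidlD(3) mult.right_neutral)

lemma isidl_sum: "isidl V \<Longrightarrow> (\<And>i. i \<in> A \<Longrightarrow> f i \<in> V) \<Longrightarrow> sum f A \<in> V"
  by (induction A rule: infinite_finite_induct) (auto intro: isidlD)

definition gen2 :: "'a :: comm_ring_1 \<Rightarrow> 'a \<Rightarrow> 'a set" where
  "gen2 a b = {x * a + y * b | x y. True}"

definition gen3 :: "'a :: comm_ring_1 \<Rightarrow> 'a \<Rightarrow> 'a \<Rightarrow> 'a set" where
  "gen3 a b c = {x * a + y * b + z * c | x y z. True}"

lemma gen2I: "x * a + y * b \<in> gen2 a b"
  unfolding gen2_def by blast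

lemma gen2E: "v \<in> gen2 a b \<Longrightarrow> (\<And>x y. v = x * a + y * b \<Longrightarrow> P) \<Longrightarrow> P"
  unfolding gen2_def by blast

lemma gen3I: "x * a + y * b + z * c \<in> gen3 a b c"
  unfolding gen3_def by blast

lemma gen3E: "v \<in> gen3 a b c \<Longrightarrow> (\<And>x y z. v = x * a + y * b + z * c \<Longrightarrow> P) \<Longrightarrow> P"
  unfolding gen3_def by blast

lemma gen2_gen3: "gen2 a b = gen3 a b 0"
  unfolding gen2_def gen3_def by simp

lemma gen3_mem: "a \<in> gen3 a b c" "b \<in> gen3 a b c" "c \<in> gen3 a b c"
  using gen3I[of 1 a 0 b 0 c] gen3I[of 0 a 1 b 0 c] gen3I[of 0 a 0 b 1 c] by auto

lemma gen2_mem: "a \<in> gen2 a b" "b \<in> gen2 a b"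
  unfolding gen2_gen3 by (rule gen3_mem)+

lemma isidl_gen3: "isidl (gen3 a b c)"
  unfolding isidl_def
proof (intro conjI ballI allI)
  show "0 \<in> gen3 a b c" using gen3I[of 0 a 0 b 0 c] by simp
  fix v w assume "v \<in> gen3 a b c" "w \<in> gen3 a b c"
  then obtain x y z x' y' z' where "v = x * a + y * b + z * c" "w = x' * a + y' * b + z' * c"
    by (metis gen3E)
  hence "v + w = (x + x') * a + (y + y') * b + (z + z') * c" by (simp add: algebra_simps)
  thus "v + w \<in> gen3 a b c" using gen3I by metis
next
  fix r v assume "v \<in> gen3 a b c"
  then obtain x y z where "v = x * a + y * b + z * c" by (metis gen3E)
  hence "r * v = (r * x) * a + (r * y) * b + (r * z) * c" by (simp add: algebra_simps)
  thus "r * v \<in> gen3 a b c" using gen3I by metis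
qed

lemma isidl_gen2: "isidl (gen2 a b)"
  unfolding gen2_gen3 by (rule isidl_gen3)

lemma gen3_least: "isidl V \<Longrightarrow> a \<in> V \<Longrightarrow> b \<in> V \<Longrightarrow> c \<in> V \<Longrightarrow> gen3 a b c \<subseteq> V"
  by (auto elim!: gen3E intro!: isidlD(2,3))

lemma gen2_least: "isidl V \<Longrightarrow> a \<in> V \<Longrightarrow> b \<in> V \<Longrightarrow> gen2 a b \<subseteq> V"
  by (auto elim!: gen2E intro!: isidlD(2,3))

lemmas csub_gen2 = isidl_csub[OF isidl_gen2] and csub_gen3 = isidl_csub[OF isidl_gen3]

lemma gen2_1: "gen2 p 1 = UNIV"
  using isidl_UNIV_iff[OF isidl_gen2] gen2_mem(2) by blast

lemma gen2_commute: "gen2 a b = gen2 b a"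
  by (intro equalityI gen2_least isidl_gen2 gen2_mem)

section \<open>Power series as complex algebras, and the quotient dimension of the library\<close>

instantiation complex :: calg
begin
definition "sc_complex (c :: complex) = c"
instance by standard (auto simp: sc_complex_def)
end

instantiation fps :: (calg) calg
begin
definition "sc_fps c = fps_const (sc c)"
instance by standard (auto simp: sc_fps_def sc_add sc_mult)
end

instantiation conv_series :: calg
begin
definition "sc_conv_series c = const_series c"
instance
proof
  show "sc (a + b) = (sc a + sc b :: conv_series)" for a b
    unfolding sc_conv_series_def by transfer simp
  show "sc (a * b) = (sc a * sc b :: conv_series)" for a b
    unfolding sc_conv_series_def by transfer simp
  show "sc 1 = (1 :: conv_series)"
    unfolding sc_conv_series_def by transfer simp
qed
end

lemma ideal_series_ring_iff: "ideal A series_ring \<longleftrightarrow> isidl A"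
proof
  assume "ideal A series_ring"
  then interpret ideal A series_ring .
  show "isidl A" unfolding isidl_def
    using a_closed zero_closed I_l_closed
      additive_subgroup.zero_closed[OF additive_subgroup_axioms]
      additive_subgroup.a_closed[OF additive_subgroup_axioms]
    by (auto simp: ring_of_type_algebra_def)
next
  assume A: "isidl A"
  have r: "ring series_ring" by (rule ring_from_type_algebra)
  show "ideal A series_ring"
  proof (rule idealI[OF r])
    show "subgroup A (add_monoid series_ring)"
    proof
      fix x assume "x \<in> A"
      interpret ring series_ring by (rule r)
      have "inv\<^bsub>add_monoid series_ring\<^esub> x = - x"
        using minus_equality[of "- x" x] by (simp add: ring_of_type_algebra_def a_inv_def)
      thus "inv\<^bsub>add_monoid series_ring\<^esub> x \<in> A" using isidlD(5)[OF A \<open>x \<in> A\<close>] by simp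
    qed (use isidlD[OF A] in \<open>auto simp: ring_of_type_algebra_def\<close>)
  qed (use isidlD[OF A] in \<open>auto simp: ring_of_type_algebra_def\<close>)
qed

lemma ideal_gen_gen2: "ideal_gen {a, b} = gen2 a b"
  unfolding ideal_gen_def genideal_def ideal_series_ring_iff
  by (intro equalityI Inter_lower Inter_greatest) (auto simp: isidl_gen2 gen2_mem dest: gen2_least)

lemma ideal_gen_gen3: "ideal_gen {a, b, c} = gen3 a b c"
  unfolding ideal_gen_def genideal_def ideal_series_ring_iff
  by (intro equalityI Inter_lower Inter_greatest) (auto simp: isidl_gen3 gen3_mem dest: gen3_least)

text \<open>Under the projection to the quotient, chains of \<open>reldim\<close> above A correspond
  to chains of \<open>dimension\<close> above zero. Both directions are needed because
  \<open>dim\<close> is a definite description: one gives existence, the other uniqueness.\<close>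

lemma quot_dim_eqI:
  assumes A: "isidl A" and "reldim A n UNIV"
  shows "quot_dim A = n"
proof -
  interpret ideal A series_ring using A by (simp add: ideal_series_ring_iff)
  define Q where "Q = series_ring Quot A"
  interpret Q: ring Q unfolding Q_def by (rule quotient_is_ring)
  define \<pi> where "\<pi> = (\<lambda>x. A +>\<^bsub>series_ring\<^esub> x)"
  define K where "K = range (\<lambda>c. \<pi> (sc c))"
  have carr: "carrier Q = range \<pi>"
    unfolding Q_def FactRing_def A_RCOSETS_def' \<pi>_def by (auto simp: ring_of_type_algebra_def)
  have \<pi>_def': "\<pi> x = {a + x | a. a \<in> A}" for x
    unfolding \<pi>_def a_r_coset_def' by (auto simp: ring_of_type_algebra_def)
  have \<pi>_eq: "\<pi> x = \<pi> y \<longleftrightarrow> x - y \<in> A" for x y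
  proof
    assume "\<pi> x = \<pi> y"
    hence "0 + x \<in> \<pi> y" using isidlD(1)[OF A] unfolding \<pi>_def'[of x] by blast
    thus "x - y \<in> A" unfolding \<pi>_def' by auto
  next
    assume *: "x - y \<in> A"
    have "a + (x - y) \<in> A" "a - (x - y) \<in> A" if "a \<in> A" for a
      using * isidlD(2,6)[OF A that] by blast+
    moreover have "a + x = (a + (x - y)) + y" "a + y = (a - (x - y)) + x" for a by simp_all
    ultimately have "{a + x | a. a \<in> A} \<subseteq> {a + y | a. a \<in> A}" "{a + y | a. a \<in> A} \<subseteq> {a + x | a. a \<in> A}"
      by (safe; metis)+
    thus "\<pi> x = \<pi> y" unfolding \<pi>_def' by (rule equalityI)
  qed
  have \<pi>0: "\<zero>\<^bsub>Q\<^esub> = A" unfolding Q_def FactRing_def by simp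
  have \<pi>A: "\<pi> x = A \<longleftrightarrow> x \<in> A" for x
  proof -
    have "\<pi> 0 = A" unfolding \<pi>_def' by simp
    thus ?thesis using \<pi>_eq[of x 0] by simp
  qed
  have \<pi>add: "\<pi> x \<oplus>\<^bsub>Q\<^esub> \<pi> y = \<pi> (x + y)" for x y
    using a_rcos_sum[of x y] unfolding Q_def FactRing_def \<pi>_def by (simp add: ring_of_type_algebra_def)
  have \<pi>mult: "\<pi> x \<otimes>\<^bsub>Q\<^esub> \<pi> y = \<pi> (x * y)" for x y
    using rcoset_mult_add[of x y] unfolding Q_def FactRing_def \<pi>_def by (simp add: ring_of_type_algebra_def)
  have le: "Q.line_extension K (\<pi> v) (\<pi> ` U) = \<pi> ` line_ext U v" for v U
  proof -
    have *: "\<pi> (sc c) \<otimes>\<^bsub>Q\<^esub> \<pi> v \<oplus>\<^bsub>Q\<^esub> \<pi> u = \<pi> (u + sc c * v)" for c u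
      by (simp add: \<pi>add \<pi>mult add.commute)
    show ?thesis
    proof (intro equalityI subsetI)
      fix z assume "z \<in> Q.line_extension K (\<pi> v) (\<pi> ` U)"
      then obtain c u where "u \<in> U" "z = \<pi> (u + sc c * v)"
        unfolding Q.line_extension_mem_iff K_def *[symmetric] by blast
      thus "z \<in> \<pi> ` line_ext U v" using line_extI by blast
    next
      fix z assume "z \<in> \<pi> ` line_ext U v"
      then obtain c u where "u \<in> U" "z = \<pi> (sc c) \<otimes>\<^bsub>Q\<^esub> \<pi> v \<oplus>\<^bsub>Q\<^esub> \<pi> u"
        unfolding line_ext_def * by blast
      thus "z \<in> Q.line_extension K (\<pi> v) (\<pi> ` U)"
        unfolding Q.line_extension_mem_iff K_def by blast
    qed
  qed
  have 1: "Q.dimension n K (\<pi> ` U)" if "reldim A n U" for n U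
    using that
  proof (induction rule: reldim.induct)
    case reldim_0
    have "\<pi> ` A = {\<zero>\<^bsub>Q\<^esub>}" using isidlD(1)[OF A] \<pi>A \<pi>0 by auto
    thus ?case using Q.zero_dim[of K] by simp
  next
    case (reldim_Suc n U v)
    have csU: "csub U" using reldim_csub[OF reldim_Suc(1) isidl_csub[OF A]] .
    have "\<pi> v \<notin> \<pi> ` U"
    proof
      assume "\<pi> v \<in> \<pi> ` U"
      then obtain u where u: "u \<in> U" "v - u \<in> A" using \<pi>_eq by blast
      have "(v - u) + u \<in> U" using reldim_subset[OF reldim_Suc(1)] u csubD(2)[OF csU] by blast
      thus False using reldim_Suc by simp
    qed
    thus ?case using Q.Suc_dim[of "\<pi> v" "\<pi> ` U" n K] reldim_Suc carr by (simp add: le)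
  qed
  have 2: "E \<subseteq> range \<pi> \<and> reldim A n {x. \<pi> x \<in> E}" if "Q.dimension n K' E" "K' = K" for n K' E
    using that
  proof (induction rule: Q.dimension.induct)
    case (zero_dim K)
    show ?case using reldim_0[of A] \<pi>A \<pi>0 Q.zero_closed carr by auto
  next
    case (Suc_dim v E n K')
    obtain v0 where v0: "v = \<pi> v0" using Suc_dim carr by auto
    define U where "U = {x. \<pi> x \<in> E}"
    have IH: "E \<subseteq> range \<pi>" "reldim A n U" using Suc_dim unfolding U_def by auto
    have E: "E = \<pi> ` U" using Suc_dim unfolding U_def by auto
    have csU: "csub U" using IH reldim_csub[OF _ isidl_csub[OF A]] by blast
    have AU: "A \<subseteq> U" using IH reldim_subset by blast
    have "{x. \<pi> x \<in> \<pi> ` line_ext U v0} = line_ext U v0"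
    proof -
      have "x \<in> line_ext U v0" if "\<pi> x = \<pi> y" "y \<in> line_ext U v0" for x y
      proof -
        have "x - y \<in> U" using that(1) AU by (auto simp: \<pi>_eq)
        hence "(x - y) + y \<in> line_ext U v0"
          using csubD(2)[OF csub_line_ext[OF csU, of v0] _ that(2)] line_ext_superset[of U v0] by blast
        thus ?thesis by simp
      qed
      thus ?thesis by auto
    qed
    moreover have "v0 \<notin> U" using Suc_dim(2) v0 U_def by simp
    ultimately show ?case using IH(2) reldim.reldim_Suc[of A n U v0]
      unfolding v0 E Suc_dim(5) le by auto
  qed
  have "Q.dim K (carrier Q) = n"
    unfolding Q.dim_def
  proof (rule the_equality)
    show "Q.dimension n K (carrier Q)" using 1[OF assms(2)] carr by simp
  next
    fix m assume "Q.dimension m K (carrier Q)"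
    hence "reldim A m UNIV" using 2 carr by force
    thus "m = n" using reldim_unique[OF _ assms(2) isidl_csub[OF A]] by blast
  qed
  thus ?thesis unfolding quot_dim_def Q_def K_def \<pi>_def sc_conv_series_def by simp
qed

section \<open>Weierstrass division for convergent series\<close>

lemma fps2_mult_nth:
  "(F * G) $ n $ k = (\<Sum>i=0..n. \<Sum>j=0..k. F $ i $ j * G $ (n - i) $ (k - j))"
  by (simp add: fps_mult_nth fps_sum_nth)

text \<open>X and Y get separate radii because Weierstrass division fixes the radius in Y first and
  then chooses the one in X depending on it.\<close>

lemma convergent_fps2I2:
  assumes "M \<ge> 0" "\<rho> > 0" "\<sigma> > 0" "\<And>i j. norm (F $ i $ j) \<le> M / (\<rho> ^ i * \<sigma> ^ j)"
  shows "convergent_fps2 F"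
proof (rule convergent_fps2I)
  define s where "s = max (1 / \<rho>) (1 / \<sigma>)"
  show "M \<ge> 0" "s > 0" using assms by (auto simp: s_def less_max_iff_disj)
  show "norm (F $ i $ j) \<le> M * s ^ (i + j)" for i j
  proof -
    have "M / (\<rho> ^ i * \<sigma> ^ j) = M * ((1 / \<rho>) ^ i * (1 / \<sigma>) ^ j)"
      by (simp add: power_divide)
    also have "\<dots> \<le> M * (s ^ i * s ^ j)"
      using assms by (intro mult_left_mono mult_mono power_mono) (auto simp: s_def le_max_iff_disj)
    finally show ?thesis using assms(4)[of i j] by (simp add: power_add)
  qed
qed

lemma convergent_fps2_dominated:
  assumes "convergent_fps2 F" "\<And>i j. norm (G $ i $ j) \<le> norm (F $ (i + a) $ (j + b))"
  shows "convergent_fps2 G"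
proof -
  obtain M s where M: "M \<ge> 0" "s \<ge> 1" "\<And>i j. norm (F $ i $ j) \<le> M * s ^ (i + j)"
    using assms(1) by (rule convergent_fps2E) blast
  show ?thesis
  proof (rule convergent_fps2I)
    show "M * s ^ (a + b) \<ge> 0" "s > 0" using M by auto
    show "norm (G $ i $ j) \<le> M * s ^ (a + b) * s ^ (i + j)" for i j
      using order_trans[OF assms(2)[of i j] M(3)[of "i + a" "j + b"]] by (simp add: power_add mult_ac)
  qed
qed

lemma half_power_sum: "(\<Sum>i=0..n. (1/2 :: real) ^ i) \<le> 2"
proof -
  have "(\<Sum>i=0..n. (1/2 :: real) ^ i) = (\<Sum>i<Suc n. (1/2) ^ i)"
    by (simp add: atLeast0AtMost lessThan_Suc_atMost)
  also have "\<dots> \<le> 2" by (subst geometric_sum) auto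
  finally show ?thesis .
qed

definition quo_Y :: "nat \<Rightarrow> 'a :: comm_ring_1 fps fps \<Rightarrow> 'a fps fps" where
  "quo_Y m F = Abs_fps (\<lambda>i. fps_shift m (F $ i))"

definition rem_Y :: "nat \<Rightarrow> 'a :: comm_ring_1 fps fps \<Rightarrow> 'a fps fps" where
  "rem_Y m F = Abs_fps (\<lambda>i. Abs_fps (\<lambda>j. if j < m then F $ i $ j else 0))"

lemma quo_Y_nth [simp]: "quo_Y m F $ i $ j = F $ i $ (j + m)"
  by (simp add: quo_Y_def)

lemma rem_Y_nth [simp]: "rem_Y m F $ i $ j = (if j < m then F $ i $ j else 0)"
  by (simp add: rem_Y_def)

lemma convergent_fps2_quo_Y: "convergent_fps2 F \<Longrightarrow> convergent_fps2 (quo_Y k F)"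
  by (erule convergent_fps2_dominated[of _ _ 0 k]) simp

lemma convergent_fps2_rem_Y: "convergent_fps2 F \<Longrightarrow> convergent_fps2 (rem_Y k F)"
  by (erule convergent_fps2_dominated[of _ _ 0 0]) simp

lemma quo_rem_Y: "fps_const (fps_X ^ m) * quo_Y m F + rem_Y m F = F"
  by (simp add: fps_eq_iff fps_X_power_mult_nth)

text \<open>With these radii the map F -> h * \<open>quo_Y m F\<close>, where h = Y^m - w, at least
  halves the weighted supremum of the coefficients: \<open>quo_Y\<close> costs a factor \<sigma>^-m,
  so the weighted sum of the coefficients of h must be at most \<sigma>^m / 2.\<close>

lemma convergent_weierstrass_bound:
  assumes "convergent_fps2 w" "convergent_fps2 g" "\<And>j. j < m \<Longrightarrow> w $ 0 $ j = 0" "w $ 0 $ m = 1"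
  obtains B \<rho> \<sigma> where "B \<ge> 0" "\<rho> > 0" "\<sigma> > 0" "\<And>i j. norm (g $ i $ j) \<le> B / (\<rho> ^ i * \<sigma> ^ j)"
    "\<And>n k. (\<Sum>i=0..n. \<Sum>j=0..k. norm ((fps_const (fps_X ^ m) - w) $ i $ j) * \<rho> ^ i * \<sigma> ^ j) \<le> \<sigma> ^ m / 2"
proof -
  obtain M s where F: "M \<ge> 0" "s \<ge> 1" "\<And>i j. norm (w $ i $ j) \<le> M * s ^ (i + j)"
    using assms(1) by (rule convergent_fps2E) blast
  obtain N t where G: "N \<ge> 0" "t \<ge> 1" "\<And>i j. norm (g $ i $ j) \<le> N * t ^ (i + j)"
    using assms(2) by (rule convergent_fps2E) blast
  define u where "u = max s t"
  have u: "u \<ge> 1" "s \<le> u" "t \<le> u" using F by (auto simp: u_def)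
  define h where "h = fps_const (fps_X ^ m) - w"
  \<comment> \<open>\<sigma> makes the terms Y^j with j > m small compared with \<sigma>^m, then
    \<rho> does the same for the multiples of X. The target for each weighted coefficient is
    (\<sigma>^m / 8) (1/2)^(i+j), and the double geometric series is at most 4.\<close>
  define \<sigma> where "\<sigma> = 1 / (8 * (M + 1) * (2 * u) ^ (m + 1))"
  define \<rho> where "\<rho> = \<sigma> ^ m / (16 * (M + 1) * u)"
  have pos: "\<sigma> > 0" "\<rho> > 0" using F u by (auto simp: \<sigma>_def \<rho>_def)
  have "1 * (2 * u) ^ 1 \<le> 8 * (M + 1) * (2 * u) ^ (m + 1)"
    using F u by (intro mult_mono power_increasing) auto
  hence \<sigma>u: "2 * u * \<sigma> \<le> 1" using F u by (simp add: \<sigma>_def field_simps)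
  have "1 * \<sigma> \<le> 2 * u * \<sigma>" using u pos by (intro mult_right_mono) auto
  hence "\<sigma> \<le> 1" using \<sigma>u by simp
  have "\<sigma> ^ m \<le> 1" using \<open>\<sigma> \<le> 1\<close> pos by (simp add: power_le_one)
  also have "1 \<le> 8 * (M + 1)" using F(1) by simp
  finally have "\<sigma> ^ m \<le> 8 * (M + 1)" .
  hence "\<sigma> ^ m / (8 * (M + 1)) \<le> 1" using F(1) by (subst divide_le_eq_1_pos) auto
  moreover have \<rho>eq: "2 * u * \<rho> = \<sigma> ^ m / (8 * (M + 1))" using F(1) u by (simp add: \<rho>_def divide_simps)
  ultimately have \<rho>u: "2 * u * \<rho> \<le> 1" by simp
  have "(2 * u) ^ (m + 1) \<noteq> 0" using u by simp
  hence \<sigma>eq: "(2 * u) ^ (m + 1) * \<sigma> = 1 / (8 * (M + 1))"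
    unfolding \<sigma>_def by (simp only: times_divide_eq_right mult_1_right nonzero_mult_divide_mult_cancel_right
      mult_divide_mult_cancel_right) (simp add: divide_simps)
  have M8: "M / (8 * (M + 1)) \<le> 1 / 8" using F(1) by (simp add: divide_simps)
  have \<sigma>M: "M * ((2 * u) ^ (m + 1) * \<sigma>) \<le> 1 / 8"
    unfolding \<sigma>eq using M8 by simp
  have "\<sigma> ^ m * (M / (8 * (M + 1))) \<le> \<sigma> ^ m * (1 / 8)"
    using M8 pos by (intro mult_left_mono) auto
  hence \<rho>M: "M * (2 * u * \<rho>) \<le> \<sigma> ^ m / 8"
    unfolding \<rho>eq by (simp add: mult.commute)
  have h: "norm (h $ i $ j) \<le> M * u ^ (i + j)" if "(i, j) \<noteq> (0, m)" for i j
  proof -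
    have "h $ i $ j = - w $ i $ j" using that by (cases "i = 0") (auto simp: h_def fps_X_power_nth)
    hence "norm (h $ i $ j) \<le> M * s ^ (i + j)" using F(3) by simp
    also have "\<dots> \<le> M * u ^ (i + j)" using F u by (intro mult_left_mono power_mono) auto
    finally show ?thesis .
  qed
  have bd: "norm (h $ i $ j) * \<rho> ^ i * \<sigma> ^ j \<le> \<sigma> ^ m / 8 * ((1/2) ^ i * (1/2) ^ j)" for i j
  proof (cases "i = 0 \<and> j \<le> m")
    case True
    hence "h $ i $ j = 0" using assms(3,4) by (cases "j = m") (auto simp: h_def fps_X_power_nth)
    thus ?thesis using pos by simp
  next
    case False
    have "norm (h $ i $ j) * \<rho> ^ i * \<sigma> ^ j \<le> M * u ^ (i + j) * \<rho> ^ i * \<sigma> ^ j"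
      using False pos by (intro mult_right_mono h) auto
    also have "\<dots> = (M * (2 * u * \<rho>) ^ i * (2 * u * \<sigma>) ^ j) * ((1/2) ^ i * (1/2) ^ j)"
      by (simp add: power_mult_distrib power_add power_divide field_simps)
    also have "M * (2 * u * \<rho>) ^ i * (2 * u * \<sigma>) ^ j \<le> \<sigma> ^ m / 8"
    proof (cases "i = 0")
      case True
      hence j: "m + 1 \<le> j" using False by simp
      have "M * (2 * u * \<rho>) ^ i * (2 * u * \<sigma>) ^ j \<le> M * (2 * u * \<sigma>) ^ (m + 1)"
        using mult_left_mono[OF power_decreasing[OF j, of "2 * u * \<sigma>"] F(1)] True u pos \<sigma>u by simp
      also have "\<dots> = (M * ((2 * u) ^ (m + 1) * \<sigma>)) * \<sigma> ^ m"
        by (simp add: power_mult_distrib algebra_simps)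
      also have "\<dots> \<le> 1 / 8 * \<sigma> ^ m" using \<sigma>M pos by (intro mult_right_mono) auto
      finally show ?thesis by simp
    next
      case False
      have "M * (2 * u * \<rho>) ^ i * (2 * u * \<sigma>) ^ j \<le> M * (2 * u * \<rho>) ^ 1 * 1"
        using F u pos \<sigma>u \<rho>u False
        by (intro mult_mono mult_left_mono power_decreasing power_le_one) auto
      thus ?thesis using \<rho>M by simp
    qed
    finally show ?thesis by (simp add: mult_right_mono)
  qed
  have 1: "(\<Sum>i=0..n. \<Sum>j=0..k. norm (h $ i $ j) * \<rho> ^ i * \<sigma> ^ j) \<le> \<sigma> ^ m / 2" for n k
  proof -
    have "(\<Sum>i=0..n. \<Sum>j=0..k. norm (h $ i $ j) * \<rho> ^ i * \<sigma> ^ j)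
        \<le> (\<Sum>i=0..n. \<Sum>j=0..k. \<sigma> ^ m / 8 * ((1/2) ^ i * (1/2) ^ j))"
      by (intro sum_mono bd)
    also have "\<dots> = \<sigma> ^ m / 8 * ((\<Sum>i=0..n. (1/2) ^ i) * (\<Sum>j=0..k. (1/2) ^ j))"
      unfolding sum_product by (simp only: sum_distrib_left)
    also have "\<dots> \<le> \<sigma> ^ m / 8 * (2 * 2)"
      using pos by (intro mult_left_mono mult_mono half_power_sum sum_nonneg) auto
    finally show ?thesis by simp
  qed
  have 2: "norm (g $ i $ j) \<le> N / (\<rho> ^ i * \<sigma> ^ j)" for i j
  proof -
    have "t \<le> 2 * u" using u by linarith
    hence "t * \<rho> \<le> 2 * u * \<rho>" "t * \<sigma> \<le> 2 * u * \<sigma>" using pos by (auto intro: mult_right_mono)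
    hence "t * \<rho> \<le> 1" "t * \<sigma> \<le> 1" using \<rho>u \<sigma>u by linarith+
    hence "t \<le> 1 / \<rho>" "t \<le> 1 / \<sigma>" using pos by (simp_all add: pos_le_divide_eq)
    hence "N * (t ^ i * t ^ j) \<le> N * ((1 / \<rho>) ^ i * (1 / \<sigma>) ^ j)"
      using G pos by (intro mult_left_mono mult_mono power_mono) auto
    thus ?thesis using G(3)[of i j] by (simp add: power_add power_divide)
  qed
  show ?thesis using that[of N \<rho> \<sigma>] G(1) pos 1 2 unfolding h_def by blast
qed

text \<open>Substituting Y^m = w + h into F = Y^m * \<open>quo_Y m F\<close> +
  \<open>rem_Y m F\<close> leaves the error h * \<open>quo_Y m F\<close>. Feeding the error back
  produces the sequence G, which decays geometrically; its sum T yields the quotient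
  \<open>quo_Y m T\<close> and the remainder \<open>rem_Y m T\<close>.\<close>

lemma weierstrass_division_monic:
  assumes "convergent_fps2 w" "convergent_fps2 g" "\<And>j. j < m \<Longrightarrow> w $ 0 $ j = 0" "w $ 0 $ m = 1"
  shows "\<exists>a r. convergent_fps2 a \<and> convergent_fps2 r \<and> g = w * a + r \<and> (\<forall>i j. m \<le> j \<longrightarrow> r $ i $ j = 0)"
proof -
  obtain B \<rho> \<sigma> where B: "B \<ge> 0" and pos: "\<rho> > 0" "\<sigma> > 0"
    and g: "\<And>i j. norm (g $ i $ j) \<le> B / (\<rho> ^ i * \<sigma> ^ j)"
    and h: "\<And>n k. (\<Sum>i=0..n. \<Sum>j=0..k. norm ((fps_const (fps_X ^ m) - w) $ i $ j) * \<rho> ^ i * \<sigma> ^ j) \<le> \<sigma> ^ m / 2"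
    using convergent_weierstrass_bound[OF assms] by blast
  define h where "h = fps_const (fps_X ^ m) - w"
  define G where "G = rec_nat g (\<lambda>_ F. h * quo_Y m F)"
  have G0: "G 0 = g" and GS: "\<And>k. G (Suc k) = h * quo_Y m (G k)" unfolding G_def by auto
  have bG: "norm (G k $ i $ j) \<le> B * (1/2) ^ k / (\<rho> ^ i * \<sigma> ^ j)" for k i j
  proof (induction k arbitrary: i j)
    case 0 thus ?case using g by (simp add: G0)
  next
    case (Suc k)
    define C where "C = B * (1/2) ^ k / (\<rho> ^ i * \<sigma> ^ j * \<sigma> ^ m)"
    have C: "C \<ge> 0" using B pos by (simp add: C_def)
    have "norm (G (Suc k) $ i $ j) \<le> (\<Sum>i'=0..i. \<Sum>j'=0..j. norm (h $ i' $ j' * G k $ (i - i') $ (j - j' + m)))"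
      unfolding GS fps2_mult_nth quo_Y_nth by (intro order_trans[OF norm_sum] sum_mono norm_sum)
    also have "\<dots> \<le> (\<Sum>i'=0..i. \<Sum>j'=0..j. C * (norm (h $ i' $ j') * \<rho> ^ i' * \<sigma> ^ j'))"
    proof (intro sum_mono)
      fix i' j' assume ij: "i' \<in> {0..i}" "j' \<in> {0..j}"
      have "norm (h $ i' $ j' * G k $ (i - i') $ (j - j' + m))
          \<le> norm (h $ i' $ j') * (B * (1/2) ^ k / (\<rho> ^ (i - i') * \<sigma> ^ (j - j' + m)))"
        unfolding norm_mult by (intro mult_left_mono Suc.IH) auto
      also have "B * (1/2) ^ k / (\<rho> ^ (i - i') * \<sigma> ^ (j - j' + m)) = C * \<rho> ^ i' * \<sigma> ^ j'"
      proof -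
        have "\<rho> ^ i = \<rho> ^ (i - i') * \<rho> ^ i'" "\<sigma> ^ j = \<sigma> ^ (j - j') * \<sigma> ^ j'"
          using ij by (simp_all flip: power_add)
        thus ?thesis using pos by (simp add: C_def power_add field_simps)
      qed
      finally show "norm (h $ i' $ j' * G k $ (i - i') $ (j - j' + m)) \<le> C * (norm (h $ i' $ j') * \<rho> ^ i' * \<sigma> ^ j')"
        by (simp add: algebra_simps)
    qed
    also have "\<dots> = C * (\<Sum>i'=0..i. \<Sum>j'=0..j. norm (h $ i' $ j') * \<rho> ^ i' * \<sigma> ^ j')"
      by (simp only: sum_distrib_left)
    also have "\<dots> \<le> C * (\<sigma> ^ m / 2)" using h[folded h_def] C by (intro mult_left_mono)
    also have "\<dots> = B * (1/2) ^ Suc k / (\<rho> ^ i * \<sigma> ^ j)" using pos by (simp add: C_def field_simps)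
    finally show ?case .
  qed
  have sm: "summable (\<lambda>k. G k $ i $ j)" and sb: "norm (\<Sum>k. G k $ i $ j) \<le> 2 * B / (\<rho> ^ i * \<sigma> ^ j)" for i j
  proof -
    have "(\<lambda>k. (B / (\<rho> ^ i * \<sigma> ^ j)) * (1/2) ^ k) sums ((B / (\<rho> ^ i * \<sigma> ^ j)) * 2)"
      using geometric_sums[of "1/2 :: real"] by (intro sums_mult) auto
    hence s: "(\<lambda>k. B * (1/2) ^ k / (\<rho> ^ i * \<sigma> ^ j)) sums (2 * B / (\<rho> ^ i * \<sigma> ^ j))"
      by (simp add: mult.commute)
    show "summable (\<lambda>k. G k $ i $ j)"
      by (rule summable_comparison_test'[OF sums_summable[OF s] bG])
    show "norm (\<Sum>k. G k $ i $ j) \<le> 2 * B / (\<rho> ^ i * \<sigma> ^ j)"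
      using norm_suminf_le[OF bG sums_summable[OF s]] sums_unique[OF s] by simp
  qed
  define T where "T = Abs_fps (\<lambda>i. Abs_fps (\<lambda>j. \<Sum>k. G k $ i $ j))"
  have Tn: "T $ i $ j = (\<Sum>k. G k $ i $ j)" for i j by (simp add: T_def)
  have T: "convergent_fps2 T"
    using B pos sb by (intro convergent_fps2I2[of "2 * B" \<rho> \<sigma>]) (auto simp: Tn)
  have a: "convergent_fps2 (quo_Y m T)" and r: "convergent_fps2 (rem_Y m T)"
    using T by (rule convergent_fps2_quo_Y convergent_fps2_rem_Y)+
  define S where "S = (\<lambda>K. \<Sum>k<K. G k)"
  have exact: "g = w * quo_Y m (S K) + rem_Y m (S K) + G K" for K
  proof (induction K)
    case 0
    have "quo_Y m (S 0) = 0" "rem_Y m (S 0) = 0" by (auto simp: S_def fps_eq_iff)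
    thus ?case by (simp add: G0)
  next
    case (Suc K)
    have "quo_Y m (S (Suc K)) = quo_Y m (S K) + quo_Y m (G K)"
      "rem_Y m (S (Suc K)) = rem_Y m (S K) + rem_Y m (G K)" by (auto simp: S_def fps_eq_iff)
    moreover have "G (Suc K) = fps_const (fps_X ^ m) * quo_Y m (G K) - w * quo_Y m (G K)"
      unfolding GS h_def by (simp add: algebra_simps)
    ultimately have "w * quo_Y m (S (Suc K)) + rem_Y m (S (Suc K)) + G (Suc K)
        = w * quo_Y m (S K) + rem_Y m (S K) + (fps_const (fps_X ^ m) * quo_Y m (G K) + rem_Y m (G K))"
      by (simp add: algebra_simps)
    also have "\<dots> = w * quo_Y m (S K) + rem_Y m (S K) + G K" by (simp only: quo_rem_Y)
    finally show ?case using Suc by simp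
  qed
  have limS: "(\<lambda>K. S K $ i $ j) \<longlonglongrightarrow> T $ i $ j" for i j
    using summable_LIMSEQ[OF sm[of i j]] by (simp add: S_def Tn fps_sum_nth)
  have limG: "(\<lambda>K. G K $ i $ j) \<longlonglongrightarrow> 0" for i j
    using summable_LIMSEQ_zero[OF sm] .
  \<comment> \<open>A coefficient of a product involves finitely many coefficients of the factors,
    so the exact identity for partial sums passes to the limit coefficientwise.\<close>
  have "g = w * quo_Y m T + rem_Y m T"
    unfolding fps_eq_iff
  proof (intro allI)
    fix n k
    have "(\<lambda>K. (w * quo_Y m (S K)) $ n $ k + rem_Y m (S K) $ n $ k + G K $ n $ k)
        \<longlonglongrightarrow> (w * quo_Y m T) $ n $ k + rem_Y m T $ n $ k + 0"
      unfolding fps2_mult_nth quo_Y_nth rem_Y_nth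
      by (intro tendsto_intros limS limG) (auto intro!: limS)
    moreover have "(\<lambda>K. (w * quo_Y m (S K)) $ n $ k + rem_Y m (S K) $ n $ k + G K $ n $ k) = (\<lambda>K. g $ n $ k)"
      using exact by (metis fps_add_nth)
    ultimately show "g $ n $ k = (w * quo_Y m T + rem_Y m T) $ n $ k"
      using LIMSEQ_unique[OF tendsto_const] by fastforce
  qed
  thus ?thesis using a r by (intro exI[of _ "quo_Y m T"] exI[of _ "rem_Y m T"]) auto
qed

lemma weierstrass_division:
  assumes "convergent_fps2 w" "convergent_fps2 g" "w $ 0 \<noteq> 0"
  shows "\<exists>a r. convergent_fps2 a \<and> convergent_fps2 r \<and> g = w * a + r \<and> (\<forall>i j. subdegree (w $ 0) \<le> j \<longrightarrow> r $ i $ j = 0)"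
proof -
  define c where "c = inverse (w $ 0 $ subdegree (w $ 0))"
  have c: "c \<noteq> 0" using assms(3) by (simp add: c_def)
  have conv: "convergent_fps2 (fps_const (fps_const c) * w)"
    by (intro convergent_fps2_mult convergent_fps2_const assms)
  have z: "(fps_const (fps_const c) * w) $ 0 $ j = c * w $ 0 $ j" for j by simp
  have "(fps_const (fps_const c) * w) $ 0 $ j = 0" if "j < subdegree (w $ 0)" for j
    unfolding z using nth_less_subdegree_zero[OF that] by simp
  moreover have "(fps_const (fps_const c) * w) $ 0 $ subdegree (w $ 0) = 1"
    unfolding z c_def using assms(3) by simp
  ultimately obtain a r where ar: "convergent_fps2 a" "convergent_fps2 r" "g = fps_const (fps_const c) * w * a + r"
      "\<forall>i j. subdegree (w $ 0) \<le> j \<longrightarrow> r $ i $ j = 0"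
    using weierstrass_division_monic[OF conv assms(2)] by blast
  show ?thesis
    using ar by (intro exI[of _ "fps_const (fps_const c) * a"] exI[of _ r])
      (auto intro!: convergent_fps2_mult convergent_fps2_const simp: algebra_simps)
qed

section \<open>Coprime convergent series generate an ideal of finite codimension\<close>

lift_definition sX :: conv_series is fps_X
  by (rule convergent_fps2I[of 1 1]) (auto simp: fps_X_def)

lift_definition sY :: conv_series is "fps_const fps_X"
  by (rule convergent_fps2I[of 1 1]) (auto simp: fps_X_def)

text \<open>Restriction to the line X = 0. That \<open>at0 g\<close> is nonzero is regularity in Y,
  the condition for Weierstrass division by g, and the order of \<open>at0 g\<close> is then I(g,
  X).\<close>

lift_definition at0 :: "conv_series \<Rightarrow> complex fps" is "\<lambda>F. F $ 0" .

lemma fps_X_decomp: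
  fixes F :: "'a :: comm_ring_1 fps"
  shows "F = fps_const (F $ 0) + fps_X * fps_shift 1 F"
proof (rule fps_ext)
  fix n show "F $ n = (fps_const (F $ 0) + fps_X * fps_shift 1 F) $ n"
    by (cases n) auto
qed

abbreviation fY :: "complex fps fps" where "fY \<equiv> fps_const fps_X"

lemma convergent_fps2_shift: "convergent_fps2 F \<Longrightarrow> convergent_fps2 (fps_shift k F)"
  by (erule convergent_fps2_dominated[of _ _ k 0]) simp

lemma fps2_of_simps:
  "fps2_of (a + b) = fps2_of a + fps2_of b" "fps2_of (a * b) = fps2_of a * fps2_of b"
  "fps2_of (a - b) = fps2_of a - fps2_of b" "fps2_of 0 = 0" "fps2_of 1 = 1"
  "fps2_of sX = fps_X" "fps2_of sY = fY" "fps2_of (sc c) = sc c"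
  by (auto simp: plus_conv_series.rep_eq times_conv_series.rep_eq minus_conv_series.rep_eq
    zero_conv_series.rep_eq one_conv_series.rep_eq sX.rep_eq sY.rep_eq const_series.rep_eq
    sc_conv_series_def sc_fps_def sc_complex_def)

lemma convergent_fps2_of: "convergent_fps2 (fps2_of a)"
  using fps2_of[of a] by simp

lemma obtain_series:
  assumes "convergent_fps2 F" obtains a where "fps2_of a = F"
  using Abs_conv_series_inverse[of F] assms by auto

lemma at0_def': "at0 a = fps2_of a $ 0"
  by (simp add: at0.rep_eq)

lemma fps2_of_power: "fps2_of (a ^ k) = fps2_of a ^ k"
  by (induction k) (auto simp: fps2_of_simps)

lemma at0_simps [simp]:
  "at0 (a + b) = at0 a + at0 b" "at0 (a - b) = at0 a - at0 b" "at0 0 = 0" "at0 1 = 1"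
  "at0 (a * b) = at0 a * at0 b" "at0 sX = 0" "at0 sY = fps_X"
  by (simp_all add: at0_def' fps2_of_simps)

lemma at0_power [simp]: "at0 (a ^ k) = at0 a ^ k"
  by (induction k) auto

lemma sX_dvd_iff: "sX dvd g \<longleftrightarrow> at0 g = 0"
proof
  assume "at0 g = 0"
  obtain a where a: "fps2_of a = fps_shift 1 (fps2_of g)"
    using obtain_series[OF convergent_fps2_shift[OF convergent_fps2_of]] by metis
  have "fps_X * fps_shift 1 (fps2_of g) = fps2_of g"
    using fps_X_decomp[of "fps2_of g"] \<open>at0 g = 0\<close> by (simp add: at0_def')
  hence "g = sX * a" by (simp add: a fps2_of_simps flip: fps2_of_inject)
  thus "sX dvd g" by (rule dvdI)
qed auto

lemma sX_nonzero [simp]: "sX \<noteq> 0" and sY_nonzero [simp]: "sY \<noteq> 0"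
  by (simp_all add: fps2_of_simps flip: fps2_of_inject)

lemma weierstrass_division_series:
  assumes "at0 w \<noteq> 0"
  obtains a r where "g = w * a + r" "\<And>i j. subdegree (at0 w) \<le> j \<Longrightarrow> fps2_of r $ i $ j = 0"
proof -
  obtain A R where AR: "convergent_fps2 A" "convergent_fps2 R" "fps2_of g = fps2_of w * A + R"
      "\<And>i j. subdegree (fps2_of w $ 0) \<le> j \<Longrightarrow> R $ i $ j = 0"
    using weierstrass_division[OF convergent_fps2_of convergent_fps2_of, of w g] assms
    unfolding at0_def' by blast
  obtain a r where ar: "fps2_of a = A" "fps2_of r = R"
    using obtain_series[OF AR(1)] obtain_series[OF AR(2)] by metis
  have "g = w * a + r" using AR(3) by (simp add: ar fps2_of_simps flip: fps2_of_inject)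
  thus ?thesis using that AR(4) ar at0_def' by metis
qed

lemma X_factor:
  assumes "r \<noteq> 0"
  obtains k r' where "r = sX ^ k * r'" "at0 r' \<noteq> 0" "\<And>i j. fps2_of r' $ i $ j = fps2_of r $ (i + k) $ j"
proof -
  define k where "k = subdegree (fps2_of r)"
  have nz: "fps2_of r \<noteq> 0" using assms by (simp add: fps2_of_simps(4)[symmetric] fps2_of_inject)
  obtain r' where r': "fps2_of r' = fps_shift k (fps2_of r)"
    using obtain_series[OF convergent_fps2_shift[OF convergent_fps2_of]] by metis
  have "fps2_of r = fps_X ^ k * fps2_of r'"
    using subdegree_decompose[of "fps2_of r"] unfolding r' k_def by (simp add: mult.commute)
  hence "r = sX ^ k * r'" by (simp add: fps2_of_simps fps2_of_power flip: fps2_of_inject)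
  moreover have "at0 r' \<noteq> 0" using nz by (simp add: at0_def' r' k_def)
  ultimately show ?thesis using that r' by simp
qed

text \<open>For ideals, a form of finite codimension that is easy to verify and can be transported
  to formal series.\<close>

definition cofin :: "conv_series set \<Rightarrow> bool" where
  "cofin V \<longleftrightarrow> (\<exists>k. sX ^ k \<in> V) \<and> (\<exists>k. sY ^ k \<in> V)"

lemma cofin_mono: "cofin V \<Longrightarrow> V \<subseteq> W \<Longrightarrow> cofin W"
  unfolding cofin_def by blast

text \<open>
  The ideal of all \<open>s\<close> with \<open>X\<^sup>k s \<in> \<langle>g, h\<rangle>\<close> for some \<open>k\<close> is principal: by Weierstrass division an
  element whose restriction to \<open>X = 0\<close> has minimal order generates it.
\<close>

lemma common_divisor_mod_X:
  assumes "at0 g \<noteq> 0"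
  obtains w k where "w dvd g" "w dvd h" "sX ^ k * w \<in> gen2 g h"
proof -
  define J where "J = {s. \<exists>k. sX ^ k * s \<in> gen2 g h}"
  note I = isidl_gen2[of g h]
  have J: "isidl J"
    unfolding isidl_def
  proof (intro conjI ballI allI)
    show "0 \<in> J" unfolding J_def using isidlD(1)[OF I] by simp
    fix x y assume "x \<in> J" "y \<in> J"
    then obtain k l where kl: "sX ^ k * x \<in> gen2 g h" "sX ^ l * y \<in> gen2 g h" unfolding J_def by blast
    have "sX ^ (k + l) * (x + y) = sX ^ l * (sX ^ k * x) + sX ^ k * (sX ^ l * y)"
      by (simp add: power_add algebra_simps)
    also have "\<dots> \<in> gen2 g h" using isidlD(2)[OF I isidlD(3)[OF I kl(1)] isidlD(3)[OF I kl(2)]] .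
    finally show "x + y \<in> J" unfolding J_def by blast
  next
    fix r x assume "x \<in> J"
    then obtain k where "sX ^ k * x \<in> gen2 g h" unfolding J_def by blast
    from isidlD(3)[OF I this, of r] show "r * x \<in> J" unfolding J_def
      by (auto simp: algebra_simps)
  qed
  have gJ: "g \<in> J" "h \<in> J"
    unfolding J_def using gen2_mem(1)[of g h] gen2_mem(2)[of h g] by (auto intro!: exI[of _ 0])
  have Jsat: "r \<in> J" if rk: "sX ^ k * r \<in> J" for k r
  proof -
    obtain l where "sX ^ l * (sX ^ k * r) \<in> gen2 g h" using rk unfolding J_def by blast
    hence "sX ^ (l + k) * r \<in> gen2 g h" by (simp add: power_add algebra_simps)
    thus ?thesis unfolding J_def by blast
  qed
  define n where "n = (LEAST n. \<exists>w\<in>J. at0 w \<noteq> 0 \<and> subdegree (at0 w) = n)"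
  have ex: "\<exists>n. \<exists>w\<in>J. at0 w \<noteq> 0 \<and> subdegree (at0 w) = n" using gJ assms by blast
  obtain w where w: "w \<in> J" "at0 w \<noteq> 0" "subdegree (at0 w) = n"
    using LeastI_ex[OF ex] unfolding n_def by blast
  have least: "n \<le> subdegree (at0 v)" if "v \<in> J" "at0 v \<noteq> 0" for v
    unfolding n_def using that by (intro Least_le) blast
  have dvd: "w dvd s" if s: "s \<in> J" for s
  proof -
    obtain a r where ar: "s = w * a + r" "\<And>i j. subdegree (at0 w) \<le> j \<Longrightarrow> fps2_of r $ i $ j = 0"
      using weierstrass_division_series[OF w(2)] by blast
    have "r = s - w * a" using ar by simp
    hence r: "r \<in> J" using isidlD(6)[OF J s isidlD(4)[OF J w(1)]] by simp
    \<comment> \<open>Otherwise r = X^k r' with r' in J by saturation, and the order of r' on X = 0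
      is below n, against minimality.\<close>
    have "r = 0"
    proof (rule ccontr)
      assume "r \<noteq> 0"
      then obtain k r' where r': "r = sX ^ k * r'" "at0 r' \<noteq> 0" "\<And>i j. fps2_of r' $ i $ j = fps2_of r $ (i + k) $ j"
        by (rule X_factor) blast
      have "r' \<in> J" using Jsat[of k r'] r r' by simp
      hence "n \<le> subdegree (at0 r')" using least r' by blast
      hence "at0 r' $ subdegree (at0 r') = 0" using ar(2) w(3) r'(3) by (simp add: at0.rep_eq)
      thus False using r'(2) by simp
    qed
    thus ?thesis using ar by simp
  qed
  obtain k where "sX ^ k * w \<in> gen2 g h" using w(1) unfolding J_def by blast
  thus ?thesis using that dvd gJ by blast
qed

text \<open>Divide Y^n by g, where n is the order of g(0, Y). On X = 0 the remainder has degree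
  below n but is divisible by Y^n, so it vanishes there.\<close>

lemma Y_power_mod_X:
  assumes "at0 g \<noteq> 0"
  shows "sY ^ subdegree (at0 g) \<in> gen2 g sX"
proof -
  obtain a r where ar: "sY ^ subdegree (at0 g) = g * a + r" "\<And>i j. subdegree (at0 g) \<le> j \<Longrightarrow> fps2_of r $ i $ j = 0"
    using weierstrass_division_series[OF assms] by blast
  have "at0 r = 0"
  proof (rule ccontr)
    assume nz: "at0 r \<noteq> 0"
    have "at0 r = fps_X ^ subdegree (at0 g) - at0 g * at0 a"
      using arg_cong[OF ar(1), of at0] by (simp add: algebra_simps)
    moreover have "at0 g dvd fps_X ^ subdegree (at0 g)"
      using assms by (simp add: fps_dvd_iff)
    ultimately have "at0 g dvd at0 r" by simp
    hence "subdegree (at0 g) \<le> subdegree (at0 r)" using nz assms by (simp add: fps_dvd_iff)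
    hence "at0 r $ subdegree (at0 r) = 0" using ar(2) by (simp add: at0.rep_eq)
    thus False using nz by simp
  qed
  then obtain b where "r = sX * b" using sX_dvd_iff by (metis dvdE)
  thus ?thesis using gen2I[of a g b sX] ar(1) by (simp add: mult.commute)
qed

text \<open>Modulo g, Y^n is a multiple b X of X, hence Y^(n k) is b^k X^k.\<close>

lemma cofin_if_X_power:
  assumes "isidl V" "g \<in> V" "at0 g \<noteq> 0" "sX ^ k \<in> V"
  shows "cofin V"
proof -
  define n where "n = subdegree (at0 g)"
  obtain a b where ab: "sY ^ n = a * g + b * sX"
    using Y_power_mod_X[OF assms(3)] unfolding n_def by (rule gen2E)
  have "g dvd (a * g + b * sX) ^ k - (b * sX) ^ k"
    using power_diff_sumr2[of "a * g + b * sX" k "b * sX"] by (simp add: dvd_mult dvd_mult2)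
  then obtain c where c: "sY ^ (n * k) - (b * sX) ^ k = g * c"
    unfolding ab[symmetric] power_mult by (rule dvdE)
  hence "sY ^ (n * k) = g * c + b ^ k * sX ^ k" by (simp add: power_mult_distrib algebra_simps)
  hence "sY ^ (n * k) \<in> V"
    using isidlD(2)[OF assms(1) isidlD(4)[OF assms(1,2)] isidlD(3)[OF assms(1,4)]] by simp
  thus ?thesis unfolding cofin_def using assms by blast
qed

text \<open>The common divisor obtained from \<open>common_divisor_mod_X\<close> is a unit, so the
  ideal contains a power of X. That lemma needs one series regular in Y; if neither is, X is a
  common divisor.\<close>

lemma coprime_imp_cofin:
  assumes "\<And>w. w dvd g \<Longrightarrow> w dvd h \<Longrightarrow> w dvd 1"
  shows "cofin (gen2 g h)"
proof -
  have *: "cofin (gen2 g h)" if nz: "at0 g \<noteq> 0" and cop: "\<And>w. w dvd g \<Longrightarrow> w dvd h \<Longrightarrow> w dvd 1" for g h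
  proof -
    obtain w k where w: "w dvd g" "w dvd h" "sX ^ k * w \<in> gen2 g h"
      using common_divisor_mod_X[OF nz, of h] by blast
    obtain u where "1 = w * u" using cop w by (metis dvdE)
    hence "sX ^ k = (sX ^ k * w) * u" by (simp add: algebra_simps)
    hence "sX ^ k \<in> gen2 g h" using w isidlD(4)[OF isidl_gen2] by metis
    thus ?thesis using cofin_if_X_power[OF isidl_gen2 gen2_mem(1) nz] by blast
  qed
  show ?thesis
  proof (cases "at0 g = 0 \<and> at0 h = 0")
    case True
    hence "sX dvd 1" using assms[of sX] by (simp add: sX_dvd_iff)
    hence False by (simp add: sX_dvd_iff)
    thus ?thesis ..
  next
    case False
    thus ?thesis using *[of g h] *[of h g] assms gen2_commute by metis
  qed
qed

lemma cofin_gen2_mult: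
  assumes "cofin (gen2 p q)" "cofin (gen2 p s)"
  shows "cofin (gen2 p (q * s))"
proof -
  have *: "x * y \<in> gen2 p (q * s)" if xy: "x \<in> gen2 p q" "y \<in> gen2 p s" for x y
  proof -
    obtain a b c d where "x = a * p + b * q" "y = c * p + d * s" using xy by (metis gen2E)
    hence "x * y = (a * c * p + a * d * s + b * c * q) * p + (b * d) * (q * s)"
      by (simp add: algebra_simps)
    thus ?thesis using gen2I by metis
  qed
  show ?thesis using assms unfolding cofin_def by (metis * power_add)
qed

lemma cofin_gen2_prod:
  "finite A \<Longrightarrow> (\<And>i. i \<in> A \<Longrightarrow> cofin (gen2 p (f i))) \<Longrightarrow> cofin (gen2 p (prod f A))"
proof (induction A rule: finite_induct)
  case empty
  show ?case by (simp add: cofin_def gen2_1)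
next
  case (insert i A)
  have "cofin (gen2 p (f i * prod f A))"
    by (intro cofin_gen2_mult insert.IH insert.prems) auto
  thus ?case using insert.hyps by simp
qed

text \<open>From x^k s = p a and y^l s = p b follows a y^l = b x^k. As y is not a zero divisor
  modulo x, x^k divides a and can be cancelled. This replaces an appeal to unique
  factorization.\<close>

lemma dvd_of_dvd_power_mult:
  fixes p s x y :: "'a :: idom"
  assumes prime: "\<And>a. x dvd a * y \<Longrightarrow> x dvd a" and "x \<noteq> 0" "y \<noteq> 0"
    and "p dvd x ^ k * s" "p dvd y ^ l * s"
  shows "p dvd s"
proof (cases "p = 0")
  case True
  thus ?thesis using assms(2,4) by simp
next
  case False
  have *: "x dvd a" if "x dvd a * y ^ l" for a
    using that
  proof (induction l arbitrary: a)
    case (Suc l)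
    have "a * y ^ Suc l = (a * y ^ l) * y" by (simp add: mult_ac)
    hence "x dvd (a * y ^ l) * y" using Suc.prems by (simp only:)
    hence "x dvd a * y ^ l" by (rule prime)
    thus ?case by (rule Suc.IH)
  qed simp
  have **: "x ^ k dvd a" if "x ^ k dvd a * y ^ l" for a
    using that
  proof (induction k arbitrary: a)
    case (Suc k)
    hence "x dvd a * y ^ l" by (metis dvd_mult_left power_Suc)
    then obtain b where b: "a = x * b" using * by blast
    have "a * y ^ l = x * (b * y ^ l)" by (simp add: b mult_ac)
    hence "x * x ^ k dvd x * (b * y ^ l)" using Suc.prems by (simp only: power_Suc)
    hence "x ^ k dvd b * y ^ l" using assms(2) by (simp only: dvd_mult_cancel_left) simp
    from mult_dvd_mono[OF dvd_refl Suc.IH[OF this], of x] show ?case using b by simp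
  qed simp
  obtain a b where ab: "x ^ k * s = p * a" "y ^ l * s = p * b" using assms(4,5) by (metis dvdE)
  have "p * (a * y ^ l) = p * (b * x ^ k)" using ab by (metis mult.assoc mult.commute)
  hence "a * y ^ l = b * x ^ k" using False by simp
  hence "x ^ k dvd a" using ** by simp
  then obtain c where "a = x ^ k * c" by blast
  hence "x ^ k * s = x ^ k * (p * c)" using ab by (simp add: algebra_simps)
  hence "s = p * c" using assms(2) by simp
  thus ?thesis by simp
qed

lemma dvd_mult_gen2:
  assumes "p dvd q * s" "x \<in> gen2 p q"
  shows "p dvd x * s"
proof -
  obtain a b where "x = a * p + b * q" using assms(2) by (rule gen2E)
  hence "x * s = p * (a * s) + b * (q * s)" by (simp add: algebra_simps)
  thus ?thesis using assms(1) by (simp add: dvd_mult)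
qed

text \<open>Euclid's lemma for coprime p and q: a power of X or of Y that lies in \<langle>p,
  q\<rangle> multiplies s into the multiples of p.\<close>

lemma cofin_dvd_cancel:
  assumes "cofin (gen2 p q)" "p dvd q * s"
  shows "p dvd s"
proof -
  have prime: "sX dvd a" if "sX dvd a * sY" for a using that by (simp add: sX_dvd_iff)
  obtain k l where "sX ^ k \<in> gen2 p q" "sY ^ l \<in> gen2 p q" using assms(1) unfolding cofin_def by blast
  hence "p dvd sX ^ k * s" "p dvd sY ^ l * s" by (simp_all add: dvd_mult_gen2[OF assms(2)])
  from dvd_of_dvd_power_mult[OF prime sX_nonzero sY_nonzero this] show ?thesis .
qed

section \<open>Passage to formal power series\<close>

text \<open>Downward induction on i + j: x^i y^j F lies in V once i + j = k + l, and the
  decomposition of F reduces lower monomials to the next degree.\<close>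

lemma monomials_span:
  fixes V U :: "'a :: calg set" and x y :: 'a
  assumes decomp: "\<And>F. \<exists>c G H. F = sc c + x * G + y * H"
    and "isidl V" "x ^ k \<in> V" "y ^ l \<in> V" "csub U" "V \<subseteq> U" "\<And>i j. i + j \<le> k + l \<Longrightarrow> x ^ i * y ^ j \<in> U"
  shows "U = UNIV"
proof -
  have "x ^ i * y ^ j * F \<in> U" if "i + j + d = k + l" for i j d F
    using that
  proof (induction d arbitrary: i j F)
    case 0
    show ?case
    proof (cases "k \<le> i")
      case True
      hence "x ^ i = x ^ k * x ^ (i - k)" by (simp flip: power_add)
      hence "x ^ i * y ^ j * F = x ^ k * (x ^ (i - k) * y ^ j * F)" by (simp add: mult.assoc)
      thus ?thesis using isidlD(4)[OF assms(2,3)] assms(6) by auto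
    next
      case False
      hence "y ^ j = y ^ l * y ^ (j - l)" using 0 by (simp flip: power_add)
      hence "x ^ i * y ^ j * F = y ^ l * (y ^ (j - l) * x ^ i * F)" by (simp add: algebra_simps)
      thus ?thesis using isidlD(4)[OF assms(2,4)] assms(6) by auto
    qed
  next
    case (Suc d)
    obtain c G H where F: "F = sc c + x * G + y * H" using decomp by blast
    have "x ^ i * y ^ j * F = sc c * (x ^ i * y ^ j) + x ^ Suc i * y ^ j * G + x ^ i * y ^ Suc j * H"
      by (simp add: F algebra_simps)
    moreover have "sc c * (x ^ i * y ^ j) \<in> U" using assms(7) Suc.prems by (intro csubD(3)[OF assms(5)]) auto
    moreover have "x ^ Suc i * y ^ j * G \<in> U" "x ^ i * y ^ Suc j * H \<in> U"
      by (rule Suc.IH, use Suc.prems in simp)+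
    ultimately show ?case using csubD(2)[OF assms(5)] by metis
  qed
  from this[of 0 0 "k + l"] show ?thesis by auto
qed

lemma finite_reldim_extension:
  assumes "finite B" "csub V"
  shows "\<exists>n U. reldim V n U \<and> B \<subseteq> U"
  using assms(1)
proof (induction B rule: finite_induct)
  case empty
  show ?case using reldim_0[of V] by blast
next
  case (insert b B)
  then obtain n U where U: "reldim V n U" "B \<subseteq> U" by blast
  show ?case
  proof (cases "b \<in> U")
    case True thus ?thesis using U by blast
  next
    case False
    have "insert b B \<subseteq> line_ext U b"
      using U line_ext_superset[of U b] line_ext_mem[OF reldim_csub[OF U(1) assms(2)], of b] by blast
    thus ?thesis using reldim_Suc[OF U(1) False] by blast
  qed
qed

lemma fincod_if_powers:
  fixes V :: "'a :: calg set" and x y :: 'a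
  assumes decomp: "\<And>F. \<exists>c G H. F = sc c + x * G + y * H"
    and "isidl V" "x ^ k \<in> V" "y ^ l \<in> V"
  shows "fincod V"
proof -
  define B where "B = (\<lambda>(i, j). x ^ i * y ^ j) ` ({..k + l} \<times> {..k + l})"
  have cV: "csub V" using assms(2) by (rule isidl_csub)
  obtain n U where U: "reldim V n U" "B \<subseteq> U"
    using finite_reldim_extension[of B V] cV unfolding B_def by auto
  have "U = UNIV"
  proof (rule monomials_span[OF assms reldim_csub[OF U(1) cV] reldim_subset[OF U(1)]])
    fix i j :: nat assume "i + j \<le> k + l"
    hence "x ^ i * y ^ j \<in> B" unfolding B_def by (intro image_eqI[of _ _ "(i, j)"]) auto
    thus "x ^ i * y ^ j \<in> U" using U by blast
  qed
  thus ?thesis using U(1) fincodI[OF cV] by blast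
qed

lemma fps2_decomp:
  "(F :: complex fps fps) = sc (F $ 0 $ 0) + fps_X * fps_shift 1 F + fY * fps_const (fps_shift 1 (F $ 0))"
proof -
  have "F = fps_const (fps_const (F $ 0 $ 0) + fps_X * fps_shift 1 (F $ 0)) + fps_X * fps_shift 1 F"
    using fps_X_decomp[of F] fps_X_decomp[of "F $ 0"] by simp
  thus ?thesis
    by (simp add: fps_const_add[symmetric] fps_const_mult[symmetric] add_ac sc_fps_def sc_complex_def
      del: fps_const_add fps_const_mult)
qed

lemma series_decomp: "\<exists>c G H. F = sc c + sX * G + sY * H"
proof -
  define P where "P = fps2_of F"
  have P: "convergent_fps2 P" unfolding P_def by (rule convergent_fps2_of)
  have c: "convergent_fps2 (fps_const (P $ 0))"
    using P by (rule convergent_fps2_dominated[of _ _ 0 0]) auto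
  have "quo_Y 1 (fps_const (P $ 0)) = fps_const (fps_shift 1 (P $ 0))"
    by (simp add: fps_eq_iff)
  hence "convergent_fps2 (fps_const (fps_shift 1 (P $ 0)))"
    using convergent_fps2_quo_Y[OF c, of 1] by simp
  then obtain G H where GH: "fps2_of G = fps_shift 1 P" "fps2_of H = fps_const (fps_shift 1 (P $ 0))"
    using obtain_series[OF convergent_fps2_shift[OF P]] obtain_series by metis
  have "F = sc (P $ 0 $ 0) + sX * G + sY * H"
    using fps2_decomp[of P] unfolding P_def[symmetric] GH[symmetric] by (simp add: fps2_of_simps P_def[symmetric] flip: fps2_of_inject)
  thus ?thesis by blast
qed

definition cofinF :: "complex fps fps set \<Rightarrow> bool" where
  "cofinF V \<longleftrightarrow> (\<exists>k. fps_X ^ k \<in> V) \<and> (\<exists>k. fY ^ k \<in> V)"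

lemma cofinF_mono: "cofinF V \<Longrightarrow> V \<subseteq> W \<Longrightarrow> cofinF W"
  unfolding cofinF_def by blast

lemma cofinF_fincod: "cofinF V \<Longrightarrow> isidl V \<Longrightarrow> fincod V"
  unfolding cofinF_def using fincod_if_powers fps2_decomp by blast

lemma cofin_fincod: "cofin V \<Longrightarrow> isidl V \<Longrightarrow> fincod V"
  unfolding cofin_def using fincod_if_powers[OF series_decomp] by blast

lemma clin_fps2_of: "clin fps2_of"
  by (auto simp: clin_def fps2_of_simps)

text \<open>Membership in a monomial ideal only says that certain coefficients vanish. The cofactors
  can therefore be obtained from x itself by shifting and cutting off, and these operations preserve
  convergence.\<close>

lemma formal_monomial_ideal:
  assumes "fps2_of x = fps_X ^ k * \<alpha> + fY ^ l * \<beta>"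
  shows "x \<in> gen2 (sX ^ k) (sY ^ l)"
proof -
  have z: "fps2_of x $ i $ j = 0" if "i < k" "j < l" for i j
    unfolding assms using that by (simp add: fps_X_power_mult_nth fps_const_power)
  define P where "P = fps2_of x"
  have P: "convergent_fps2 P" unfolding P_def by (rule convergent_fps2_of)
  define C where "C = fps_cutoff k P"
  have C: "convergent_fps2 C" using P by (rule convergent_fps2_dominated[of _ _ 0 0]) (auto simp: C_def)
  have "rem_Y l C = 0" using z by (simp add: fps_eq_iff C_def P_def)
  hence CY: "C = quo_Y l C * fY ^ l"
    using quo_rem_Y[of l C] by (simp add: fps_const_power mult.commute)
  obtain a b where ab: "fps2_of a = fps_shift k P" "fps2_of b = quo_Y l C"
    using obtain_series[OF convergent_fps2_shift[OF P]] obtain_series[OF convergent_fps2_quo_Y[OF C]] by metis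
  have "P = fps_shift k P * fps_X ^ k + C"
    unfolding C_def by (simp add: fps_eq_iff fps_X_power_mult_right_nth)
  hence "P = fps2_of a * fps_X ^ k + fps2_of b * fY ^ l" using CY ab by simp
  hence "x = a * sX ^ k + b * sY ^ l"
    unfolding P_def by (simp add: fps2_of_simps fps2_of_power flip: fps2_of_inject)
  thus ?thesis using gen2I by metis
qed

lemma im_sum_fps2_of:
  assumes "isidl V" "fps_X ^ k \<in> V" "fY ^ l \<in> V"
  shows "im_sum fps2_of UNIV V = UNIV"
proof (rule monomials_span[OF _ assms])
  show "\<exists>c G H. F = sc c + fps_X * G + fY * H" for F using fps2_decomp by blast
  show "csub (im_sum fps2_of UNIV V)"
    by (intro csub_im_sum clin_fps2_of csub_UNIV isidl_csub assms)
  show "V \<subseteq> im_sum fps2_of UNIV V"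
    unfolding im_sum_def using fps2_of_simps(4) by force
  fix i j
  have "fps_X ^ i * fY ^ j = fps2_of (sX ^ i * sY ^ j) + 0"
    by (simp add: fps2_of_simps fps2_of_power)
  thus "fps_X ^ i * fY ^ j \<in> im_sum fps2_of UNIV V"
    unfolding im_sum_def using isidlD(1)[OF assms(1)] by blast
qed

text \<open>Completion does not change the quotient. The map to the formal quotient is onto since
  monomials span modulo powers of X and Y. It is injective since formal cofactors can be replaced by
  convergent ones up to an error in the ideal of X^k and Y^l; this error is itself convergent and
  thus lies in V.\<close>

lemma gen3_formal:
  assumes "cofin (gen3 a b c)"
  shows "cofinF (gen3 (fps2_of a) (fps2_of b) (fps2_of c))"
    "quot_dim (gen3 a b c) = codim (gen3 (fps2_of a) (fps2_of b) (fps2_of c))"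
proof -
  define V where "V = gen3 a b c"
  define W where "W = gen3 (fps2_of a) (fps2_of b) (fps2_of c)"
  have V: "isidl V" "fincod V"
    unfolding V_def using assms by (auto intro: cofin_fincod isidl_gen3)
  have W: "isidl W" unfolding W_def by (rule isidl_gen3)
  have VW: "fps2_of x \<in> W" if "x \<in> V" for x
    using that unfolding V_def W_def by (auto elim!: gen3E simp: fps2_of_simps gen3I)
  obtain k l where kl: "sX ^ k \<in> V" "sY ^ l \<in> V" using assms unfolding V_def cofin_def by blast
  have WX: "fps_X ^ k \<in> W" "fY ^ l \<in> W"
    using VW[OF kl(1)] VW[OF kl(2)] by (simp_all add: fps2_of_simps fps2_of_power)
  show cW: "cofinF (gen3 (fps2_of a) (fps2_of b) (fps2_of c))"
    using WX unfolding W_def cofinF_def by blast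
  have split: "\<exists>\<beta> \<gamma> \<delta>. \<alpha> = fps2_of \<beta> + (fps_X ^ k * \<gamma> + fY ^ l * \<delta>)" for \<alpha>
  proof -
    have "\<alpha> \<in> im_sum fps2_of UNIV (gen2 (fps_X ^ k) (fY ^ l))"
      by (subst im_sum_fps2_of[OF isidl_gen2 gen2_mem]) auto
    thus ?thesis unfolding im_sum_def gen2_def by (auto simp: mult.commute)
  qed
  have WV: "x \<in> V" if xW: "fps2_of x \<in> W" for x
  proof -
    obtain \<alpha> \<beta> \<gamma> where *: "fps2_of x = \<alpha> * fps2_of a + \<beta> * fps2_of b + \<gamma> * fps2_of c"
      using xW unfolding W_def by (rule gen3E)
    obtain \<alpha>0 \<alpha>1 \<alpha>2 \<beta>0 \<beta>1 \<beta>2 \<gamma>0 \<gamma>1 \<gamma>2 where s: "\<alpha> = fps2_of \<alpha>0 + (fps_X ^ k * \<alpha>1 + fY ^ l * \<alpha>2)"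
      "\<beta> = fps2_of \<beta>0 + (fps_X ^ k * \<beta>1 + fY ^ l * \<beta>2)" "\<gamma> = fps2_of \<gamma>0 + (fps_X ^ k * \<gamma>1 + fY ^ l * \<gamma>2)"
      using split by metis
    define z where "z = \<alpha>0 * a + \<beta>0 * b + \<gamma>0 * c"
    have "fps2_of (x - z) = fps_X ^ k * (\<alpha>1 * fps2_of a + \<beta>1 * fps2_of b + \<gamma>1 * fps2_of c)
        + fY ^ l * (\<alpha>2 * fps2_of a + \<beta>2 * fps2_of b + \<gamma>2 * fps2_of c)"
      unfolding z_def using * by (simp add: fps2_of_simps s algebra_simps)
    hence "x - z \<in> gen2 (sX ^ k) (sY ^ l)" by (rule formal_monomial_ideal)
    hence "x - z \<in> V" using gen2_least[OF V(1) kl] by blast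
    moreover have "z \<in> V" unfolding z_def V_def by (rule gen3I)
    ultimately have "(x - z) + z \<in> V" by (rule isidlD(2)[OF V(1)])
    thus ?thesis by simp
  qed
  have "codim W = codim (im_sum fps2_of UNIV W) + codim V"
    using WV VW V(2) by (intro codim_image_eq(2) clin_fps2_of isidl_csub[OF W]) (auto simp: im_sum_fps2_of[OF W WX])
  hence "codim W = codim V" by (simp add: im_sum_fps2_of[OF W WX])
  thus "quot_dim (gen3 a b c) = codim (gen3 (fps2_of a) (fps2_of b) (fps2_of c))"
    using quot_dim_eqI[OF V(1) fincod_reldim[OF V(2)]] unfolding V_def W_def by simp
qed

lemma gen2_formal:
  assumes "cofin (gen2 a b)"
  shows "cofinF (gen2 (fps2_of a) (fps2_of b))"
    "quot_dim (gen2 a b) = codim (gen2 (fps2_of a) (fps2_of b))"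
  using gen3_formal[of a b 0] assms by (simp_all add: gen2_gen3 fps2_of_simps)

section \<open>Puiseux roots\<close>

lemma fps_X_power_dvd_iff: "fps_X ^ k dvd f \<longleftrightarrow> (\<forall>n<k. f $ n = 0)"
  for f :: "'a :: comm_ring_1 fps"
proof
  assume "\<forall>n<k. f $ n = 0"
  hence "f = fps_X ^ k * fps_shift k f" by (simp add: fps_eq_iff fps_X_power_mult_nth)
  thus "fps_X ^ k dvd f" by (rule dvdI)
qed (auto simp: dvd_def fps_X_power_mult_nth)

lemma fps_eq_0_if_X_power_dvd:
  "(\<And>k. fps_X ^ k dvd f) \<Longrightarrow> f = 0" for f :: "'a :: comm_ring_1 fps"
  unfolding fps_X_power_dvd_iff by (auto simp: fps_eq_iff)

lemma poly_diff_factor: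
  fixes P :: "'a :: comm_ring_1 fps poly"
  assumes "y $ 0 = 0" "z $ 0 = 0"
  shows "\<exists>Q. poly P y - poly P z = (y - z) * Q \<and> Q $ 0 = coeff P 1 $ 0"
proof (induction P)
  case 0
  show ?case by (intro exI[of _ 0]) simp
next
  case (pCons a P)
  then obtain Q where Q: "poly P y - poly P z = (y - z) * Q" by blast
  have "poly P w $ 0 = coeff P 0 $ 0" if "w $ 0 = 0" for w
    using that by (cases P) auto
  hence "(poly P y + z * Q) $ 0 = coeff (pCons a P) 1 $ 0" using assms by simp
  moreover have "y * poly P y - z * poly P z = (y - z) * poly P y + z * (poly P y - poly P z)"
    by (simp add: algebra_simps)
  hence "poly (pCons a P) y - poly (pCons a P) z = (y - z) * (poly P y + z * Q)"
    by (simp add: Q algebra_simps)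
  ultimately show ?case by blast
qed

text \<open>Newton iteration with the fixed slope \<open>coeff P 1 $ 0\<close>: T gains one power of
  the variable in each step, and the limit y of the iterates is a fixed point of T.\<close>

lemma hensel_simple_root:
  fixes P :: "'a :: field fps poly"
  assumes "coeff P 0 $ 0 = 0" "coeff P 1 $ 0 \<noteq> 0"
  shows "\<exists>y. y $ 0 = 0 \<and> poly P y = 0"
proof -
  define d where "d = inverse (coeff P 1 $ 0)"
  define T where "T = (\<lambda>y. y - fps_const d * poly P y)"
  have P0: "poly P w $ 0 = 0" if "w $ 0 = 0" for w
    using that assms(1) by (cases P) auto
  have T0: "T w $ 0 = 0" if "w $ 0 = 0" for w
    using P0[OF that] that by (simp add: T_def)
  have contr: "fps_X ^ Suc k dvd T y - T z" if yz: "y $ 0 = 0" "z $ 0 = 0" "fps_X ^ k dvd y - z" for y z k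
  proof -
    obtain Q where Q: "poly P y - poly P z = (y - z) * Q" "Q $ 0 = coeff P 1 $ 0"
      using poly_diff_factor[OF yz(1,2), of P] by blast
    have "T y - T z = (y - z) - fps_const d * (poly P y - poly P z)"
      by (simp add: T_def algebra_simps)
    hence "T y - T z = (y - z) * (1 - fps_const d * Q)"
      unfolding Q(1) by (simp add: algebra_simps)
    moreover have "fps_X dvd 1 - fps_const d * Q"
      using Q(2) assms(2) fps_X_power_dvd_iff[of 1 "1 - fps_const d * Q"] by (simp add: d_def)
    ultimately show ?thesis using mult_dvd_mono[OF yz(3)] by (metis mult.commute power_Suc)
  qed
  define Y where "Y = (\<lambda>k. (T ^^ k) 0)"
  have Y0: "Y k $ 0 = 0" for k by (induction k) (auto simp: Y_def T0)
  have YS: "fps_X ^ Suc k dvd Y (Suc k) - Y k" for k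
  proof (induction k)
    case 0
    show ?case unfolding fps_X_power_dvd_iff using Y0[of 1] Y0[of 0] by simp
  next
    case (Suc k)
    have "Y (Suc (Suc k)) = T (Y (Suc k))" "Y (Suc k) = T (Y k)" by (auto simp: Y_def)
    thus ?case using contr[OF Y0 Y0 Suc] by metis
  qed
  have stab: "Y (n + k) $ n = Y n $ n" for n k
  proof (induction k)
    case (Suc k)
    have "(Y (Suc (n + k)) - Y (n + k)) $ n = 0"
      using YS[of "n + k"] unfolding fps_X_power_dvd_iff by auto
    thus ?case using Suc by simp
  qed simp
  define y where "y = Abs_fps (\<lambda>n. Y n $ n)"
  have y0: "y $ 0 = 0" using Y0 by (simp add: y_def)
  have yY: "fps_X ^ Suc k dvd y - Y k" for k
    unfolding fps_X_power_dvd_iff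
  proof (intro allI impI)
    fix n assume "n < Suc k"
    hence "Y (n + (k - n)) = Y k" by simp
    thus "(y - Y k) $ n = 0" using stab[of n "k - n"] by (simp add: y_def)
  qed
  have "fps_X ^ k dvd T y - y" for k
  proof -
    have 1: "fps_X ^ Suc k dvd T y - T (Y k)"
      using contr[OF y0 Y0, of k k] yY[of k] by (metis dvd_trans le_imp_power_dvd le_Suc_eq order_refl)
    have TY: "T (Y k) = Y (Suc k)" by (simp add: Y_def)
    have 2: "fps_X ^ Suc k dvd y - Y (Suc k)"
      using yY[of "Suc k"] by (metis dvd_trans le_imp_power_dvd le_Suc_eq order_refl)
    have "fps_X ^ Suc k dvd T y - y" using dvd_diff[OF 1 2] TY by simp
    thus ?thesis by (metis dvd_trans le_imp_power_dvd le_Suc_eq order_refl)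
  qed
  hence "T y - y = 0" by (rule fps_eq_0_if_X_power_dvd)
  hence "fps_const d * poly P y = 0" by (simp add: T_def)
  hence "poly P y = 0" using assms(2) by (simp add: d_def)
  thus ?thesis using y0 by blast
qed

text \<open>The base change t -> t^N that makes fractional exponents integral. On series in two
  variables it replaces X by X^N and leaves Y alone.\<close>

abbreviation ramify :: "nat \<Rightarrow> 'a :: comm_ring_1 fps \<Rightarrow> 'a fps" where
  "ramify N a \<equiv> a oo fps_X ^ N"

lemma fps_X_power_0 [simp]: "N > 0 \<Longrightarrow> (fps_X ^ N :: 'a :: comm_ring_1 fps) $ 0 = 0"
  by (simp add: fps_X_power_nth)

lemma ramify_mult: "N > 0 \<Longrightarrow> ramify N (a * b) = ramify N a * ramify N b" for a b :: "'a :: idom fps"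
  by (rule fps_compose_mult_distrib) simp

lemma ramify_X: "N > 0 \<Longrightarrow> ramify N fps_X = (fps_X ^ N :: 'a :: idom fps)"
  by (rule fps_X_fps_compose_startby0) simp

lemma ramify_power: "N > 0 \<Longrightarrow> ramify N (a ^ k) = ramify N a ^ k" for a :: "'a :: idom fps"
  by (rule fps_compose_power[symmetric]) simp

lemma ramify_ramify: "N > 0 \<Longrightarrow> M > 0 \<Longrightarrow> ramify M (ramify N a) = ramify (N * M) a" for a :: "'a :: idom fps"
  by (simp add: fps_compose_assoc[symmetric] ramify_power ramify_X mult.commute flip: power_mult)

lemma ramify_nth: "N > 0 \<Longrightarrow> ramify N a $ n = (if N dvd n then a $ (n div N) else 0)" for a :: "'a :: comm_ring_1 fps"
proof -
  assume N: "N > 0"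
  have "ramify N a $ n = (\<Sum>i=0..n. a $ i * (if n = N * i then 1 else 0))"
    by (simp add: fps_compose_nth fps_X_power_nth flip: power_mult)
  also have "\<dots> = (\<Sum>i\<in>{0..n}. if i = n div N \<and> N dvd n then a $ i else 0)"
    using N by (intro sum.cong) auto
  also have "\<dots> = (if N dvd n then a $ (n div N) else 0)"
    by (auto simp: sum.delta' div_le_dividend intro: sum.neutral)
  finally show ?thesis .
qed

text \<open>The value P(t^N, y(t)) of a polynomial in Y over the series in X. When it is zero,
  y(X^(1/N)) is a Puiseux root of P.\<close>

definition psub :: "nat \<Rightarrow> 'a :: idom fps poly \<Rightarrow> 'a fps \<Rightarrow> 'a fps" where
  "psub N P y = poly (map_poly (ramify N) P) y"

lemma psub_0 [simp]: "psub N 0 y = 0"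
  by (simp add: psub_def)

lemma psub_pCons [simp]: "psub N (pCons a P) y = ramify N a + y * psub N P y"
  by (simp add: psub_def map_poly_pCons)

lemma psub_add: "psub N (P + Q) y = psub N P y + psub N Q y"
  by (induction P Q rule: poly_induct2) (auto simp: fps_compose_add_distrib algebra_simps)

lemma psub_smult: "N > 0 \<Longrightarrow> psub N (smult a P) y = ramify N a * psub N P y"
  by (induction P) (auto simp: ramify_mult algebra_simps)

lemma psub_mult: "N > 0 \<Longrightarrow> psub N (P * Q) y = psub N P y * psub N Q y"
  by (induction P) (auto simp: psub_add psub_smult algebra_simps)

lemma psub_pcompose: "N > 0 \<Longrightarrow> psub N (pcompose P Q) y = psub N P (psub N Q y)"
  by (induction P) (auto simp: psub_add psub_mult pcompose_pCons algebra_simps)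

lemma psub_sum: "psub N (sum f A) y = (\<Sum>i\<in>A. psub N (f i) y)"
  by (induction A rule: infinite_finite_induct) (auto simp: psub_add)

lemma psub_monom: "psub N (monom a j) y = ramify N a * y ^ j"
  by (induction j) (auto simp: monom_0 monom_Suc algebra_simps)

lemma psub_altdef: "psub N P y = (\<Sum>j\<le>degree P. ramify N (coeff P j) * y ^ j)"
  by (subst poly_as_sum_of_monoms[of P, symmetric]) (simp only: psub_sum psub_monom)

lemma psub_1: "psub 1 P y = poly P y"
  by (induction P) auto

definition const_coeffs :: "'a :: comm_ring_1 fps poly \<Rightarrow> 'a poly" where
  "const_coeffs P = map_poly (\<lambda>a. a $ 0) P"

lemma coeff_const_coeffs [simp]: "coeff (const_coeffs P) j = coeff P j $ 0"
  by (simp add: const_coeffs_def coeff_map_poly)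

lemma const_coeffs_mult: "const_coeffs (P * Q) = const_coeffs P * const_coeffs Q"
  by (simp add: poly_eq_iff coeff_mult fps_sum_nth)

lemma const_coeffs_add: "const_coeffs (P + Q) = const_coeffs P + const_coeffs Q"
  by (simp add: poly_eq_iff)

lemma const_coeffs_pCons: "const_coeffs (pCons a P) = pCons (a $ 0) (const_coeffs P)"
  by (simp add: poly_eq_iff coeff_pCons split: nat.splits)

lemma const_coeffs_pcompose: "const_coeffs (pcompose P Q) = pcompose (const_coeffs P) (const_coeffs Q)"
proof (induction P)
  case 0
  have "const_coeffs 0 = (0 :: 'a poly)" by (simp add: poly_eq_iff)
  thus ?case by simp
next
  case (pCons a P)
  have "const_coeffs (0 :: 'a fps poly) = 0" by (simp add: poly_eq_iff)
  thus ?case by (simp add: pcompose_pCons const_coeffs_add const_coeffs_mult const_coeffs_pCons pCons.IH)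
qed

lemma higher_pderiv_shift:
  "(pderiv ^^ k) (pcompose P [:s, 1:]) = pcompose ((pderiv ^^ k) P) [:s, 1 :: 'a :: idom:]"
  by (induction k) (auto simp: pderiv_pcompose pderiv_pCons)

text \<open>P can have degree above m, so the usual shift by a multiple of the coefficient in degree
  m - 1 does not suffice. Instead s is a root of the derivative of order m - 1, whose value at s is
  (m-1)! times the new coefficient. Modulo X this derivative has 0 as a simple root.\<close>

lemma tschirnhaus:
  fixes P :: "complex fps poly"
  assumes "m > 0" "\<And>j. j < m \<Longrightarrow> coeff P j $ 0 = 0" "coeff P m $ 0 \<noteq> 0"
  obtains s where "s $ 0 = 0" "coeff (pcompose P [:s, 1:]) (m - 1) = 0"
    "\<And>j. coeff (pcompose P [:s, 1:]) j $ 0 = coeff P j $ 0"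
proof -
  define D where "D = (pderiv ^^ (m - 1)) P"
  have poch: "pochhammer (of_nat (Suc n)) k $ 0 \<noteq> (0 :: complex)" for n k
  proof -
    have "pochhammer (of_nat (Suc n)) k = (of_nat (pochhammer (Suc n) k) :: complex fps)"
      by (rule pochhammer_of_nat)
    also have "\<dots> $ 0 = of_nat (pochhammer (Suc n) k)" by (simp add: fps_of_nat[symmetric] del: fps_of_nat)
    finally show ?thesis using pochhammer_pos[of "Suc n" k] by simp
  qed
  have "coeff D 0 $ 0 = 0" "coeff D 1 $ 0 \<noteq> 0"
    unfolding D_def coeff_higher_pderiv fps_mult_nth_0 using assms poch[of 1 "m - 1"] by auto
  then obtain s where s: "s $ 0 = 0" "poly D s = 0" using hensel_simple_root[of D] by blast
  let ?P = "pcompose P [:s, 1:]"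
  have "coeff ((pderiv ^^ (m - 1)) ?P) 0 = 0"
    unfolding higher_pderiv_shift D_def[symmetric] using s
    by (simp add: poly_pcompose flip: poly_0_coeff_0)
  hence "pochhammer (of_nat (Suc 0)) (m - 1) * coeff ?P (m - 1) = 0"
    unfolding coeff_higher_pderiv by simp
  moreover have "pochhammer (of_nat (Suc 0)) (m - 1) \<noteq> (0 :: complex fps)" using poch[of 0 "m - 1"] by auto
  ultimately have "coeff ?P (m - 1) = 0" by simp
  moreover have "const_coeffs ?P = const_coeffs P"
  proof -
    have "const_coeffs [:s, 1:] = [:0, 1:]" using s by (simp add: poly_eq_iff coeff_pCons split: nat.splits)
    thus ?thesis by (simp add: const_coeffs_pcompose)
  qed
  hence "coeff ?P j $ 0 = coeff P j $ 0" for j by (metis coeff_const_coeffs)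
  ultimately show ?thesis using that s by blast
qed

text \<open>A root z of multiplicity m would give p = c (Y - z)^m. Its coefficient - m z c in degree
  m - 1 vanishes only for z = 0, and then p is a monomial.\<close>

lemma root_of_smaller_multiplicity:
  fixes p :: "complex poly"
  assumes "degree p = m" "m > 0" "coeff p (m - 1) = 0" "j < m" "coeff p j \<noteq> 0"
  obtains z k where "0 < k" "k < m" "\<And>i. i < k \<Longrightarrow> coeff (pcompose p [:z, 1:]) i = 0"
    "coeff (pcompose p [:z, 1:]) k \<noteq> 0"
proof -
  have p: "p \<noteq> 0" using assms by auto
  have "\<not> constant (poly p)" using assms by (simp add: constant_degree)
  then obtain z where z: "poly p z = 0" using fundamental_theorem_of_algebra by blast
  define k where "k = order z p"
  have k0: "k > 0" using z p by (simp add: k_def order_root)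
  obtain q where q: "p = [:- z, 1:] ^ k * q" "\<not> [:- z, 1:] dvd q"
    using order_decomp[OF p] unfolding k_def by blast
  have qz: "poly q z \<noteq> 0" using q(2) by (simp add: poly_eq_0_iff_dvd)
  have "k \<le> m" using order_degree[OF p] assms unfolding k_def by simp
  moreover have "k \<noteq> m"
  proof
    assume km: "k = m"
    have q0: "q \<noteq> 0" using q p by auto
    have "degree p = k + degree q"
      using q0 by (subst q(1), subst degree_mult_eq) (auto simp: degree_linear_power)
    hence "degree q = 0" using km assms by simp
    then obtain c where c: "q = [:c:]" by (rule degree_eq_zeroE)
    have pc: "coeff p i = of_nat (m choose i) * (- z) ^ (m - i) * c" if "i \<le> m" for i
      using that by (simp add: q(1) c km coeff_linear_poly_power mult.commute)
    have "of_nat m * z * c = 0"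
      using pc[of "m - 1"] assms binomial_symmetric[of 1 m] by (auto simp: mult_ac)
    hence "z = 0" using q0 c assms by auto
    hence "coeff p j = 0" using pc[of j] assms by simp
    thus False using assms by simp
  qed
  ultimately have km: "k < m" by simp
  have "pcompose ([:- z, 1:] ^ k) [:z, 1:] = [:0, 1:] ^ k"
  proof (induction k)
    case (Suc k)
    have "pcompose [:- z, 1:] [:z, 1:] = [:0, 1:]" by (simp add: pcompose_pCons)
    thus ?case by (simp only: power_Suc pcompose_mult Suc.IH)
  qed (simp add: pcompose_1)
  hence e: "pcompose p [:z, 1:] = monom 1 k * pcompose q [:z, 1:]"
    unfolding q(1) pcompose_mult by (simp add: monom_altdef)
  have "coeff (pcompose q [:z, 1:]) 0 = poly q z"
    by (simp add: poly_pcompose flip: poly_0_coeff_0)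
  hence "coeff (pcompose p [:z, 1:]) k \<noteq> 0" unfolding e coeff_monom_mult using qz by simp
  moreover have "coeff (pcompose p [:z, 1:]) i = 0" if "i < k" for i
    unfolding e coeff_monom_mult using that by simp
  ultimately show ?thesis using that[OF k0 km] by blast
qed

text \<open>Newton's method by induction on the order m of P(0, Y). After the Tschirnhaus shift,
  rescaling X and Y along an edge of the Newton polygon gives a polynomial whose reduction has
  degree m, no term of degree m - 1 and another nonzero term. It has a root of multiplicity below m,
  and the induction hypothesis applies at that root.\<close>

lemma puiseux_root:
  fixes P :: "complex fps poly"
  assumes "m > 0" "\<And>j. j < m \<Longrightarrow> coeff P j $ 0 = 0" "coeff P m $ 0 \<noteq> 0"
  shows "\<exists>N y. N > 0 \<and> y $ 0 = 0 \<and> psub N P y = 0"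
  using assms
proof (induction m arbitrary: P rule: less_induct)
  case (less m)
  obtain s where s: "s $ 0 = 0" "coeff (pcompose P [:s, 1:]) (m - 1) = 0"
    "\<And>j. coeff (pcompose P [:s, 1:]) j $ 0 = coeff P j $ 0"
    using tschirnhaus[OF less.prems] by blast
  define A where "A = pcompose P [:s, 1:]"
  define a where "a = coeff A"
  have a: "a (m - 1) = 0" "\<And>j. j < m \<Longrightarrow> a j $ 0 = 0" "a m $ 0 \<noteq> 0"
    unfolding a_def A_def using s less.prems by auto
  have "\<exists>N y. N > 0 \<and> y $ 0 = 0 \<and> psub N A y = 0"
  proof (cases "\<forall>j<m. a j = 0")
    case True
    have "psub 1 A 0 = 0" using True less.prems(1) unfolding psub_1 a_def by (simp add: poly_0_coeff_0)
    thus ?thesis by (intro exI[of _ 1] exI[of _ 0]) auto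
  next
    case False
    define S where "S = {j. j < m \<and> a j \<noteq> 0}"
    \<comment> \<open>\<rho> j is the order that Y must have for a_j Y^j to balance a_m Y^m. The
      minimum p / q, not necessarily in lowest terms, is the largest exponent for which the rescaled
      coefficients stay integral.\<close>
    define \<rho> where "\<rho> = (\<lambda>j. real (subdegree (a j)) / real (m - j))"
    have S: "finite S" "S \<noteq> {}" using False by (auto simp: S_def)
    obtain j0 where j0: "j0 \<in> S" "\<And>j. j \<in> S \<Longrightarrow> \<rho> j0 \<le> \<rho> j"
      using ex_min_if_finite[of "\<rho> ` S"] S by (auto simp: not_less)
    define p where "p = subdegree (a j0)"
    define q where "q = m - j0"
    have j0': "j0 < m" "a j0 \<noteq> 0" using j0 by (auto simp: S_def)
    have p: "p > 0" using j0' a(2)[of j0] unfolding p_def by (metis gr0I nth_subdegree_nonzero)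
    have q: "q > 0" using j0' by (simp add: q_def)
    have slope: "p * (m - j) \<le> q * subdegree (a j)" if "j \<in> S" for j
    proof -
      have "real p / real q \<le> real (subdegree (a j)) / real (m - j)" "m - j > 0"
        using j0(2)[OF that] that unfolding \<rho>_def p_def q_def by (auto simp: S_def)
      hence "real (p * (m - j)) \<le> real (q * subdegree (a j))" using q by (simp add: field_simps)
      thus ?thesis by linarith
    qed
    \<comment> \<open>These are the coefficients of t^(- p m) A(t^q, t^p Y).\<close>
    define b where "b = (\<lambda>j. fps_shift (p * m) (ramify q (a j) * fps_X ^ (p * j)))"
    have b: "fps_X ^ (p * m) * b j = ramify q (a j) * fps_X ^ (p * j)" for j
    proof -
      have "fps_X ^ (p * m) dvd ramify q (a j) * fps_X ^ (p * j)"
      proof (cases "j \<ge> m \<or> a j = 0")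
        case True
        thus ?thesis by (cases "a j = 0") (auto intro!: dvd_mult le_imp_power_dvd)
      next
        case False
        hence "p * (m - j) \<le> q * subdegree (a j)" using slope by (simp add: S_def)
        hence "p * m \<le> q * subdegree (a j) + p * j" using False
          by (metis add_le_mono1 add_mult_distrib2 le_add_diff_inverse2 linorder_not_le nat_le_linear)
        moreover have "subdegree (ramify q (a j) * fps_X ^ (p * j)) = q * subdegree (a j) + p * j"
        proof -
          have "subdegree (ramify q (a j)) = q * subdegree (a j)" using q by (simp add: fps_X_power_subdegree)
          moreover have "ramify q (a j) \<noteq> 0" using False q by (simp add: fps_compose_eq_0_iff)
          ultimately show ?thesis by (simp add: fps_X_power_subdegree)
        qed
        ultimately show ?thesis
          unfolding fps_X_power_dvd_iff by (intro allI impI nth_less_subdegree_zero) linarith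
      qed
      thus ?thesis unfolding b_def by (auto simp: dvd_def fps_eq_iff fps_X_power_mult_nth)
    qed
    have b0: "b j $ 0 = (if p * m < p * j then 0 else ramify q (a j) $ (p * m - p * j))" for j
      by (simp add: b_def fps_X_power_mult_right_nth)
    define B where "B = (\<Sum>j\<le>degree A. monom (b j) j)"
    have coeffB: "coeff B j = (if j \<le> degree A then b j else 0)" for j
      by (simp add: B_def coeff_sum)
    have degA: "m \<le> degree A" using a(3) unfolding a_def by (metis fps_zero_nth le_degree)
    \<comment> \<open>At t = 0 no term of degree above m survives, and the index j0 of minimal slope
      contributes a nonzero coefficient besides the one in degree m.\<close>
    define p0 where "p0 = const_coeffs B"
    have p0m: "coeff p0 m \<noteq> 0" unfolding p0_def using degA a(3) by (simp add: coeffB b0)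
    have p0gt: "coeff p0 j = 0" if "j > m" for j
      unfolding p0_def using that p by (simp add: coeffB b0)
    have degp0: "degree p0 = m" using p0m p0gt by (metis le_degree leI le_antisym leading_coeff_0_iff coeff_0)
    have p0m1: "coeff p0 (m - 1) = 0" unfolding p0_def using a(1) by (simp add: coeffB b0)
    have "p * m - p * j0 = q * p" by (simp add: q_def diff_mult_distrib2 mult.commute diff_mult_distrib)
    hence "coeff p0 j0 = a j0 $ p"
      unfolding p0_def using degA j0' q by (simp add: coeffB b0 ramify_nth)
    hence p0j0: "coeff p0 j0 \<noteq> 0" using j0' by (simp add: p_def)
    obtain z k where zk: "0 < k" "k < m" "\<And>i. i < k \<Longrightarrow> coeff (pcompose p0 [:z, 1:]) i = 0"
      "coeff (pcompose p0 [:z, 1:]) k \<noteq> 0"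
      using root_of_smaller_multiplicity[OF degp0 less.prems(1) p0m1 j0'(1) p0j0] by blast
    define C where "C = pcompose B [:fps_const z, 1:]"
    have "const_coeffs [:fps_const z, 1:] = [:z, 1:]"
      by (simp add: poly_eq_iff coeff_pCons split: nat.splits)
    hence "const_coeffs C = pcompose p0 [:z, 1:]"
      by (simp add: C_def p0_def const_coeffs_pcompose)
    hence C: "coeff C i $ 0 = coeff (pcompose p0 [:z, 1:]) i" for i by (metis coeff_const_coeffs)
    obtain M w where M: "M > 0" "w $ 0 = 0" "psub M C w = 0"
      using less.IH[OF zk(2) zk(1), of C] zk C by auto
    define v where "v = fps_const z + w"
    have "psub M B v = 0" using M unfolding C_def by (simp add: psub_pcompose v_def)
    moreover have "psub (q * M) A (fps_X ^ (p * M) * v) = fps_X ^ (p * m * M) * psub M B v"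
    proof -
      have "psub (q * M) A (fps_X ^ (p * M) * v)
          = (\<Sum>j\<le>degree A. ramify (q * M) (a j) * fps_X ^ (p * j * M) * v ^ j)"
        by (simp add: psub_altdef a_def power_mult_distrib mult_ac flip: power_mult)
      also have "\<dots> = (\<Sum>j\<le>degree A. ramify M (ramify q (a j) * fps_X ^ (p * j)) * v ^ j)"
        using q M by (simp add: ramify_mult ramify_power ramify_X ramify_ramify mult_ac flip: power_mult)
      also have "\<dots> = (\<Sum>j\<le>degree A. fps_X ^ (p * m * M) * (ramify M (b j) * v ^ j))"
        unfolding b[symmetric] using M by (simp add: ramify_mult ramify_power ramify_X mult_ac flip: power_mult)
      also have "\<dots> = fps_X ^ (p * m * M) * psub M B v"
        by (simp add: B_def psub_sum psub_monom sum_distrib_left)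
      finally show ?thesis .
    qed
    ultimately have "psub (q * M) A (fps_X ^ (p * M) * v) = 0" by simp
    moreover have "(fps_X ^ (p * M) * v) $ 0 = 0" using p M by simp
    ultimately show ?thesis using q M by (intro exI[of _ "q * M"] exI[of _ "fps_X ^ (p * M) * v"]) simp
  qed
  then obtain N y where Ny: "N > 0" "y $ 0 = 0" "psub N A y = 0" by blast
  hence "psub N P (psub N [:s, 1:] y) = 0" by (simp add: A_def psub_pcompose)
  moreover have "psub N [:s, 1:] y $ 0 = 0" using Ny s by simp
  ultimately show ?case using Ny by blast
qed

section \<open>Evaluation along a parametrization\<close>

text \<open>Coinduction for identities between power series: \<open>D x\<close> will be the difference of the two sides.\<close>

lemma fps_vanish:
  fixes D :: "'b \<Rightarrow> 'a :: comm_ring_1 fps"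
  assumes "\<And>x. \<exists>x'. D x = fps_X * D x'"
  shows "D x = 0"
proof (rule fps_eq_0_if_X_power_dvd)
  fix k show "fps_X ^ k dvd D x"
  proof (induction k arbitrary: x)
    case (Suc k)
    obtain x' where "D x = fps_X * D x'" using assms by blast
    thus ?case using Suc[of x'] by (simp add: mult_dvd_mono)
  qed simp
qed

lemma fps_shift_1_const_mult:
  "fps_shift 1 (fps_const a * G) = fps_const a * fps_shift 1 G" for G :: "'a :: comm_ring_1 fps"
  by (simp add: fps_eq_iff)

text \<open>Divide F(0, Y) by w(0, Y) = Y^n u, subtract, divide the rest by X and repeat. The map
  \<open>s\<close> is one such round; A and R collect the quotients and remainders.\<close>

lemma formal_weierstrass_division:
  fixes w F :: "'a :: field fps fps"
  assumes "w $ 0 \<noteq> 0"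
  obtains A R where "F = w * A + R" "\<And>i j. subdegree (w $ 0) \<le> j \<Longrightarrow> R $ i $ j = 0"
proof -
  define n where "n = subdegree (w $ 0)"
  define u where "u = fps_shift n (w $ 0)"
  have u: "u $ 0 \<noteq> 0" using assms by (simp add: u_def n_def)
  have wu: "w $ 0 = fps_X ^ n * u"
    unfolding u_def n_def using subdegree_decompose[of "w $ 0"] by (simp add: mult.commute)
  define q where "q = (\<lambda>f. fps_shift n f * inverse u)"
  have q: "f = w $ 0 * q f + fps_cutoff n f" for f
  proof -
    have "w $ 0 * q f = fps_X ^ n * fps_shift n f * (u * inverse u)"
      unfolding wu q_def by (simp add: mult_ac)
    also have "u * inverse u = 1" using u by (metis inverse_mult_eq_1 mult.commute)
    finally have "w $ 0 * q f + fps_cutoff n f = fps_X ^ n * fps_shift n f + fps_cutoff n f" by simp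
    also have "\<dots> = f" by (simp add: fps_eq_iff fps_X_power_mult_nth)
    finally show ?thesis by simp
  qed
  define s where "s = (\<lambda>F. fps_shift 1 (F - fps_const (fps_cutoff n (F $ 0)) - w * fps_const (q (F $ 0))))"
  have s: "F = fps_const (fps_cutoff n (F $ 0)) + w * fps_const (q (F $ 0)) + fps_X * s F" for F
  proof -
    define G where "G = F - fps_const (fps_cutoff n (F $ 0)) - w * fps_const (q (F $ 0))"
    have "G $ 0 = 0" using q[of "F $ 0"] unfolding G_def by (simp add: algebra_simps)
    hence "G = fps_X * fps_shift 1 G" using fps_X_decomp[of G] by simp
    thus ?thesis unfolding s_def G_def[symmetric] by (simp add: G_def algebra_simps)
  qed
  define A where "A = (\<lambda>F. Abs_fps (\<lambda>i. q ((s ^^ i) F $ 0)))"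
  define R where "R = (\<lambda>F. Abs_fps (\<lambda>i. fps_cutoff n ((s ^^ i) F $ 0)))"
  have rec: "A F = fps_const (q (F $ 0)) + fps_X * A (s F)"
    "R F = fps_const (fps_cutoff n (F $ 0)) + fps_X * R (s F)" for F
  proof -
    have "A F $ 0 = q (F $ 0)" "fps_shift 1 (A F) = A (s F)"
      "R F $ 0 = fps_cutoff n (F $ 0)" "fps_shift 1 (R F) = R (s F)"
      unfolding A_def R_def by (simp_all add: fps_eq_iff funpow_swap1)
    thus "A F = fps_const (q (F $ 0)) + fps_X * A (s F)"
      "R F = fps_const (fps_cutoff n (F $ 0)) + fps_X * R (s F)"
      using fps_X_decomp[of "A F"] fps_X_decomp[of "R F"] by simp_all
  qed
  have "F - (w * A F + R F) = 0"
  proof (rule fps_vanish[of "\<lambda>F. F - (w * A F + R F)"])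
    fix F
    have "F - (w * A F + R F) = fps_X * (s F - (w * A (s F) + R (s F)))"
      by (subst (1) s, subst (1) rec(1), subst (1) rec(2)) (simp add: algebra_simps)
    thus "\<exists>F'. F - (w * A F + R F) = fps_X * (F' - (w * A F' + R F'))" by blast
  qed
  moreover have "R F $ i $ j = 0" if "n \<le> j" for i j using that by (simp add: R_def)
  ultimately show ?thesis using that[of "A F" "R F"] unfolding n_def by simp
qed

text \<open>\<open>F(t, y(t))\<close>; only meaningful if \<open>y\<close> has no constant term.\<close>

definition ev :: "'a :: idom fps \<Rightarrow> 'a fps fps \<Rightarrow> 'a fps" where
  "ev y F = Abs_fps (\<lambda>n. \<Sum>i\<le>n. (F $ i oo y) $ (n - i))"

text \<open>Unfolds F = F(0, Y) + X F'. Together with \<open>fps_vanish\<close> this recursion gives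
  the product rule, the chain rule and the value on \<open>emb\<close>.\<close>

lemma ev_rec: "ev y F = (F $ 0 oo y) + fps_X * ev y (fps_shift 1 F)"
proof (rule fps_ext)
  fix n show "ev y F $ n = ((F $ 0 oo y) + fps_X * ev y (fps_shift 1 F)) $ n"
    by (cases n) (simp_all add: ev_def sum.atMost_Suc_shift del: sum.atMost_Suc)
qed

lemma ev_add: "ev y (F + G) = ev y F + ev y G"
  by (simp add: ev_def fps_eq_iff fps_compose_add_distrib sum.distrib)

lemma ev_0 [simp]: "ev y 0 = 0"
  by (simp add: ev_def fps_eq_iff)

lemma ev_diff: "ev y (F - G) = ev y F - ev y G"
  using ev_add[of y "F - G" G] by (simp add: algebra_simps)

lemma ev_sum: "ev y (sum f A) = (\<Sum>i\<in>A. ev y (f i))"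
  by (induction A rule: infinite_finite_induct) (auto simp: ev_add)

lemma ev_const: "ev y (fps_const a) = (a oo y)"
proof -
  have "fps_shift 1 (fps_const a) = 0" by (simp add: fps_eq_iff)
  thus ?thesis by (subst ev_rec) simp
qed

lemma ev_X_mult: "ev y (fps_X * F) = fps_X * ev y F"
proof -
  have "fps_shift 1 (fps_X * F) = F" by (simp add: fps_eq_iff)
  thus ?thesis by (subst ev_rec) simp
qed

lemma ev_const_mult:
  assumes "y $ 0 = 0"
  shows "ev y (fps_const a * G) = (a oo y) * ev y G"
proof -
  have "ev y (fps_const a * G) - (a oo y) * ev y G = 0"
  proof (rule fps_vanish[of "\<lambda>G. ev y (fps_const a * G) - (a oo y) * ev y G"])
    fix G
    have "ev y (fps_const a * G) = (a oo y) * (G $ 0 oo y) + fps_X * ev y (fps_const a * fps_shift 1 G)"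
      by (subst ev_rec, subst fps_shift_1_const_mult) (simp add: fps_compose_mult_distrib[OF assms])
    moreover have "ev y G = (G $ 0 oo y) + fps_X * ev y (fps_shift 1 G)" by (rule ev_rec)
    ultimately have "ev y (fps_const a * G) - (a oo y) * ev y G
        = fps_X * (ev y (fps_const a * fps_shift 1 G) - (a oo y) * ev y (fps_shift 1 G))"
      by (simp add: algebra_simps)
    thus "\<exists>G'. ev y (fps_const a * G) - (a oo y) * ev y G = fps_X * (ev y (fps_const a * G') - (a oo y) * ev y G')"
      by blast
  qed
  thus ?thesis by simp
qed

lemma ev_mult:
  assumes "y $ 0 = 0"
  shows "ev y (F * G) = ev y F * ev y G"
proof -
  have "ev y (F * G) - ev y F * ev y G = 0"
  proof (rule fps_vanish[of "\<lambda>F. ev y (F * G) - ev y F * ev y G"])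
    fix F
    have "F * G = fps_const (F $ 0) * G + fps_X * (fps_shift 1 F * G)"
      by (subst (1) fps_X_decomp) (simp add: algebra_simps)
    hence "ev y (F * G) = (F $ 0 oo y) * ev y G + fps_X * ev y (fps_shift 1 F * G)"
      by (simp add: ev_add ev_X_mult ev_const_mult[OF assms])
    moreover have "ev y F = (F $ 0 oo y) + fps_X * ev y (fps_shift 1 F)" by (rule ev_rec)
    ultimately have "ev y (F * G) - ev y F * ev y G
        = fps_X * (ev y (fps_shift 1 F * G) - ev y (fps_shift 1 F) * ev y G)"
      by (simp add: algebra_simps)
    thus "\<exists>F'. ev y (F * G) - ev y F * ev y G = fps_X * (ev y (F' * G) - ev y F' * ev y G)" by blast
  qed
  thus ?thesis by simp
qed

lemma ev_1 [simp]: "ev y 1 = 1"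
  using ev_const[of y 1] by (simp add: fps_const_1_eq_1)

lemma ev_power: "y $ 0 = 0 \<Longrightarrow> ev y (F ^ k) = ev y F ^ k"
  by (induction k) (auto simp: ev_mult)

lemma ev_X: "ev y fps_X = fps_X"
  using ev_X_mult[of y 1] by simp

lemma ev_Y: "y $ 0 = 0 \<Longrightarrow> ev y (fps_const fps_X) = y"
  by (simp add: ev_const)

definition fdY :: "'a :: comm_ring_1 fps fps \<Rightarrow> 'a fps fps" where
  "fdY F = Abs_fps (\<lambda>i. fps_deriv (F $ i))"

lemma ev_chain_rule:
  assumes "y $ 0 = 0"
  shows "fps_deriv (ev y F) = ev y (fps_deriv F) + ev y (fdY F) * fps_deriv y"
proof -
  have "fps_deriv (ev y F) - (ev y (fps_deriv F) + ev y (fdY F) * fps_deriv y) = 0"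
  proof (rule fps_vanish[of "\<lambda>F. fps_deriv (ev y F) - (ev y (fps_deriv F) + ev y (fdY F) * fps_deriv y)"])
    fix F :: "'a fps fps"
    define F' where "F' = fps_shift 1 F"
    have F: "F = fps_const (F $ 0) + fps_X * F'" unfolding F'_def by (rule fps_X_decomp)
    have "fps_deriv F = F' + fps_X * fps_deriv F'"
      by (subst F) (simp add: algebra_simps)
    hence 1: "ev y (fps_deriv F) = ev y F' + fps_X * ev y (fps_deriv F')"
      by (simp add: ev_add ev_X_mult)
    have "fdY F $ 0 = fps_deriv (F $ 0)" "fps_shift 1 (fdY F) = fdY F'"
      by (simp_all add: fdY_def F'_def fps_eq_iff)
    hence 2: "ev y (fdY F) = (fps_deriv (F $ 0) oo y) + fps_X * ev y (fdY F')"
      by (subst ev_rec) simp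
    have "ev y F = (F $ 0 oo y) + fps_X * ev y F'" unfolding F'_def by (rule ev_rec)
    hence 3: "fps_deriv (ev y F) = (fps_deriv (F $ 0) oo y) * fps_deriv y + ev y F' + fps_X * fps_deriv (ev y F')"
      by (simp add: fps_compose_deriv[OF assms] algebra_simps)
    have "fps_deriv (ev y F) - (ev y (fps_deriv F) + ev y (fdY F) * fps_deriv y)
      = fps_X * (fps_deriv (ev y F') - (ev y (fps_deriv F') + ev y (fdY F') * fps_deriv y))"
      unfolding 1 2 3 by (simp add: algebra_simps)
    thus "\<exists>F'. fps_deriv (ev y F) - (ev y (fps_deriv F) + ev y (fdY F) * fps_deriv y)
      = fps_X * (fps_deriv (ev y F') - (ev y (fps_deriv F') + ev y (fdY F') * fps_deriv y))"
      by blast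
  qed
  thus ?thesis by simp
qed

text \<open>A series in X viewed in two variables, whereas \<open>fps_const\<close> does this for a
  series in Y.\<close>

definition emb :: "'a :: comm_ring_1 fps \<Rightarrow> 'a fps fps" where
  "emb c = Abs_fps (\<lambda>i. fps_const (c $ i))"

lemma ev_emb: "ev y (emb c) = c"
proof -
  have "ev y (emb c) - c = 0"
  proof (rule fps_vanish[of "\<lambda>c. ev y (emb c) - c"])
    fix c :: "'a fps"
    have "emb c $ 0 = fps_const (c $ 0)" "fps_shift 1 (emb c) = emb (fps_shift 1 c)"
      by (simp_all add: emb_def fps_eq_iff)
    hence "ev y (emb c) = fps_const (c $ 0) + fps_X * ev y (emb (fps_shift 1 c))"
      by (subst ev_rec) simp
    moreover have "c = fps_const (c $ 0) + fps_X * fps_shift 1 c" by (rule fps_X_decomp)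
    ultimately have "ev y (emb c) - c = fps_X * (ev y (emb (fps_shift 1 c)) - fps_shift 1 c)"
      by (metis add_diff_cancel_left right_diff_distrib)
    thus "\<exists>c'. ev y (emb c) - c = fps_X * (ev y (emb c') - c')" by blast
  qed
  thus ?thesis by simp
qed

lemma emb_nth [simp]: "emb c $ i = fps_const (c $ i)"
  by (simp add: emb_def)

lemma ev_linear_factor:
  assumes "y $ 0 = 0"
  shows "ev y (fps_const fps_X - emb y) = 0"
  using assms by (simp add: ev_diff ev_Y ev_emb)

text \<open>Y - y(X) has order 1 on X = 0, so the remainder of Weierstrass division is a series in X
  alone; evaluation at Y = y identifies it.\<close>

lemma ev_remainder:
  fixes y :: "'a :: field fps"
  assumes "y $ 0 = 0"
  obtains A where "F = (fps_const fps_X - emb y) * A + emb (ev y F)"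
proof -
  define w where "w = fps_const fps_X - emb y"
  have w0: "w $ 0 = fps_X" using assms by (simp add: w_def)
  obtain A R where AR: "F = w * A + R" "\<And>i j. subdegree (w $ 0) \<le> j \<Longrightarrow> R $ i $ j = 0"
    using formal_weierstrass_division[of w F] w0 by auto
  define c where "c = Abs_fps (\<lambda>i. R $ i $ 0)"
  have "R = emb c"
    using AR(2) unfolding w0 by (simp add: fps_eq_iff c_def Suc_le_eq)
  moreover have "ev y F = ev y R"
    unfolding AR(1) using assms by (simp add: ev_add ev_mult w_def ev_linear_factor)
  ultimately have "R = emb (ev y F)" by (simp add: ev_emb)
  thus ?thesis using that AR(1) unfolding w_def by blast
qed

section \<open>Intersection multiplicities of formal series\<close>

lemma cofinF_dvd_cancel:
  assumes "cofinF (gen2 p q)" "p dvd q * s"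
  shows "p dvd s"
proof -
  have prime: "fps_X dvd a" if "fps_X dvd a * fY" for a :: "complex fps fps"
  proof -
    have "(a * fY) $ 0 = 0" using that fps_X_power_dvd_iff[of 1 "a * fY"] by simp
    thus ?thesis using fps_X_power_dvd_iff[of 1 a] by simp
  qed
  obtain k l where "fps_X ^ k \<in> gen2 p q" "fY ^ l \<in> gen2 p q" using assms(1) unfolding cofinF_def by blast
  hence "p dvd fps_X ^ k * s" "p dvd fY ^ l * s" by (simp_all add: dvd_mult_gen2[OF assms(2)])
  from dvd_of_dvd_power_mult[OF prime _ _ this] show ?thesis by simp
qed

lemma gen2_mono_dvd: "q dvd q' \<Longrightarrow> gen2 p q' \<subseteq> gen2 p q"
  by (intro gen2_least isidl_gen2 gen2_mem) (metis dvdE gen2_mem(2) isidlD(4) isidl_gen2)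

text \<open>Multiplication by q gives 0 -> R/\<langle>p, s\<rangle> -> R/\<langle>p, q s\<rangle> ->
  R/\<langle>p, q\<rangle> -> 0. It is injective because p divides q (x - b s) only if it divides x
  - b s.\<close>

lemma codim_gen2_mult:
  assumes "cofinF (gen2 p (q * s))"
  shows "codim (gen2 p (q * s)) = codim (gen2 p q) + codim (gen2 p s)"
proof -
  have q: "cofinF (gen2 p q)" and s: "cofinF (gen2 p s)"
    using assms by (rule cofinF_mono, intro gen2_mono_dvd, simp)+
  note fc = cofinF_fincod[OF assms isidl_gen2] cofinF_fincod[OF q isidl_gen2] cofinF_fincod[OF s isidl_gen2]
  have im: "im_sum ((*) q) UNIV (gen2 p (q * s)) = gen2 p q"
  proof (intro equalityI subsetI)
    fix x assume "x \<in> im_sum ((*) q) UNIV (gen2 p (q * s))"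
    then obtain u a b where "x = q * u + (a * p + b * (q * s))" unfolding im_sum_def gen2_def by blast
    hence "x = a * p + (u + b * s) * q" by (simp add: algebra_simps)
    thus "x \<in> gen2 p q" using gen2I by metis
  next
    fix x assume "x \<in> gen2 p q"
    then obtain a b where "x = a * p + b * q" by (rule gen2E)
    hence "x = q * b + (a * p + 0 * (q * s))" by (simp add: algebra_simps)
    thus "x \<in> im_sum ((*) q) UNIV (gen2 p (q * s))" unfolding im_sum_def using gen2I by blast
  qed
  have iff: "q * x \<in> gen2 p (q * s) \<longleftrightarrow> x \<in> gen2 p s" for x
  proof
    assume "q * x \<in> gen2 p (q * s)"
    then obtain a b where "q * x = a * p + b * (q * s)" by (rule gen2E)
    hence "q * (x - b * s) = p * a" by (simp add: algebra_simps)
    hence "p dvd x - b * s" using cofinF_dvd_cancel[OF q] by (metis dvd_triv_left)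
    then obtain c where "x - b * s = p * c" by (rule dvdE)
    hence "x = c * p + b * s" by (simp add: algebra_simps)
    thus "x \<in> gen2 p s" using gen2I by metis
  next
    assume "x \<in> gen2 p s"
    then obtain a b where "x = a * p + b * s" by (rule gen2E)
    hence "q * x = (q * a) * p + b * (q * s)" by (simp add: algebra_simps)
    thus "q * x \<in> gen2 p (q * s)" using gen2I by metis
  qed
  show ?thesis
    using codim_image_eq(2)[OF clin_mult fc(3) csub_gen2 iff] fc(2) unfolding im by simp
qed

lemma codim_X_power_multiples:
  "fincod {c :: complex fps. \<forall>n<d. c $ n = 0}" "codim {c :: complex fps. \<forall>n<d. c $ n = 0} = d"
proof -
  define V where "V = (\<lambda>d. {c :: complex fps. \<forall>n<d. c $ n = 0})"
  have cs: "csub (V d)" for d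
    unfolding V_def csub_def by (auto simp: sc_fps_def)
  have r: "reldim (V d) d UNIV"
  proof (induction d)
    case 0
    have "V 0 = UNIV" by (simp add: V_def)
    thus ?case using reldim_0[of UNIV] by simp
  next
    case (Suc d)
    have nX: "fps_X ^ d \<notin> V (Suc d)" by (auto simp: V_def fps_X_power_nth)
    have "line_ext (V (Suc d)) (fps_X ^ d) = V d"
    proof (intro equalityI subsetI)
      fix x assume "x \<in> line_ext (V (Suc d)) (fps_X ^ d)"
      thus "x \<in> V d" by (auto simp: line_ext_def V_def sc_fps_def sc_complex_def fps_X_power_nth)
    next
      fix x assume x: "x \<in> V d"
      have "x = (x - sc (x $ d) * fps_X ^ d) + sc (x $ d) * fps_X ^ d" by simp
      moreover have "x - sc (x $ d) * fps_X ^ d \<in> V (Suc d)"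
        using x by (auto simp: V_def sc_fps_def sc_complex_def fps_X_power_nth less_Suc_eq)
      ultimately show "x \<in> line_ext (V (Suc d)) (fps_X ^ d)" using line_extI by metis
    qed
    hence "reldim (V (Suc d)) 1 (V d)" using reldim_Suc[OF reldim_0 nX] by simp
    from reldim_trans[OF Suc this] show ?case by simp
  qed
  show "fincod {c :: complex fps. \<forall>n<d. c $ n = 0}" "codim {c :: complex fps. \<forall>n<d. c $ n = 0} = d"
    using fincodI[OF cs r] codim_eqI[OF cs r] unfolding V_def by auto
qed

text \<open>The quotient by \<open>w\<close> is a power series ring in one variable, with projection \<open>\<rho>\<close> and section \<open>\<sigma>\<close>.\<close>

lemma codim_gen2_section:
  fixes \<rho> :: "complex fps fps \<Rightarrow> complex fps" and \<sigma> :: "complex fps \<Rightarrow> complex fps fps"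
  assumes \<rho>: "\<And>F G. \<rho> (F + G) = \<rho> F + \<rho> G" "\<And>F G. \<rho> (F * G) = \<rho> F * \<rho> G" "\<rho> w = 0"
    and ker: "\<And>F. \<rho> F = 0 \<Longrightarrow> w dvd F" and \<sigma>: "clin \<sigma>" "\<And>c. \<rho> (\<sigma> c) = c" and nz: "\<rho> h \<noteq> 0"
  shows "codim (gen2 w h) = subdegree (\<rho> h)"
proof -
  define V where "V = {c :: complex fps. \<forall>n<subdegree (\<rho> h). c $ n = 0}"
  have V: "c \<in> V \<longleftrightarrow> \<rho> h dvd c" for c
    using nz fps_X_power_dvd_iff[of "subdegree (\<rho> h)" c]
    by (auto simp: V_def fps_dvd_iff fps_X_power_subdegree)
  have diff: "\<rho> (F - G) = \<rho> F - \<rho> G" for F G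
    using \<rho>(1)[of "F - G" G] by (simp add: algebra_simps)
  have mem: "F \<in> gen2 w h" if F: "\<rho> F = 0" for F
    using ker[OF F] isidlD(4)[OF isidl_gen2 gen2_mem(1)] by (metis dvdE)
  have iff: "\<sigma> x \<in> gen2 w h \<longleftrightarrow> x \<in> V" for x
  proof
    assume "\<sigma> x \<in> gen2 w h"
    then obtain a b where "\<sigma> x = a * w + b * h" by (rule gen2E)
    from arg_cong[OF this, of \<rho>] show "x \<in> V" unfolding V by (simp add: \<rho> \<sigma>)
  next
    assume "x \<in> V"
    then obtain b where b: "x = \<rho> h * b" unfolding V by (rule dvdE)
    have "\<sigma> x - h * \<sigma> b \<in> gen2 w h" by (rule mem) (simp add: diff \<rho> \<sigma> b)
    hence "(\<sigma> x - h * \<sigma> b) + h * \<sigma> b \<in> gen2 w h"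
      by (rule isidlD(2)[OF isidl_gen2]) (rule isidlD(4)[OF isidl_gen2 gen2_mem(2)])
    thus "\<sigma> x \<in> gen2 w h" by simp
  qed
  have im: "im_sum \<sigma> UNIV (gen2 w h) = UNIV"
  proof -
    have "F \<in> im_sum \<sigma> UNIV (gen2 w h)" for F
    proof -
      have "F - \<sigma> (\<rho> F) \<in> gen2 w h" by (rule mem) (simp add: diff \<sigma>)
      moreover have "F = \<sigma> (\<rho> F) + (F - \<sigma> (\<rho> F))" by simp
      ultimately show ?thesis unfolding im_sum_def by blast
    qed
    thus ?thesis by blast
  qed
  have fV: "fincod V" "codim V = subdegree (\<rho> h)" unfolding V_def by (rule codim_X_power_multiples)+
  show ?thesis
    using codim_image_eq(2)[OF \<sigma>(1) fV(1) csub_gen2 iff] fV(2) by (simp add: im)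
qed

lemma codim_gen2_linear_factor:
  fixes y :: "complex fps"
  assumes y: "y $ 0 = 0" and nz: "ev y h \<noteq> 0"
  shows "codim (gen2 (fY - emb y) h) = subdegree (ev y h)"
proof (rule codim_gen2_section[where \<sigma> = emb])
  show "clin (emb :: complex fps \<Rightarrow> _)"
    by (auto simp: clin_def fps_eq_iff sc_fps_def sc_complex_def simp flip: fps_const_mult)
  fix F assume "ev y F = 0"
  moreover have "emb 0 = (0 :: complex fps fps)" by (simp add: fps_eq_iff)
  moreover obtain A where "F = (fY - emb y) * A + emb (ev y F)" using ev_remainder[OF y] by blast
  ultimately show "fY - emb y dvd F" by (metis add.right_neutral dvd_triv_left)
qed (simp_all add: ev_add ev_mult[OF y] ev_emb ev_linear_factor[OF y] nz)

lemma codim_gen2_X: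
  fixes h :: "complex fps fps"
  assumes "h $ 0 \<noteq> 0"
  shows "codim (gen2 fps_X h) = subdegree (h $ 0)"
proof (rule codim_gen2_section[where \<sigma> = fps_const and \<rho> = "\<lambda>F. F $ 0"])
  show "fps_X dvd F" if "F $ 0 = 0" for F :: "complex fps fps"
    using fps_X_power_dvd_iff[of 1 F] that by simp
qed (simp_all add: clin_def sc_fps_def assms)

text \<open>The series in X and Y are free over the series in X^N and Y with basis 1, X, ...,
  X^(N-1); component i collects the X-exponents congruent to i modulo N. An ideal generated by
  series in X^N and Y can be tested componentwise.\<close>

lemma mem_gen2_ramify_iff:
  assumes "N > 0"
  shows "x \<in> gen2 (ramify N a) (ramify N b) \<longleftrightarrow>
    (\<forall>i<N. Abs_fps (\<lambda>k. x $ (N * k + i)) \<in> gen2 a (b :: complex fps fps))"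
proof -
  define cmp where "cmp = (\<lambda>i (x :: complex fps fps). Abs_fps (\<lambda>k. x $ (N * k + i)))"
  have cmp_mult: "cmp i (ramify N a * G) = a * cmp i G" if "i < N" for i a G
  proof (rule fps_ext)
    fix k
    have "cmp i (ramify N a * G) $ k = (\<Sum>j\<in>{0..N * k + i}. if N dvd j then a $ (j div N) * G $ (N * k + i - j) else 0)"
      unfolding cmp_def fps_mult_nth fps_nth_Abs_fps using assms by (intro sum.cong refl) (simp add: ramify_nth)
    also have "\<dots> = (\<Sum>j\<in>{j\<in>{0..N * k + i}. N dvd j}. a $ (j div N) * G $ (N * k + i - j))"
      by (rule sum.inter_filter[symmetric]) simp
    also have "\<dots> = (\<Sum>l\<in>{0..k}. a $ l * G $ (N * k + i - N * l))"
    proof (rule sum.reindex_bij_witness[of _ "\<lambda>l. N * l" "\<lambda>j. j div N"])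
      fix j assume j: "j \<in> {j \<in> {0..N * k + i}. N dvd j}"
      have "j div N \<le> (N * k + i) div N" using j by (intro div_le_mono) auto
      also have "(N * k + i) div N = k" using \<open>i < N\<close> by simp
      finally show "j div N \<in> {0..k}" by simp
    qed (use assms in \<open>auto intro: le_add1 trans_le_add1\<close>)
    also have "\<dots> = (\<Sum>l\<in>{0..k}. a $ l * G $ (N * (k - l) + i))"
      by (intro sum.cong) (auto simp: diff_mult_distrib2)
    also have "\<dots> = (a * cmp i G) $ k" by (simp add: cmp_def fps_mult_nth)
    finally show "cmp i (ramify N a * G) $ k = (a * cmp i G) $ k" .
  qed
  have decomp: "x = (\<Sum>i<N. fps_X ^ i * ramify N (cmp i x))" for x
  proof (rule fps_ext)
    fix n
    have "(\<Sum>i<N. fps_X ^ i * ramify N (cmp i x)) $ n = (\<Sum>i<N. if i = n mod N then x $ n else 0)"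
      unfolding fps_sum_nth
    proof (intro sum.cong refl)
      fix i assume "i \<in> {..<N}"
      have "N dvd n - i \<and> i \<le> n \<longleftrightarrow> i = n mod N"
      proof
        assume *: "N dvd n - i \<and> i \<le> n"
        then obtain c where "n - i = N * c" by blast
        hence "n = N * c + i" using * by simp
        thus "i = n mod N" using \<open>i \<in> {..<N}\<close> by simp
      qed (auto simp: minus_mod_eq_mult_div)
      thus "(fps_X ^ i * ramify N (cmp i x)) $ n = (if i = n mod N then x $ n else 0)"
        using assms by (auto simp: fps_X_power_mult_nth ramify_nth cmp_def not_le)
    qed
    thus "x $ n = (\<Sum>i<N. fps_X ^ i * ramify N (cmp i x)) $ n" using assms by simp
  qed
  have cmp_add: "cmp i (x + y) = cmp i x + cmp i y" for i x y by (simp add: cmp_def fps_eq_iff)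
  have "x \<in> gen2 (ramify N a) (ramify N b) \<longleftrightarrow> (\<forall>i<N. cmp i x \<in> gen2 a b)"
  proof
    assume "x \<in> gen2 (ramify N a) (ramify N b)"
    then obtain u v where "x = u * ramify N a + v * ramify N b" by (rule gen2E)
    hence x: "x = ramify N a * u + ramify N b * v" by (simp add: mult.commute)
    have "cmp i x = cmp i u * a + cmp i v * b" if "i < N" for i
      unfolding x cmp_add cmp_mult[OF that] by (simp only: mult.commute)
    thus "\<forall>i<N. cmp i x \<in> gen2 a b" using gen2I by metis
  next
    assume *: "\<forall>i<N. cmp i x \<in> gen2 a b"
    have "fps_X ^ i * ramify N (cmp i x) \<in> gen2 (ramify N a) (ramify N b)" if "i < N" for i
    proof -
      obtain u v where "cmp i x = u * a + v * b" using * \<open>i < N\<close> by (metis gen2E)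
      hence "fps_X ^ i * ramify N (cmp i x)
          = (fps_X ^ i * ramify N u) * ramify N a + (fps_X ^ i * ramify N v) * ramify N b"
        using assms by (simp add: fps_compose_add_distrib ramify_mult algebra_simps)
      thus ?thesis using gen2I by metis
    qed
    hence "(\<Sum>i<N. fps_X ^ i * ramify N (cmp i x)) \<in> gen2 (ramify N a) (ramify N b)"
      by (intro isidl_sum isidl_gen2) auto
    thus "x \<in> gen2 (ramify N a) (ramify N b)" using decomp[of x] by simp
  qed
  thus ?thesis unfolding cmp_def .
qed

lemma cofinF_ramify:
  assumes "N > 0" "cofinF (gen2 a b)"
  shows "cofinF (gen2 (ramify N a) (ramify N b))"
proof -
  have *: "ramify N x \<in> gen2 (ramify N a) (ramify N b)" if x: "x \<in> gen2 a b" for x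
  proof -
    obtain u v where "x = u * a + v * b" using x by (rule gen2E)
    hence "ramify N x = ramify N u * ramify N a + ramify N v * ramify N b"
      using assms by (simp add: fps_compose_add_distrib ramify_mult)
    thus ?thesis using gen2I by metis
  qed
  obtain k l where "fps_X ^ k \<in> gen2 a b" "fY ^ l \<in> gen2 a b" using assms(2) unfolding cofinF_def by blast
  from *[OF this(1)] *[OF this(2)] assms(1) show ?thesis
    unfolding cofinF_def by (auto simp: ramify_power ramify_X simp flip: power_mult)
qed

text \<open>W m constrains only the components from m on, so W N is the whole ring and W 0 the
  ramified ideal. Going from m + 1 down to m constrains one more component and costs the codimension
  of I.\<close>

lemma codim_ramify:
  assumes "N > 0" "cofinF (gen2 a b)"
  shows "codim (gen2 (ramify N a) (ramify N b)) = N * codim (gen2 a b)"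
proof -
  define I where "I = gen2 a b"
  define cmp where "cmp = (\<lambda>i (x :: complex fps fps). Abs_fps (\<lambda>k. x $ (N * k + i)))"
  define W where "W = (\<lambda>m. {x. \<forall>i<N. m \<le> i \<longrightarrow> cmp i x \<in> I})"
  have I: "csub I" "fincod I" "isidl I" unfolding I_def using assms by (auto intro: cofinF_fincod isidl_gen2 csub_gen2)
  have lin: "cmp i (x + y) = cmp i x + cmp i y" "cmp i (sc c * x) = sc c * cmp i x" for i x y c
    by (simp_all add: cmp_def fps_eq_iff sc_fps_def sc_complex_def)
  have c0: "cmp i 0 = 0" for i by (simp add: cmp_def fps_eq_iff)
  have cW: "csub (W m)" for m
    unfolding W_def by (intro csubI) (auto simp: lin c0 intro: csubD[OF I(1)])
  have cL: "cmp i (fps_X ^ m * ramify N G) = (if i = m then G else 0)" if "i < N" "m < N" for i m G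
  proof (rule fps_ext)
    fix k
    have "m \<le> N * k + i \<and> N dvd N * k + i - m \<longleftrightarrow> i = m"
    proof
      assume *: "m \<le> N * k + i \<and> N dvd N * k + i - m"
      then obtain c where "N * k + i - m = N * c" by blast
      hence "N * k + i = N * c + m" using * by simp
      hence "(N * k + i) mod N = (N * c + m) mod N" by simp
      thus "i = m" using that by simp
    qed auto
    thus "cmp i (fps_X ^ m * ramify N G) $ k = (if i = m then G else 0) $ k"
      using assms(1) by (auto simp: cmp_def fps_X_power_mult_nth ramify_nth not_le)
  qed
  have step: "fincod (W m) \<and> codim (W m) = codim (W (Suc m)) + codim I" if fW: "m < N" "fincod (W (Suc m))" for m
  proof -
    define L where "L = (\<lambda>G :: complex fps fps. fps_X ^ m * ramify N G)"
    have lL: "clin L"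
    proof -
      have "ramify N (sc c * x) = sc c * ramify N x" for c and x :: "complex fps fps"
        using assms(1) by (simp add: ramify_mult sc_fps_def sc_complex_def)
      thus ?thesis by (auto simp: clin_def L_def fps_compose_add_distrib algebra_simps)
    qed
    have iff: "L x \<in> W m \<longleftrightarrow> x \<in> I" for x
      unfolding W_def L_def using fW(1) cL csubD(1)[OF I(1)] by auto
    have im: "im_sum L UNIV (W m) = W (Suc m)"
    proof (intro equalityI subsetI)
      fix x assume "x \<in> im_sum L UNIV (W m)"
      then obtain u v where "v \<in> W m" "x = L u + v" unfolding im_sum_def by blast
      thus "x \<in> W (Suc m)"
        unfolding W_def L_def using fW(1) cL by (auto simp: lin)
    next
      fix x assume x: "x \<in> W (Suc m)"
      define v where "v = x - L (cmp m x)"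
      have "cmp i v = cmp i x - cmp i (L (cmp m x))" for i by (simp add: v_def cmp_def fps_eq_iff)
      hence "v \<in> W m" using x fW(1) cL csubD(1)[OF I(1)]
        unfolding W_def L_def by (auto simp: Suc_le_eq le_less)
      moreover have "x = L (cmp m x) + v" by (simp add: v_def)
      ultimately show "x \<in> im_sum L UNIV (W m)" unfolding im_sum_def by blast
    qed
    show ?thesis
      using codim_image_eq[OF lL I(2) cW iff] fW(2) unfolding im by simp
  qed
  have "fincod (W (N - d)) \<and> codim (W (N - d)) = d * codim I" if "d \<le> N" for d
    using that
  proof (induction d)
    case 0
    have "W N = UNIV" by (auto simp: W_def)
    thus ?case by simp
  next
    case (Suc d)
    have "Suc (N - Suc d) = N - d" using Suc.prems by simp
    thus ?case using step[of "N - Suc d"] Suc by simp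
  qed
  from this[of N] have "codim (W 0) = N * codim I" by simp
  moreover have "W 0 = gen2 (ramify N a) (ramify N b)"
    unfolding W_def I_def cmp_def using mem_gen2_ramify_iff[OF assms(1), of _ a b] by auto
  ultimately show ?thesis unfolding I_def by simp
qed

lemma formal_unit:
  fixes U :: "complex fps fps"
  assumes "U $ 0 $ 0 \<noteq> 0"
  shows "U dvd 1"
proof -
  have "U $ 0 \<noteq> 0" "subdegree (U $ 0) = 0" using assms by auto
  then obtain A R where "1 = U * A + R" "\<And>i j. R $ i $ j = 0"
    using formal_weierstrass_division[of U 1] by auto
  moreover have "R = 0" using calculation(2) by (simp add: fps_eq_iff)
  ultimately show ?thesis by (metis add.right_neutral dvd_triv_left)
qed

text \<open>\<open>F(t\<^sup>N, y(t))\<close>.\<close>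

definition param :: "nat \<Rightarrow> complex fps \<Rightarrow> complex fps fps \<Rightarrow> complex fps" where
  "param N y F = ev y (ramify N F)"

lemma
  assumes "N > 0" "y $ 0 = 0"
  shows param_mult: "param N y (F * G) = param N y F * param N y G"
    and param_power: "param N y (F ^ k) = param N y F ^ k"
    and param_X: "param N y fps_X = fps_X ^ N"
    and param_Y: "param N y fY = y"
  using assms by (simp_all add: param_def ramify_mult ev_mult ramify_power ev_power ramify_X ev_X ev_Y)

lemma param_add: "param N y (F + G) = param N y F + param N y G"
  by (simp add: param_def fps_compose_add_distrib ev_add)

lemma param_diff: "param N y (F - G) = param N y F - param N y G"
  by (simp add: param_def fps_compose_sub_distrib ev_diff)

lemma param_nth_0: "param N y F $ 0 = F $ 0 $ 0"
  by (simp add: param_def ev_def)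

lemma param_chain_rule:
  assumes N: "N > 0" and y: "y $ 0 = 0"
  shows "fps_deriv (param N y F) = param N y (fps_deriv F) * fps_deriv (fps_X ^ N)
    + param N y (fdY F) * fps_deriv y"
proof -
  have "fdY (fps_X ^ N :: complex fps fps) = 0"
    by (simp add: fps_eq_iff fdY_def fps_X_power_nth)
  hence D: "ev y (fps_deriv (fps_X ^ N)) = fps_deriv (fps_X ^ N)"
    using ev_chain_rule[OF y, of "fps_X ^ N"] by (simp add: ev_power[OF y] ev_X)
  have 1: "fps_deriv (ramify N F) = ramify N (fps_deriv F) * fps_deriv (fps_X ^ N)"
    using N by (intro fps_compose_deriv) simp
  have 2: "fdY (ramify N F) = ramify N (fdY F)"
    using N by (simp add: fps_eq_iff fdY_def ramify_nth)
  show ?thesis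
    unfolding param_def ev_chain_rule[OF y] 1 2 by (simp only: ev_mult[OF y] D)
qed

text \<open>Dividing Y^n by Q, with n the order of Q(0, Y), gives Q A = Y^n - R with A a unit. The
  right side is the Weierstrass polynomial of Q, and its Puiseux root is a root of Q.\<close>

lemma series_root:
  assumes "Q $ 0 \<noteq> 0" "subdegree (Q $ 0) > 0"
  obtains N y where "N > 0" "y $ 0 = 0" "param N y Q = 0"
proof -
  define n where "n = subdegree (Q $ 0)"
  obtain A R where AR: "fY ^ n = Q * A + R" "\<And>i j. n \<le> j \<Longrightarrow> R $ i $ j = 0"
    using formal_weierstrass_division[OF assms(1)] unfolding n_def by blast
  have R0: "fps_X ^ n = Q $ 0 * A $ 0 + R $ 0"
    using arg_cong[OF AR(1), of "\<lambda>F. F $ 0"] by (simp add: fps_const_power)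
  \<comment> \<open>On X = 0 both Y^n and Q A have no terms of degree below n, while R has only such
    terms.\<close>
  have R00: "R $ 0 $ j = 0" for j
  proof (cases "j < n")
    case True
    have "(Q $ 0 * A $ 0) $ j = 0"
      unfolding fps_mult_nth using True by (intro sum.neutral ballI) (auto simp: n_def intro!: disjI1 nth_less_subdegree_zero)
    thus ?thesis using arg_cong[OF R0, of "\<lambda>f. f $ j"] True by (simp add: fps_X_power_nth)
  qed (use AR(2) in auto)
  have "R $ 0 = 0" using R00 by (simp add: fps_eq_iff)
  have "A $ 0 $ 0 \<noteq> 0"
  proof
    assume "A $ 0 $ 0 = 0"
    have "(Q $ 0 * A $ 0) $ n = (\<Sum>i=0..n. Q $ 0 $ i * A $ 0 $ (n - i))" by (rule fps_mult_nth)
    also have "\<dots> = (\<Sum>i\<in>{0..n}. 0)"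
    proof (intro sum.cong refl)
      fix i assume "i \<in> {0..n}"
      thus "Q $ 0 $ i * A $ 0 $ (n - i) = 0"
        using \<open>A $ 0 $ 0 = 0\<close> by (cases "i = n") (auto simp: n_def intro!: nth_less_subdegree_zero)
    qed
    finally show False using arg_cong[OF R0, of "\<lambda>f. f $ n"] R00 by (simp add: fps_X_power_nth)
  qed
  define r where "r = (\<lambda>j. Abs_fps (\<lambda>i. R $ i $ j))"
  define P where "P = monom 1 n - (\<Sum>j<n. monom (r j) j)"
  have cP: "coeff P j = (if j = n then 1 else if j < n then - r j else 0)" for j
    by (auto simp: P_def coeff_sum)
  have "\<exists>N y. N > 0 \<and> y $ 0 = 0 \<and> psub N P y = 0"
    using assms(2) R00 by (intro puiseux_root[of n]) (auto simp: cP n_def r_def)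
  then obtain N y where Ny: "N > 0" "y $ 0 = 0" "psub N P y = 0" by blast
  have pe: "param N y (emb c) = ramify N c" for c
  proof -
    have "ramify N (emb c) = emb (ramify N c)" using Ny(1) by (simp add: fps_eq_iff ramify_nth)
    thus ?thesis by (simp add: param_def ev_emb)
  qed
  have pY: "param N y (fps_const (fps_X ^ k)) = y ^ k" for k
    using param_power[OF Ny(1,2), of fY k] param_Y[OF Ny(1,2)] by simp
  have psum: "param N y (sum F B) = (\<Sum>j\<in>B. param N y (F j))" for F and B :: "nat set"
    unfolding param_def by (simp add: fps_compose_sum_distrib ev_sum)
  have "R = (\<Sum>j<n. emb (r j) * fY ^ j)"
  proof (intro fps_ext)
    fix i k
    have "(\<Sum>j<n. emb (r j) * fY ^ j) $ i $ k = (\<Sum>j<n. if j = k then R $ i $ k else 0)"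
      unfolding fps_sum_nth by (intro sum.cong refl) (simp add: fps_const_power r_def fps_X_power_nth)
    thus "R $ i $ k = (\<Sum>j<n. emb (r j) * fY ^ j) $ i $ k" using AR(2)[of k i] by auto
  qed
  hence "param N y R = (\<Sum>j<n. ramify N (r j) * y ^ j)"
    using Ny by (simp add: psum param_mult pY pe)
  moreover have "psub N P y = y ^ n - (\<Sum>j<n. ramify N (r j) * y ^ j)"
  proof -
    have "psub N (P + (\<Sum>j<n. monom (r j) j)) y = psub N (monom 1 n) y" by (simp add: P_def)
    thus ?thesis by (simp add: psub_add psub_sum psub_monom algebra_simps)
  qed
  moreover have "param N y (fY ^ n) = y ^ n" by (simp add: pY)
  ultimately have "param N y (Q * A) = 0" using Ny(3) AR(1) by (simp add: param_add)
  hence "param N y Q * param N y A = 0" using Ny by (simp add: param_mult)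
  moreover have "param N y A $ 0 \<noteq> 0" using \<open>A $ 0 $ 0 \<noteq> 0\<close> by (simp add: param_nth_0)
  ultimately show ?thesis using that Ny by auto
qed

text \<open>Each root splits off a factor Y - y and lowers the order of Q(0, Y) by one. The
  remaining factor may need a further ramification M, which is then applied to y as well.\<close>

lemma puiseux_splitting:
  assumes "Q $ 0 \<noteq> 0"
  shows "\<exists>N ys U. N > 0 \<and> length ys = subdegree (Q $ 0) \<and> (\<forall>y\<in>set ys. y $ 0 = 0) \<and> U $ 0 $ 0 \<noteq> 0 \<and>
    ramify N Q = U * prod_list (map (\<lambda>y. fY - emb y) ys)"
  using assms
proof (induction "subdegree (Q $ 0)" arbitrary: Q)
  case 0
  hence "Q $ 0 $ 0 \<noteq> 0" by (metis nth_subdegree_zero_iff)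
  thus ?case using 0 by (intro exI[of _ 1] exI[of _ "[]"] exI[of _ Q]) auto
next
  case (Suc n)
  obtain N y where Ny: "N > 0" "y $ 0 = 0" "param N y Q = 0"
    using series_root[OF Suc.prems] Suc.hyps(2) by (metis zero_less_Suc)
  have "emb 0 = (0 :: complex fps fps)" by (simp add: fps_eq_iff)
  then obtain Q' where Q': "ramify N Q = (fY - emb y) * Q'"
    using ev_remainder[OF Ny(2), of "ramify N Q"] Ny(3) unfolding param_def by (metis add.right_neutral)
  have Q0: "Q $ 0 = fps_X * Q' $ 0" using arg_cong[OF Q', of "\<lambda>F. F $ 0"] Ny by simp
  hence "Q' $ 0 \<noteq> 0" using Suc.prems by auto
  moreover have "n = subdegree (Q' $ 0)" using Q0 Suc.hyps(2) \<open>Q' $ 0 \<noteq> 0\<close> by simp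
  ultimately obtain M ys U where IH: "M > 0" "length ys = n" "\<forall>y\<in>set ys. y $ 0 = 0" "U $ 0 $ 0 \<noteq> 0"
      "ramify M Q' = U * prod_list (map (\<lambda>y. fY - emb y) ys)"
    using Suc.hyps(1)[of Q'] by blast
  have "ramify M (emb y) = emb (ramify M y)" using IH(1) by (simp add: fps_eq_iff ramify_nth)
  hence "ramify (N * M) Q = U * prod_list (map (\<lambda>y. fY - emb y) (ramify M y # ys))"
    unfolding ramify_ramify[OF Ny(1) IH(1), symmetric] Q' ramify_mult[OF IH(1)] IH(5)
    by (simp add: fps_compose_sub_distrib mult_ac)
  thus ?case using Ny IH Suc.hyps(2)
    by (intro exI[of _ "N * M"] exI[of _ "ramify M y # ys"] exI[of _ U]) auto
qed

text \<open>One choice of N and of the roots serves all h, so that intersection numbers with the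
  same Q can be compared root by root.\<close>

lemma intersection_formula:
  assumes "Q $ 0 \<noteq> 0"
  obtains N ys where "N > 0" "length ys = subdegree (Q $ 0)"
    "\<And>y. y \<in> set ys \<Longrightarrow> y $ 0 = 0" "\<And>y. y \<in> set ys \<Longrightarrow> param N y Q = 0"
    "\<And>h y. cofinF (gen2 Q h) \<Longrightarrow> y \<in> set ys \<Longrightarrow> param N y h \<noteq> 0"
    "\<And>h. cofinF (gen2 Q h) \<Longrightarrow> N * codim (gen2 Q h) = (\<Sum>y\<leftarrow>ys. subdegree (param N y h))"
proof -
  obtain N ys U where *: "N > 0" "length ys = subdegree (Q $ 0)" "\<forall>y\<in>set ys. y $ 0 = 0" "U $ 0 $ 0 \<noteq> 0"
    "ramify N Q = U * prod_list (map (\<lambda>y. fY - emb y) ys)"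
    using puiseux_splitting[OF assms] by blast
  have z: "param N y Q = 0" if "y \<in> set ys" for y
  proof -
    have "fY - emb y dvd ramify N Q"
      using that unfolding *(5) by (intro dvd_mult prod_list_dvd) auto
    then obtain A where "ramify N Q = (fY - emb y) * A" by (rule dvdE)
    thus ?thesis using that * unfolding param_def by (simp add: ev_mult ev_linear_factor)
  qed
  \<comment> \<open>Otherwise a power X^k in the ideal would vanish along the root, but its value is
    t^(N k).\<close>
  have nz: "param N y h \<noteq> 0" if h: "cofinF (gen2 Q h)" and y: "y \<in> set ys" for h y
  proof
    assume 0: "param N y h = 0"
    obtain k where "fps_X ^ k \<in> gen2 Q h" using h unfolding cofinF_def by blast
    then obtain a b where "fps_X ^ k = a * Q + b * h" by (rule gen2E)
    hence "param N y (fps_X ^ k) = 0"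
      using * y 0 z[OF y] by (simp add: param_add param_mult)
    thus False using * y by (simp add: param_power param_X)
  qed
  have sum: "N * codim (gen2 Q h) = (\<Sum>y\<leftarrow>ys. subdegree (param N y h))" if h: "cofinF (gen2 Q h)" for h
  proof -
    define H where "H = ramify N h"
    have cH: "cofinF (gen2 H (ramify N Q))"
      using cofinF_ramify[OF *(1) h] unfolding H_def by (simp add: gen2_commute)
    have "codim (gen2 H U) = 0"
    proof -
      obtain u where "U * u = 1" using formal_unit[OF *(4)] by (metis dvdE)
      hence "1 = 0 * H + u * U" by (simp add: mult.commute)
      hence "1 \<in> gen2 H U" using gen2I by metis
      hence "gen2 H U = UNIV" using isidl_UNIV_iff[OF isidl_gen2] by blast
      thus ?thesis by simp
    qed
    moreover have "codim (gen2 H (prod_list (map (\<lambda>y. fY - emb y) zs))) = (\<Sum>y\<leftarrow>zs. subdegree (param N y h))"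
      if "cofinF (gen2 H (prod_list (map (\<lambda>y. fY - emb y) zs)))" "set zs \<subseteq> set ys" for zs
      using that
    proof (induction zs)
      case Nil
      show ?case by (simp add: gen2_1)
    next
      case (Cons z zs)
      let ?w = "fY - emb z"
      have z: "z $ 0 = 0" "param N z h \<noteq> 0" using * nz[OF h] Cons.prems by auto
      have "codim (gen2 ?w H) = subdegree (param N z h)"
        using codim_gen2_linear_factor[OF z(1), of H] z(2) unfolding param_def H_def by blast
      moreover have "cofinF (gen2 H (prod_list (map (\<lambda>y. fY - emb y) zs)))"
        using Cons.prems(1) by (rule cofinF_mono) (intro gen2_mono_dvd, simp)
      ultimately show ?case
        using codim_gen2_mult[of H ?w "prod_list (map (\<lambda>y. fY - emb y) zs)"] Cons
        by (simp add: gen2_commute[of H ?w])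
    qed
    moreover have "cofinF (gen2 H (prod_list (map (\<lambda>y. fY - emb y) ys)))"
      using cH by (rule cofinF_mono) (intro gen2_mono_dvd, simp add: *(5))
    ultimately have "codim (gen2 H (ramify N Q)) = (\<Sum>y\<leftarrow>ys. subdegree (param N y h))"
      using codim_gen2_mult[of H U] cH unfolding *(5) by simp
    thus ?thesis using codim_ramify[OF *(1) h] unfolding H_def by (simp add: gen2_commute)
  qed
  show ?thesis using that[OF *(1,2)] * z nz sum by blast
qed

section \<open>Polar curves\<close>

lemma subdegree_deriv:
  fixes f :: "complex fps"
  assumes "f \<noteq> 0" "f $ 0 = 0"
  shows "fps_deriv f \<noteq> 0" "subdegree f = Suc (subdegree (fps_deriv f))"
proof -
  obtain m where m: "subdegree f = Suc m"
    using assms by (metis not0_implies_Suc nth_subdegree_nonzero)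
  have nz: "fps_deriv f $ m \<noteq> 0" using m assms nth_subdegree_nonzero[of f] by (simp del: of_nat_Suc)
  thus "fps_deriv f \<noteq> 0" by (metis fps_zero_nth)
  have "subdegree (fps_deriv f) = m"
    using nz m by (intro subdegreeI) (auto intro!: nth_less_subdegree_zero)
  thus "subdegree f = Suc (subdegree (fps_deriv f))" using m by simp
qed

lemma subdegree_deriv_X_power: "N > 0 \<Longrightarrow> subdegree (fps_deriv (fps_X ^ N :: complex fps)) = N - 1"
  using subdegree_deriv(2)[of "fps_X ^ N"] by (simp add: fps_X_power_subdegree)

text \<open>The number of roots is the order of Q(0, Y), and each contributes c N to N times the
  intersection number.\<close>

lemma codim_compare:
  assumes Q: "Q $ 0 \<noteq> 0" and fin: "cofinF (gen2 Q g)" "cofinF (gen2 Q h)"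
    and each: "\<And>N y. N > 0 \<Longrightarrow> y $ 0 = 0 \<Longrightarrow> param N y Q = 0 \<Longrightarrow> param N y g \<noteq> 0 \<Longrightarrow> param N y h \<noteq> 0 \<Longrightarrow>
      subdegree (param N y g) = subdegree (param N y h) + c * N"
  shows "codim (gen2 Q g) = codim (gen2 Q h) + c * subdegree (Q $ 0)"
proof -
  obtain N ys where *: "N > 0" "length ys = subdegree (Q $ 0)"
    "\<And>y. y \<in> set ys \<Longrightarrow> y $ 0 = 0" "\<And>y. y \<in> set ys \<Longrightarrow> param N y Q = 0"
    "\<And>h y. cofinF (gen2 Q h) \<Longrightarrow> y \<in> set ys \<Longrightarrow> param N y h \<noteq> 0"
    "\<And>h. cofinF (gen2 Q h) \<Longrightarrow> N * codim (gen2 Q h) = (\<Sum>y\<leftarrow>ys. subdegree (param N y h))"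
    by (rule intersection_formula[OF Q]) blast
  have "N * codim (gen2 Q g) = (\<Sum>y\<leftarrow>ys. subdegree (param N y h) + c * N)"
    unfolding *(6)[OF fin(1)]
    by (intro arg_cong[of _ _ sum_list] map_cong refl each *(1,3,4,5) fin)
  also have "\<dots> = N * codim (gen2 Q h) + length ys * (c * N)"
    unfolding *(6)[OF fin(2)] by (simp add: sum_list_addf sum_list_triv)
  finally have "N * codim (gen2 Q g) = N * (codim (gen2 Q h) + c * length ys)"
    by (simp add: algebra_simps)
  thus ?thesis using *(1,2) by simp
qed

text \<open>
  Along a branch of the polar curve \<open>f\<^sub>Y = 0\<close> parametrized by \<open>t\<close> one has \<open>df/dt = f\<^sub>X dX/dt\<close>, so the
  orders of \<open>f\<close> and of \<open>f\<^sub>X\<close> differ by the order of \<open>X\<close>.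
\<close>

lemma teissier:
  assumes f: "f $ 0 \<noteq> 0" "f $ 0 $ 0 = 0"
    and fin: "cofinF (gen2 (fdY f) f)" "cofinF (gen2 (fdY f) (fps_deriv f))"
  shows "codim (gen2 (fdY f) f) + 1 = codim (gen2 (fdY f) (fps_deriv f)) + subdegree (f $ 0)"
proof -
  have Q0: "fdY f $ 0 = fps_deriv (f $ 0)" by (simp add: fdY_def)
  note sd = subdegree_deriv[OF f]
  have "codim (gen2 (fdY f) f)
      = codim (gen2 (fdY f) (fps_deriv f)) + 1 * subdegree (fdY f $ 0)"
  proof (rule codim_compare[OF _ fin])
    show "fdY f $ 0 \<noteq> 0" using sd(1) Q0 by simp
    fix N y
    assume *: "N > 0" "y $ 0 = 0" "param N y (fdY f) = 0"
      and nz: "param N y f \<noteq> 0" "param N y (fps_deriv f) \<noteq> 0"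
    have "fps_deriv (param N y f) = param N y (fps_deriv f) * fps_deriv (fps_X ^ N)"
      using param_chain_rule[OF *(1,2), of f] *(3) by simp
    moreover have "fps_deriv (fps_X ^ N) \<noteq> (0 :: complex fps)"
      using *(1) by (intro subdegree_deriv(1)) auto
    ultimately have "subdegree (fps_deriv (param N y f)) = subdegree (param N y (fps_deriv f)) + (N - 1)"
      using nz(2) subdegree_deriv_X_power[OF *(1)] by simp
    thus "subdegree (param N y f) = subdegree (param N y (fps_deriv f)) + 1 * N"
      using subdegree_deriv(2)[OF nz(1)] f(2) *(1) by (simp add: param_nth_0)
  qed
  thus ?thesis using sd(2) Q0 by simp
qed

text \<open>The series f + X f_X is the X-derivative of X f. On a branch of f_Y = 0 put p = f(t^N,
  y(t)); then N times the value of f + X f_X is N p + t p', with coefficients (N + n) p_n. None of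
  these factors is zero, so the orders agree.\<close>

lemma polar_X_multiple:
  assumes f: "f $ 0 \<noteq> 0" "f $ 0 $ 0 = 0"
    and fin: "cofinF (gen2 (fdY f) f)" "cofinF (gen2 (fdY f) (f + fps_X * fps_deriv f))"
  shows "codim (gen2 (fdY f) (f + fps_X * fps_deriv f)) = codim (gen2 (fdY f) f)"
proof -
  let ?F = "f + fps_X * fps_deriv f"
  have "codim (gen2 (fdY f) ?F)
      = codim (gen2 (fdY f) f) + 0 * subdegree (fdY f $ 0)"
  proof (rule codim_compare[OF _ fin(2,1)])
    show "fdY f $ 0 \<noteq> 0" using subdegree_deriv(1)[OF f] by (simp add: fdY_def)
    fix N y
    assume *: "N > 0" "y $ 0 = 0" "param N y (fdY f) = 0" and nz: "param N y f \<noteq> 0"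
    define p where "p = param N y f"
    have dp: "fps_deriv p = param N y (fps_deriv f) * fps_deriv (fps_X ^ N)"
      using param_chain_rule[OF *(1,2), of f] *(3) by (simp add: p_def)
    have "fps_X * fps_deriv (fps_X ^ N) = (of_nat N * fps_X ^ N :: complex fps)"
      unfolding fps_mult_fps_X_deriv_shift by (simp add: fps_eq_iff fps_X_power_nth flip: fps_of_nat)
    hence "fps_X * fps_deriv p = of_nat N * (fps_X ^ N * param N y (fps_deriv f))"
      unfolding dp by (simp add: mult_ac)
    hence e: "of_nat N * param N y ?F = of_nat N * p + fps_X * fps_deriv p"
      using *(1,2) by (simp add: param_add param_mult param_X p_def algebra_simps)
    have "(of_nat N * param N y ?F) $ n = of_nat (N + n) * p $ n" for n
      unfolding e by (cases n) (auto simp: algebra_simps simp flip: fps_of_nat)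
    hence "of_nat N * param N y ?F $ n = of_nat (N + n) * p $ n" for n
      by (simp flip: fps_of_nat)
    hence "param N y ?F $ n = 0 \<longleftrightarrow> p $ n = 0" for n
      using *(1) by (metis add_is_0 mult_eq_0_iff not_gr0 of_nat_eq_0_iff)
    hence "subdegree (param N y ?F) = subdegree p"
      using nz unfolding p_def by (intro subdegreeI) auto
    thus "subdegree (param N y ?F) = subdegree (param N y f) + 0 * N" by (simp add: p_def)
  qed
  thus ?thesis by simp
qed

section \<open>The Tjurina number of a union\<close>

text \<open>
  On a branch of \<open>f\<close> the claim reads that \<open>dg / g\<close> is not a holomorphic differential: it has a simple
  pole whose residue is the order of \<open>g\<close>.
\<close>

lemma jacobian_not_in_ideal:
  assumes f: "f $ 0 \<noteq> 0" "f $ 0 $ 0 = 0" and g: "g $ 0 $ 0 = 0"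
    and fin: "cofinF (gen2 f g)" "cofinF (gen2 f (fdY f))"
  shows "fps_deriv f * fdY g - fdY f * fps_deriv g
    \<noteq> g * (a * fps_deriv f + b * fdY f) + c * f"
proof
  assume *: "fps_deriv f * fdY g - fdY f * fps_deriv g
    = g * (a * fps_deriv f + b * fdY f) + c * f"
  have "subdegree (f $ 0) > 0" using f by (metis gr0I nth_subdegree_zero_iff)
  then obtain N y where Ny: "N > 0" "y $ 0 = 0" and pf: "param N y f = 0"
    using series_root[OF f(1)] by blast
  have nz: "param N y h \<noteq> 0" if h: "cofinF (gen2 f h)" for h
  proof
    assume 0: "param N y h = 0"
    obtain k where "fps_X ^ k \<in> gen2 f h" using h unfolding cofinF_def by blast
    then obtain a b where "fps_X ^ k = a * f + b * h" by (rule gen2E)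
    hence "param N y (fps_X ^ k) = 0" using Ny 0 pf by (simp add: param_add param_mult)
    thus False using Ny by (simp add: param_power param_X)
  qed
  let ?p = "param N y" and ?D = "fps_deriv (fps_X ^ N) :: complex fps"
  define G where "G = ?p g"
  have G: "G \<noteq> 0" "G $ 0 = 0" using nz[OF fin(1)] g by (simp_all add: G_def param_nth_0)
  have cf: "?p (fps_deriv f) * ?D = - (?p (fdY f) * fps_deriv y)"
    using param_chain_rule[OF Ny, of f] pf by (simp add: eq_neg_iff_add_eq_0)
  have cg: "fps_deriv G = ?p (fps_deriv g) * ?D + ?p (fdY g) * fps_deriv y"
    unfolding G_def by (rule param_chain_rule[OF Ny])
  have "?p (fps_deriv f) * ?p (fdY g) - ?p (fdY f) * ?p (fps_deriv g)
      = G * (?p a * ?p (fps_deriv f) + ?p b * ?p (fdY f))"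
    using arg_cong[OF *, of ?p] Ny pf by (simp add: param_diff param_add param_mult G_def)
  hence "(?p (fps_deriv f) * ?D) * ?p (fdY g) - ?p (fdY f) * (?p (fps_deriv g) * ?D)
      = G * (?p a * (?p (fps_deriv f) * ?D) + ?p b * ?p (fdY f) * ?D)"
    by (simp add: algebra_simps)
  \<comment> \<open>On the branch, f_X dX = - f_Y dy turns the Jacobian determinant into - f_Y dg.
    The factor f_Y, common to both sides, is cancelled next.\<close>
  hence "?p (fdY f) * fps_deriv G = ?p (fdY f) * (G * (?p a * fps_deriv y - ?p b * ?D))"
    unfolding cf cg by (simp add: algebra_simps)
  hence "fps_deriv G = G * (?p a * fps_deriv y - ?p b * ?D)" using nz[OF fin(2)] by simp
  hence "G dvd fps_deriv G" by simp
  hence "subdegree G \<le> subdegree (fps_deriv G)"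
    using subdegree_deriv(1)[OF G] by (intro dvd_imp_subdegree_le) auto
  thus False using subdegree_deriv(2)[OF G] by simp
qed

text \<open>Differentiation enters only through J, so the inequality is proved for arbitrary
  elements of an algebra. With V = \<langle>f\<rangle> + g T(f) and W = V +
  \<langle>\<delta>\<rangle> the estimates are codim V \<le> I(f, g) + \<tau>(f), codim S \<le>
  codim V + \<tau>(g), codim W < codim V, and codim T(f g) + \<tau>(f) \<le> codim S + codim
  W.\<close>

lemma codim_product_le:
  fixes f g fx fy gx gy :: "'a :: calg"
  assumes Tf: "fincod (gen3 f fx fy)" and Tg: "fincod (gen3 g gx gy)" and I: "fincod (gen2 f g)"
    and J: "\<And>a b c. fx * gy - fy * gx \<noteq> g * (a * fx + b * fy) + c * f"
  shows "codim (gen3 (f * g) (f * gx + g * fx) (f * gy + g * fy)) + 1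
    \<le> codim (gen3 f fx fy) + codim (gen3 g gx gy) + 2 * codim (gen2 f g)"
proof -
  define P Px Py \<delta> where "P = f * g" and "Px = f * gx + g * fx" and "Py = f * gy + g * fy"
    and "\<delta> = fx * gy - fy * gx"
  define V where "V = gen3 f (g * fx) (g * fy)"
  define W where "W = im_sum ((*) \<delta>) UNIV V"
  define S where "S = {f * s + g * t | s t. s \<in> gen3 g gx gy \<and> t \<in> gen3 f fx fy}"
  have V: "isidl V" "csub V" unfolding V_def by (rule isidl_gen3 csub_gen3)+
  have W: "csub W" unfolding W_def by (intro csub_im_sum clin_mult csub_UNIV V(2))
  have WI: "\<delta> * w + v \<in> W" if "v \<in> V" for v w
    unfolding W_def im_sum_def using that by blast
  have WE: "\<exists>v w. v \<in> V \<and> x = v + w * \<delta>" if "x \<in> W" for x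
    using that unfolding W_def im_sum_def by (auto simp: algebra_simps)
  have gV: "g * t \<in> V" if "t \<in> gen3 f fx fy" for t
  proof -
    obtain a b c where t: "t = a * f + b * fx + c * fy" using \<open>t \<in> gen3 f fx fy\<close> by (rule gen3E)
    have "g * t = (a * g) * f + b * (g * fx) + c * (g * fy)" unfolding t by (simp add: algebra_simps)
    thus ?thesis unfolding V_def using gen3I by metis
  qed
  have Vf: "\<exists>u t. v = f * u + g * t \<and> t \<in> gen3 f fx fy" if "v \<in> V" for v
  proof -
    obtain a b c where "v = a * f + b * (g * fx) + c * (g * fy)" using \<open>v \<in> V\<close> unfolding V_def by (rule gen3E)
    hence "v = f * a + g * (0 * f + b * fx + c * fy)" by (simp add: algebra_simps)
    thus ?thesis using gen3I by metis
  qed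
  have fV: "f * u \<in> V" for u
    unfolding V_def using isidlD(4)[OF isidl_gen3 gen3_mem(1)] .
  have imI: "im_sum ((*) g) UNIV V = gen2 f g"
  proof (intro equalityI subsetI)
    fix x assume "x \<in> im_sum ((*) g) UNIV V"
    then obtain u v where "x = g * u + v" "v \<in> V" unfolding im_sum_def by blast
    moreover obtain u' t where "v = f * u' + g * t" using Vf[OF \<open>v \<in> V\<close>] by blast
    ultimately have "x = u' * f + (u + t) * g" by (simp add: algebra_simps)
    thus "x \<in> gen2 f g" using gen2I by metis
  next
    fix x assume "x \<in> gen2 f g"
    then obtain a b where "x = a * f + b * g" by (rule gen2E)
    hence "x = g * b + f * a" by (simp add: algebra_simps)
    thus "x \<in> im_sum ((*) g) UNIV V" unfolding im_sum_def using fV by blast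
  qed
  have a: "fincod V" "codim V \<le> codim (gen2 f g) + codim (gen3 f fx fy)"
    using codim_image_le[OF clin_mult Tf subset_UNIV csub_UNIV V(2), of g] gV I unfolding imI by auto
  have "\<delta> \<in> W" using WI[OF isidlD(1)[OF V(1)], of 1] by simp
  moreover have "\<delta> \<notin> V"
  proof
    assume "\<delta> \<in> V"
    then obtain a b c where "\<delta> = a * f + b * (g * fx) + c * (g * fy)" unfolding V_def by (rule gen3E)
    hence "fx * gy - fy * gx = g * (b * fx + c * fy) + a * f" by (simp add: \<delta>_def algebra_simps)
    thus False using J by blast
  qed
  moreover have VW: "V \<subseteq> W" using WI[of _ 0] by auto
  ultimately have b: "codim W < codim V" "fincod W"
    using codim_less[OF a(1) _ W] codim_mono(1)[OF a(1) VW W] by blast+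
  have WT: "W \<subseteq> gen3 f fx fy"
  proof
    fix x assume "x \<in> W"
    then obtain v w where vw: "v \<in> V" "x = v + w * \<delta>" using WE by blast
    obtain a b c where "v = a * f + b * (g * fx) + c * (g * fy)" using vw(1) unfolding V_def by (rule gen3E)
    hence "x = a * f + (b * g + w * gy) * fx + (c * g - w * gx) * fy"
      unfolding vw(2) \<delta>_def by (simp add: algebra_simps)
    thus "x \<in> gen3 f fx fy" using gen3I by metis
  qed
  have imS: "im_sum ((*) f) UNIV S = V"
  proof (intro equalityI subsetI)
    fix x assume "x \<in> im_sum ((*) f) UNIV S"
    then obtain u s t where "t \<in> gen3 f fx fy" "x = f * u + (f * s + g * t)" unfolding im_sum_def S_def by blast
    moreover have "f * u + (f * s + g * t) = f * (u + s) + g * t" by (simp add: algebra_simps)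
    ultimately show "x \<in> V" using isidlD(2)[OF V(1) fV gV] by metis
  next
    fix x assume "x \<in> V"
    then obtain u t where "x = f * u + g * t" "t \<in> gen3 f fx fy" using Vf by blast
    hence "x = f * u + (f * 0 + g * t)" "t \<in> gen3 f fx fy" "0 \<in> gen3 g gx gy" by (auto intro: isidlD(1)[OF isidl_gen3])
    thus "x \<in> im_sum ((*) f) UNIV S" unfolding im_sum_def S_def by blast
  qed
  define T where "T = gen3 P Px Py"
  have T: "isidl T" "csub T" unfolding T_def by (rule isidl_gen3 csub_gen3)+
  have imT: "im_sum ((*) g) (gen3 f fx fy) T = S"
  proof (intro equalityI subsetI)
    fix x assume "x \<in> im_sum ((*) g) (gen3 f fx fy) T"
    then obtain t z where tz: "t \<in> gen3 f fx fy" "z \<in> T" "x = g * t + z" unfolding im_sum_def by blast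
    obtain a b c where z: "z = a * P + b * Px + c * Py" using tz(2) unfolding T_def by (rule gen3E)
    have "x = f * (a * g + b * gx + c * gy) + g * (t + (0 * f + b * fx + c * fy))"
      unfolding tz(3) z P_def Px_def Py_def by (simp add: algebra_simps)
    moreover have "t + (0 * f + b * fx + c * fy) \<in> gen3 f fx fy"
      using isidlD(2)[OF isidl_gen3 tz(1) gen3I] .
    ultimately show "x \<in> S" unfolding S_def using gen3I by blast
  next
    fix x assume "x \<in> S"
    then obtain s t where st: "s \<in> gen3 g gx gy" "t \<in> gen3 f fx fy" "x = f * s + g * t" unfolding S_def by blast
    obtain a b c where s: "s = a * g + b * gx + c * gy" using st(1) by (rule gen3E)
    \<comment> \<open>The element f (a g + b gx + c gy) differs from a P + b Px + c Py by g (b fx +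
      c fy), which is moved into the multiple of g.\<close>
    have "x = g * (t - (0 * f + b * fx + c * fy)) + (a * P + b * Px + c * Py)"
      unfolding st(3) s P_def Px_def Py_def by (simp add: algebra_simps)
    moreover have "t - (0 * f + b * fx + c * fy) \<in> gen3 f fx fy"
      using isidlD(6)[OF isidl_gen3 st(2) gen3I] .
    ultimately show "x \<in> im_sum ((*) g) (gen3 f fx fy) T" unfolding im_sum_def T_def using gen3I by blast
  qed
  have "csub S" unfolding imT[symmetric] by (intro csub_im_sum clin_mult csub_gen3 T(2))
  have fS: "(*) f ` gen3 g gx gy \<subseteq> S"
  proof
    fix x assume "x \<in> (*) f ` gen3 g gx gy"
    then obtain s where "s \<in> gen3 g gx gy" "x = f * s + g * 0" by auto
    thus "x \<in> S" unfolding S_def using isidlD(1)[OF isidl_gen3] by blast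
  qed
  have c: "fincod S" "codim S \<le> codim V + codim (gen3 g gx gy)"
    using codim_image_le[OF clin_mult Tg subset_UNIV csub_UNIV \<open>csub S\<close> fS] a(1) unfolding imS by auto
  have gW: "(*) g ` W \<subseteq> T"
  proof
    fix x assume "x \<in> (*) g ` W"
    then obtain v w where vw: "v \<in> V" "x = g * (v + w * \<delta>)" using WE by blast
    obtain a b c where v: "v = a * f + b * (g * fx) + c * (g * fy)" using vw(1) unfolding V_def by (rule gen3E)
    \<comment> \<open>Uses g^2 fx = g Px - gx P, the same identity for y, and g \<delta> = gy Px -
      gx Py.\<close>
    have "x = (a - b * gx - c * gy) * P + (b * g + w * gy) * Px + (c * g - w * gx) * Py"
      unfolding vw(2) v \<delta>_def P_def Px_def Py_def by (simp add: algebra_simps)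
    thus "x \<in> T" unfolding T_def using gen3I by metis
  qed
  have "codim T + codim (gen3 f fx fy) \<le> codim S + codim W"
    using codim_image_le(2)[OF clin_mult b(2) WT csub_gen3 T(2) gW] c(1) unfolding imT by simp
  thus ?thesis using a(2) b(1) c(2) unfolding T_def P_def Px_def Py_def by linarith
qed

section \<open>Reduced curves\<close>

lemma fps2_of_deriv:
  "fps2_of (deriv_X f) = fps_deriv (fps2_of f)" "fps2_of (deriv_Y f) = fdY (fps2_of f)"
  by (simp_all add: deriv_X.rep_eq deriv_Y.rep_eq fdY_def)

lemma fdY_mult:
  "fdY (F * G) = F * fdY G + fdY F * G" for F G :: "complex fps fps"
  by (rule fps_ext) (simp add: fdY_def fps_mult_nth fps_deriv_sum sum.distrib)

lemma deriv_mult: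
  "deriv_X (a * b) = a * deriv_X b + deriv_X a * b"
  "deriv_Y (a * b) = a * deriv_Y b + deriv_Y a * b"
  by (simp_all add: fps2_of_deriv fps2_of_simps fdY_mult flip: fps2_of_inject)

lemma deriv_sX: "deriv_X sX = 1" "deriv_Y sX = 0"
proof -
  have "fdY fps_X = (0 :: complex fps fps)"
    by (simp add: fdY_def fps_eq_iff fps_X_nth)
  thus "deriv_X sX = 1" "deriv_Y sX = 0"
    by (simp_all add: fps2_of_deriv fps2_of_simps flip: fps2_of_inject)
qed

lemma at0_deriv_Y: "at0 (deriv_Y f) = fps_deriv (at0 f)"
  by (simp add: at0_def' fps2_of_deriv fdY_def)

lemma series_unit_iff: "u dvd 1 \<longleftrightarrow> at0 u $ 0 \<noteq> 0"
proof
  assume "u dvd 1"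
  then obtain v where "1 = u * v" by (rule dvdE)
  hence "at0 u * at0 v = 1" by (metis at0_simps(4,5))
  thus "at0 u $ 0 \<noteq> 0" by (metis fps_mult_nth_0 fps_one_nth mult_zero_left zero_neq_one)
next
  assume "at0 u $ 0 \<noteq> 0"
  hence "at0 u \<noteq> 0" "subdegree (at0 u) = 0" by auto
  then obtain a r where "1 = u * a + r" "\<And>i j. fps2_of r $ i $ j = 0"
    using weierstrass_division_series[of u 1] by auto
  moreover have "r = 0" using calculation(2) by (simp add: fps_eq_iff fps2_of_simps flip: fps2_of_inject)
  ultimately show "u dvd 1" by (metis add.right_neutral dvd_triv_left)
qed

lemma cofin_param:
  assumes "cofin (gen2 g h)" "N > 0" "y $ 0 = 0" "param N y (fps2_of g) = 0" "param N y (fps2_of h) = 0"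
  shows False
proof -
  obtain k where "sX ^ k \<in> gen2 g h" using assms(1) unfolding cofin_def by blast
  then obtain a b where "sX ^ k = a * g + b * h" by (rule gen2E)
  from arg_cong[OF this, of "\<lambda>F. param N y (fps2_of F)"] show False
    using assms by (simp add: fps2_of_simps fps2_of_power param_add param_mult param_power param_X)
qed

lemma nonunit_root:
  assumes "at0 w \<noteq> 0" "\<not> w dvd 1"
  obtains N y where "N > 0" "y $ 0 = 0" "\<And>g. w dvd g \<Longrightarrow> param N y (fps2_of g) = 0"
proof -
  have "subdegree (at0 w) > 0" using assms by (metis gr0I nth_subdegree_zero_iff series_unit_iff)
  then obtain N y where *: "N > 0" "y $ 0 = 0" "param N y (fps2_of w) = 0"
    using series_root[of "fps2_of w"] assms unfolding at0_def' by blast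
  show ?thesis
  proof (rule that[OF *(1,2)])
    fix g assume "w dvd g"
    then obtain c where "g = w * c" by (rule dvdE)
    thus "param N y (fps2_of g) = 0" using * by (simp add: fps2_of_simps param_mult)
  qed
qed

text \<open>By the chain rule f is constant along the curve, and it vanishes at the origin.\<close>

lemma param_eq_0_if_deriv:
  assumes "N > 0" "y $ 0 = 0" "at0 f $ 0 = 0"
    "param N y (fps2_of (deriv_X f)) = 0" "param N y (fps2_of (deriv_Y f)) = 0"
  shows "param N y (fps2_of f) = 0"
proof -
  have "fps_deriv (param N y (fps2_of f)) = 0"
    using param_chain_rule[OF assms(1,2), of "fps2_of f"] assms(4,5) by (simp add: fps2_of_deriv)
  moreover have "param N y (fps2_of f) $ 0 = 0" using assms(3) by (simp add: param_nth_0 at0_def')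
  ultimately show ?thesis by (metis fps_const_0_eq_0 fps_deriv_eq_0_iff)
qed

text \<open>Coprimality of f and f_Y forces an isolated singularity: on a branch of a common factor
  of f_X and f_Y the series f would vanish as well.\<close>

lemma cofin_derivs:
  assumes "at0 f \<noteq> 0" "at0 f $ 0 = 0" "cofin (gen2 f (deriv_Y f))"
  shows "cofin (gen2 (deriv_X f) (deriv_Y f))"
proof (rule coprime_imp_cofin, rule ccontr)
  fix w assume w: "w dvd deriv_X f" "w dvd deriv_Y f" "\<not> w dvd 1"
  have "at0 (deriv_Y f) \<noteq> 0" using assms subdegree_deriv(1) by (simp add: at0_deriv_Y)
  hence "at0 w \<noteq> 0" using w(2) by (metis dvd_trans sX_dvd_iff)
  then obtain N y where *: "N > 0" "y $ 0 = 0" "\<And>g. w dvd g \<Longrightarrow> param N y (fps2_of g) = 0"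
    by (rule nonunit_root[OF _ w(3)]) blast
  have "param N y (fps2_of f) = 0"
    by (rule param_eq_0_if_deriv[OF *(1,2) assms(2) *(3)[OF w(1)] *(3)[OF w(2)]])
  thus False using cofin_param[OF assms(3) *(1,2)] *(3)[OF w(2)] by blast
qed

text \<open>The argument of \<open>cofin_derivs\<close> for X g, whose derivatives are g + X g_X and
  X g_Y. On a parametrized branch X = t^N is nonzero, so g vanishes along with X g.\<close>

lemma cofin_X_multiple:
  assumes "at0 g \<noteq> 0" "at0 g $ 0 = 0" "cofin (gen2 g (deriv_Y g))"
  shows "cofin (gen2 (deriv_Y g) (g + sX * deriv_X g))" "cofin (gen2 (g + sX * deriv_X g) (sX * deriv_Y g))"
proof -
  let ?h = "g + sX * deriv_X g"
  show 1: "cofin (gen2 (deriv_Y g) ?h)"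
  proof (rule coprime_imp_cofin, rule ccontr)
    fix w assume w: "w dvd deriv_Y g" "w dvd ?h" "\<not> w dvd 1"
    have "at0 (deriv_Y g) \<noteq> 0" using assms subdegree_deriv(1) by (simp add: at0_deriv_Y)
    hence "at0 w \<noteq> 0" using w(1) by (metis dvd_trans sX_dvd_iff)
    then obtain N y where *: "N > 0" "y $ 0 = 0" "\<And>g. w dvd g \<Longrightarrow> param N y (fps2_of g) = 0"
      by (rule nonunit_root[OF _ w(3)]) blast
    have d: "deriv_X (sX * g) = ?h" "deriv_Y (sX * g) = sX * deriv_Y g"
      by (simp_all add: deriv_mult deriv_sX)
    have "param N y (fps2_of (deriv_X (sX * g))) = 0" unfolding d by (rule *(3)[OF w(2)])
    moreover have "param N y (fps2_of (deriv_Y (sX * g))) = 0" unfolding d by (rule *(3)[OF dvd_mult[OF w(1)]])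
    ultimately have "param N y (fps2_of (sX * g)) = 0"
      by (rule param_eq_0_if_deriv[OF *(1,2), rotated 1]) simp
    hence "param N y (fps2_of g) = 0" using *(1,2) by (simp add: fps2_of_simps param_mult param_X)
    thus False using cofin_param[OF assms(3) *(1,2)] *(3)[OF w(1)] by blast
  qed
  have "sX = 0 * ?h + 1 * sX" by simp
  hence X: "sX ^ 1 \<in> gen2 ?h sX" using gen2I by (metis power_one_right)
  have "cofin (gen2 ?h sX)"
    by (rule cofin_if_X_power[OF isidl_gen2 gen2_mem(1) _ X]) (simp add: assms(1))
  thus "cofin (gen2 ?h (sX * deriv_Y g))"
    using 1 by (intro cofin_gen2_mult) (simp_all add: gen2_commute)
qed

section \<open>Intersection, Milnor and Tjurina numbers of convergent series\<close>

lemma intersection_mult_eq: "intersection_mult g h = quot_dim (gen2 g h)"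
  by (simp add: intersection_mult_def ideal_gen_gen2)

lemma intersection_mult_codim:
  "cofin (gen2 g h) \<Longrightarrow> intersection_mult g h = codim (gen2 (fps2_of g) (fps2_of h))"
  by (simp add: intersection_mult_eq gen2_formal)

lemma intersection_mult_commute: "intersection_mult g h = intersection_mult h g"
  by (simp add: intersection_mult_eq gen2_commute)

lemma intersection_mult_mult:
  assumes "cofin (gen2 p (q * s))"
  shows "intersection_mult p (q * s) = intersection_mult p q + intersection_mult p s"
proof -
  have "cofin (gen2 p q)" "cofin (gen2 p s)"
    using assms by (rule cofin_mono, intro gen2_mono_dvd, simp)+
  thus ?thesis
    using assms codim_gen2_mult[of "fps2_of p" "fps2_of q" "fps2_of s"] gen2_formal(1)[OF assms]
    by (simp add: intersection_mult_codim fps2_of_simps)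
qed

lemma intersection_mult_prod:
  assumes "finite A" "cofin (gen2 p (prod f A))"
  shows "intersection_mult p (prod f A) = (\<Sum>i\<in>A. intersection_mult p (f i))"
  using assms
proof (induction A rule: finite_induct)
  case empty
  have "quot_dim (gen2 p 1) = 0"
    using quot_dim_eqI[OF isidl_gen2, of p 1] reldim_0[of UNIV] by (simp add: gen2_1)
  thus ?case by (simp add: intersection_mult_eq)
next
  case (insert i A)
  have "cofin (gen2 p (prod f A))"
    using insert.prems by (rule cofin_mono) (intro gen2_mono_dvd, simp add: insert.hyps)
  thus ?case using insert intersection_mult_mult[of p "f i" "prod f A"] by simp
qed

lemma gen2_add_multiple: "gen2 p (p * r + q) = gen2 p q"
proof (intro equalityI gen2_least isidl_gen2 gen2_mem)
  show "p * r + q \<in> gen2 p q" using gen2I[of r p 1 q] by (simp add: mult.commute)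
  show "q \<in> gen2 p (p * r + q)" using gen2I[of "- r" p 1 "p * r + q"] by (simp add: mult.commute)
qed

lemma gen2_unit_mult:
  assumes "u dvd (1 :: 'a :: comm_ring_1)"
  shows "gen2 p (u * q) = gen2 p q"
proof (intro equalityI gen2_least isidl_gen2 gen2_mem)
  show "u * q \<in> gen2 p q" using isidlD(3)[OF isidl_gen2 gen2_mem(2)] .
  obtain v where "1 = u * v" using assms by (rule dvdE)
  hence "q = v * (u * q)" by (metis mult.assoc mult.commute mult.left_neutral)
  thus "q \<in> gen2 p (u * q)" using isidlD(3)[OF isidl_gen2 gen2_mem(2)] by metis
qed

lemma gen2_polar_unit_mult:
  assumes "u dvd 1"
  shows "gen2 (u * p) (deriv_Y (u * p)) = gen2 p (deriv_Y p)"
proof -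
  have "gen2 (u * p) (deriv_Y (u * p)) = gen2 p (p * deriv_Y u + u * deriv_Y p)"
    using gen2_unit_mult[OF assms] by (metis deriv_mult(2) gen2_commute add.commute mult.commute)
  also have "\<dots> = gen2 p (deriv_Y p)" by (simp add: gen2_add_multiple gen2_unit_mult[OF assms])
  finally show ?thesis .
qed

lemma milnor_polar:
  assumes "at0 f \<noteq> 0" "at0 f $ 0 = 0" "cofin (gen2 f (deriv_Y f))"
  shows "intersection_mult f (deriv_Y f) + 1 = milnor f + subdegree (at0 f)"
proof -
  have c: "cofin (gen2 (deriv_Y f) f)" "cofin (gen2 (deriv_Y f) (deriv_X f))"
    using assms(3) cofin_derivs[OF assms] by (simp_all add: gen2_commute)
  have "intersection_mult (deriv_Y f) f + 1 = intersection_mult (deriv_Y f) (deriv_X f) + subdegree (at0 f)"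
    using teissier[of "fps2_of f"] assms c gen2_formal(1)[OF c(1)] gen2_formal(1)[OF c(2)]
    by (simp add: intersection_mult_codim fps2_of_deriv at0_def')
  thus ?thesis by (simp add: milnor_def intersection_mult_commute)
qed

text \<open>Modulo f the derivative (f g)_Y is f_Y g, and modulo g it is f g_Y.\<close>

lemma intersection_mult_polar_mult:
  assumes "cofin (gen2 (f * g) (deriv_Y (f * g)))"
  shows "intersection_mult (f * g) (deriv_Y (f * g))
    = intersection_mult f (deriv_Y f) + intersection_mult g (deriv_Y g) + 2 * intersection_mult f g"
proof -
  define D where "D = deriv_Y (f * g)"
  have c: "cofin (gen2 D (f * g))" using assms by (simp add: D_def gen2_commute)
  have *: "cofin (gen2 D f)" "cofin (gen2 D g)"
    using c by (rule cofin_mono, intro gen2_mono_dvd, simp)+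
  have 1: "gen2 f D = gen2 f (deriv_Y f * g)" unfolding D_def deriv_mult by (rule gen2_add_multiple)
  have "D = g * deriv_Y f + f * deriv_Y g" by (simp add: D_def deriv_mult algebra_simps)
  hence 2: "gen2 g D = gen2 g (f * deriv_Y g)" by (simp add: gen2_add_multiple)
  have "intersection_mult (f * g) D = intersection_mult D f + intersection_mult D g"
    using intersection_mult_mult[OF c] by (simp add: intersection_mult_commute)
  also have "intersection_mult D f = intersection_mult f (deriv_Y f) + intersection_mult f g"
    using intersection_mult_mult[of f "deriv_Y f" g] *(1) 1 by (simp add: intersection_mult_eq gen2_commute[of D])
  also have "intersection_mult D g = intersection_mult g f + intersection_mult g (deriv_Y g)"
    using intersection_mult_mult[of g f "deriv_Y g"] *(2) 2 by (simp add: intersection_mult_eq gen2_commute[of D])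
  finally show ?thesis by (simp add: D_def intersection_mult_commute)
qed

lemma milnor_mult_regular:
  assumes "at0 f \<noteq> 0" "at0 f $ 0 = 0" "at0 g \<noteq> 0" "at0 g $ 0 = 0"
    and "cofin (gen2 f (deriv_Y f))" "cofin (gen2 g (deriv_Y g))" "cofin (gen2 (f * g) (deriv_Y (f * g)))"
  shows "milnor (f * g) + 1 = milnor f + milnor g + 2 * intersection_mult f g"
proof -
  have fg: "at0 (f * g) \<noteq> 0" "at0 (f * g) $ 0 = 0" using assms(1-4) by simp_all
  have "subdegree (at0 (f * g)) = subdegree (at0 f) + subdegree (at0 g)" using assms(1,3) by simp
  thus ?thesis
    using milnor_polar[OF assms(1,2,5)] milnor_polar[OF assms(3,4,6)] milnor_polar[OF fg assms(7)]
      intersection_mult_polar_mult[OF assms(7)] by linarith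
qed

lemma intersection_mult_sX:
  assumes "at0 g \<noteq> 0"
  shows "cofin (gen2 sX g)" "intersection_mult sX g = subdegree (at0 g)"
proof -
  have "sX ^ 1 \<in> gen2 sX g" using gen2_mem(1) by simp
  from cofin_if_X_power[OF isidl_gen2 gen2_mem(2) assms this] show "cofin (gen2 sX g)" .
  thus "intersection_mult sX g = subdegree (at0 g)"
    using codim_gen2_X[of "fps2_of g"] assms by (simp add: intersection_mult_codim fps2_of_simps at0_def')
qed

text \<open>I(g + X g_X, X g_Y) splits along the factors X and g_Y. Modulo X the first entry is g,
  and on the branches of g_Y it has the same order as g.\<close>

lemma milnor_X_mult:
  assumes "at0 g \<noteq> 0" "at0 g $ 0 = 0" "cofin (gen2 g (deriv_Y g))"
  shows "milnor (sX * g) = subdegree (at0 g) + intersection_mult g (deriv_Y g)"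
proof -
  let ?h = "g + sX * deriv_X g"
  note c = cofin_X_multiple[OF assms]
  have c': "cofin (gen2 (deriv_Y g) g)" using assms(3) by (simp add: gen2_commute)
  have d: "deriv_X (sX * g) = ?h" "deriv_Y (sX * g) = sX * deriv_Y g"
    by (simp_all add: deriv_mult deriv_sX)
  have "milnor (sX * g) = intersection_mult ?h sX + intersection_mult ?h (deriv_Y g)"
    unfolding milnor_def d by (rule intersection_mult_mult[OF c(2)])
  also have "intersection_mult ?h sX = intersection_mult sX g"
    using gen2_add_multiple[of sX "deriv_X g" g] by (simp add: intersection_mult_eq gen2_commute add.commute)
  also have "\<dots> = subdegree (at0 g)" by (rule intersection_mult_sX(2)[OF assms(1)])
  also have "intersection_mult ?h (deriv_Y g) = intersection_mult (deriv_Y g) ?h" by (rule intersection_mult_commute)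
  also have "\<dots> = intersection_mult (deriv_Y g) g"
    using polar_X_multiple[of "fps2_of g"] assms gen2_formal(1)[OF c(1)] gen2_formal(1)[OF c']
    by (simp add: intersection_mult_codim c(1) c' fps2_of_deriv fps2_of_simps at0_def')
  finally show ?thesis by (simp add: intersection_mult_commute)
qed

lemma milnor_X_unit:
  assumes "u dvd 1" shows "milnor (sX * u) = 0" "cofin (gen2 (deriv_X (sX * u)) (deriv_Y (sX * u)))"
proof -
  define a where "a = deriv_X (sX * u)"
  have "a = u + sX * deriv_X u" by (simp add: a_def deriv_mult deriv_sX)
  hence "a dvd 1" using assms by (simp add: series_unit_iff)
  then obtain b where "1 = a * b" by (rule dvdE)
  hence "1 = b * a + 0 * deriv_Y (sX * u)" by (simp add: mult.commute)
  hence "1 \<in> gen2 a (deriv_Y (sX * u))" using gen2I by metis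
  hence U: "gen2 a (deriv_Y (sX * u)) = UNIV" using isidl_UNIV_iff[OF isidl_gen2] by blast
  hence "quot_dim (gen2 a (deriv_Y (sX * u))) = 0"
    using quot_dim_eqI[OF isidl_gen2, of a "deriv_Y (sX * u)"] reldim_0[of UNIV] by simp
  thus "milnor (sX * u) = 0" by (simp add: milnor_def intersection_mult_eq a_def)
  show "cofin (gen2 (deriv_X (sX * u)) (deriv_Y (sX * u)))" using U by (simp add: cofin_def a_def)
qed

lemma tjurina_eq: "tjurina f = quot_dim (gen3 f (deriv_X f) (deriv_Y f))"
  by (simp add: tjurina_def ideal_gen_gen3)

text \<open>Here f is the factor whose branch is parametrized in
  \<open>jacobian_not_in_ideal\<close>, hence the regularity of f; \<open>tjurina_union_le\<close>
  exchanges the factors when necessary.\<close>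

lemma tjurina_mult_le:
  assumes "at0 f $ 0 = 0" "at0 g $ 0 = 0" "at0 f \<noteq> 0" "cofin (gen2 f (deriv_Y f))" "cofin (gen2 f g)"
    and "cofin (gen2 (deriv_X f) (deriv_Y f))" "cofin (gen2 (deriv_X g) (deriv_Y g))"
    and "cofin (gen2 (deriv_X (f * g)) (deriv_Y (f * g)))"
  shows "tjurina (f * g) + 1 \<le> tjurina f + tjurina g + 2 * intersection_mult f g"
proof -
  have c3: "cofin (gen3 h (deriv_X h) (deriv_Y h))" if "cofin (gen2 (deriv_X h) (deriv_Y h))" for h
    using that by (rule cofin_mono) (intro gen2_least isidl_gen3 gen3_mem)
  define F G where "F = fps2_of f" and "G = fps2_of g"
  define T where "T = (\<lambda>F :: complex fps fps. gen3 F (fps_deriv F) (fdY F))"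
  have T: "cofinF (T (fps2_of h))" "tjurina h = codim (T (fps2_of h))"
    if "cofin (gen2 (deriv_X h) (deriv_Y h))" for h
    using gen3_formal[OF c3[OF that]] unfolding T_def by (simp_all add: tjurina_eq fps2_of_deriv)
  have "codim (gen3 (F * G) (F * fps_deriv G + G * fps_deriv F) (F * fdY G + G * fdY F)) + 1
    \<le> codim (T F) + codim (T G) + 2 * codim (gen2 F G)"
    unfolding T_def
  proof (rule codim_product_le)
    show "fincod (gen3 F (fps_deriv F) (fdY F))" "fincod (gen3 G (fps_deriv G) (fdY G))"
      using cofinF_fincod[OF T(1)[OF assms(6)]] cofinF_fincod[OF T(1)[OF assms(7)]]
      unfolding F_def G_def T_def by (simp_all add: isidl_gen3)
    show "fincod (gen2 F G)"
      using gen2_formal(1)[OF assms(5)] unfolding F_def G_def by (rule cofinF_fincod[OF _ isidl_gen2])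
    show "fps_deriv F * fdY G - fdY F * fps_deriv G
      \<noteq> G * (a * fps_deriv F + b * fdY F) + c * F" for a b c
      using assms(1-3) gen2_formal(1)[OF assms(5)] gen2_formal(1)[OF assms(4)] unfolding F_def G_def
      by (intro jacobian_not_in_ideal) (simp_all add: at0_def' fps2_of_deriv)
  qed
  moreover have "gen3 (F * G) (F * fps_deriv G + G * fps_deriv F) (F * fdY G + G * fdY F)
      = T (fps2_of (f * g))"
    unfolding T_def F_def G_def by (simp add: fps2_of_simps fdY_mult mult.commute)
  ultimately show ?thesis
    using T(2)[OF assms(6)] T(2)[OF assms(7)] T(2)[OF assms(8)] intersection_mult_codim[OF assms(5)]
    unfolding F_def G_def by simp
qed

lemma irreducible_dvd_cases:
  fixes p w :: "'a :: idom"
  assumes "Factorial_Ring.irreducible p" "w dvd p"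
  shows "w dvd 1 \<or> p dvd w"
proof -
  obtain c where c: "p = w * c" using assms(2) by (rule dvdE)
  have "w dvd 1 \<or> c dvd 1" using Factorial_Ring.irreducibleD[OF assms(1) c] .
  thus ?thesis
  proof
    assume "c dvd 1"
    then obtain d where "1 = c * d" by (rule dvdE)
    hence "w = p * d" using c by (metis mult.assoc mult.right_neutral)
    thus ?thesis by simp
  qed simp
qed

lemma irreducible_dvd_sX:
  assumes "Factorial_Ring.irreducible p" "at0 p = 0"
  obtains u where "p = sX * u" "u dvd 1"
proof -
  obtain u where u: "p = sX * u" using assms(2) sX_dvd_iff by (metis dvdE)
  have "\<not> sX dvd 1" by (simp add: series_unit_iff)
  thus ?thesis using that Factorial_Ring.irreducibleD[OF assms(1) u] u by blast
qed

text \<open>On X = 0 the Y-derivative lowers the order by exactly one.\<close>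

lemma irreducible_not_dvd_deriv_Y:
  assumes "Factorial_Ring.irreducible p" "at0 p \<noteq> 0"
  shows "\<not> p dvd deriv_Y p"
proof
  assume "p dvd deriv_Y p"
  then obtain c where "deriv_Y p = p * c" by (rule dvdE)
  hence "fps_deriv (at0 p) = at0 p * at0 c" by (simp flip: at0_deriv_Y)
  moreover have "at0 p $ 0 = 0" using Factorial_Ring.irreducible_not_unit[OF assms(1)] by (simp add: series_unit_iff)
  ultimately have "subdegree (at0 p) \<le> subdegree (fps_deriv (at0 p))"
    using subdegree_deriv(1)[OF assms(2)] by (intro dvd_imp_subdegree_le) auto
  thus False using subdegree_deriv(2)[OF assms(2) \<open>at0 p $ 0 = 0\<close>] by simp
qed

section \<open>Unions of branches of a reduced curve\<close>

locale reduced_curve =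
  fixes S :: "nat set" and f :: "nat \<Rightarrow> conv_series"
  assumes finite_S: "finite S"
    and irred: "i \<in> S \<Longrightarrow> Factorial_Ring.irreducible (f i)"
    and distinct: "i \<in> S \<Longrightarrow> j \<in> S \<Longrightarrow> i \<noteq> j \<Longrightarrow> ideal_gen {f i} \<noteq> ideal_gen {f j}"
begin

definition F :: "nat set \<Rightarrow> conv_series" where "F A = (\<Prod>i\<in>A. f i)"

lemma F_insert: "finite A \<Longrightarrow> i \<notin> A \<Longrightarrow> F (insert i A) = f i * F A"
  by (simp add: F_def)

lemma F_remove: "finite A \<Longrightarrow> i \<in> A \<Longrightarrow> F A = f i * F (A - {i})"
  by (simp add: F_def prod.remove)

lemma F_Un: "finite A \<Longrightarrow> finite B \<Longrightarrow> A \<inter> B = {} \<Longrightarrow> F (A \<union> B) = F A * F B"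
  by (simp add: F_def prod.union_disjoint)

lemma finite_subset_S: "A \<subseteq> S \<Longrightarrow> finite A"
  using finite_S finite_subset by blast

lemma f_nonunit: "i \<in> S \<Longrightarrow> at0 (f i) $ 0 = 0"
  using Factorial_Ring.irreducible_not_unit[OF irred] series_unit_iff by blast

lemma F_nonunit:
  assumes "A \<subseteq> S" "A \<noteq> {}"
  shows "at0 (F A) $ 0 = 0"
proof -
  obtain i where i: "i \<in> A" using assms by blast
  hence "at0 (f i) $ 0 = 0" using f_nonunit assms by blast
  thus ?thesis using F_remove[OF finite_subset_S[OF assms(1)] i] by simp
qed

lemma at0_F_eq_0_iff: "A \<subseteq> S \<Longrightarrow> at0 (F A) = 0 \<longleftrightarrow> (\<exists>i\<in>A. at0 (f i) = 0)"
proof -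
  assume "A \<subseteq> S"
  hence "finite A" by (rule finite_subset_S)
  thus ?thesis unfolding F_def by (induction A rule: finite_induct) auto
qed

text \<open>A common divisor that is not a unit is associated to both irreducible series, which then
  generate the same ideal; this principal ideal appears as \<open>gen2 a a\<close>.\<close>

lemma cofin_pair:
  assumes "i \<in> S" "j \<in> S" "i \<noteq> j"
  shows "cofin (gen2 (f i) (f j))"
proof (rule coprime_imp_cofin)
  fix w assume w: "w dvd f i" "w dvd f j"
  show "w dvd 1"
  proof (rule ccontr)
    assume "\<not> w dvd 1"
    hence "f i dvd w" "f j dvd w" using irreducible_dvd_cases irred assms w by blast+
    hence "f i dvd f j" "f j dvd f i" using w by (blast intro: dvd_trans)+
    have *: "gen2 a a \<subseteq> gen2 b b" if "b dvd a" for a b :: conv_series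
    proof -
      obtain c where "a = b * c" using \<open>b dvd a\<close> by (rule dvdE)
      hence "a \<in> gen2 b b" using isidlD(4)[OF isidl_gen2 gen2_mem(1)] by simp
      thus ?thesis by (intro gen2_least isidl_gen2)
    qed
    have "gen2 (f i) (f i) = gen2 (f j) (f j)"
      using *[OF \<open>f i dvd f j\<close>] *[OF \<open>f j dvd f i\<close>] by blast
    thus False using distinct[OF assms] ideal_gen_gen2[of "f i" "f i"] ideal_gen_gen2[of "f j" "f j"] by simp
  qed
qed

lemma cofin_disjoint:
  assumes "A \<subseteq> S" "B \<subseteq> S" "A \<inter> B = {}"
  shows "cofin (gen2 (F A) (F B))"
proof -
  have "cofin (gen2 (f i) (F B))" if "i \<in> A" for i
    unfolding F_def using assms that finite_subset_S by (intro cofin_gen2_prod cofin_pair) auto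
  hence "cofin (gen2 (F B) (F A))"
    unfolding F_def[of A] using finite_subset_S[OF assms(1)] by (intro cofin_gen2_prod) (auto simp: gen2_commute)
  thus ?thesis by (simp add: gen2_commute)
qed

lemma cofin_single: "i \<in> S \<Longrightarrow> A \<subseteq> S \<Longrightarrow> i \<notin> A \<Longrightarrow> cofin (gen2 (f i) (F A))"
  using cofin_disjoint[of "{i}" A] by (simp add: F_def)

text \<open>Otherwise the ideal would lie in that of X, which contains no power of Y.\<close>

lemma not_both_X: "cofin (gen2 a b) \<Longrightarrow> at0 a = 0 \<Longrightarrow> at0 b \<noteq> 0"
proof
  assume *: "cofin (gen2 a b)" "at0 a = 0" "at0 b = 0"
  obtain k where "sY ^ k \<in> gen2 a b" using *(1) unfolding cofin_def by blast
  then obtain c d where "sY ^ k = c * a + d * b" by (rule gen2E)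
  from arg_cong[OF this, of at0] show False using * by simp
qed

text \<open>It suffices to treat one branch f_i. Modulo f_i the Y-derivative of \<open>F A\<close>
  is \<open>F (A - {i})\<close> times that of f_i; the first factor is coprime to f_i, and f_i does
  not divide the second.\<close>

lemma cofin_polar:
  assumes "A \<subseteq> S" "at0 (F A) \<noteq> 0"
  shows "cofin (gen2 (F A) (deriv_Y (F A)))"
proof -
  have "cofin (gen2 (deriv_Y (F A)) (f i))" if i: "i \<in> A" for i
  proof (rule coprime_imp_cofin, rule ccontr)
    fix w assume w: "w dvd deriv_Y (F A)" "w dvd f i" "\<not> w dvd 1"
    have iS: "i \<in> S" using i assms by blast
    have nz: "at0 (f i) \<noteq> 0" using assms at0_F_eq_0_iff i by blast
    have "f i dvd w" using irreducible_dvd_cases[OF irred[OF iS] w(2)] w(3) by blast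
    hence "f i dvd deriv_Y (F A)" using w(1) by (rule dvd_trans)
    also have "deriv_Y (F A) = f i * deriv_Y (F (A - {i})) + F (A - {i}) * deriv_Y (f i)"
      using F_remove[OF finite_subset_S[OF assms(1)] i] by (simp add: deriv_mult mult.commute)
    finally have "f i dvd F (A - {i}) * deriv_Y (f i)" by (simp add: dvd_add_right_iff)
    moreover have "cofin (gen2 (f i) (F (A - {i})))" using iS assms by (intro cofin_single) auto
    ultimately have "f i dvd deriv_Y (f i)" using cofin_dvd_cancel by blast
    thus False using irreducible_not_dvd_deriv_Y[OF irred[OF iS] nz] by blast
  qed
  hence "cofin (gen2 (deriv_Y (F A)) (F A))"
    unfolding F_def[of A] using finite_subset_S[OF assms(1)] by (intro cofin_gen2_prod) (auto simp: F_def)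
  thus ?thesis by (simp add: gen2_commute)
qed

text \<open>The unit u of the component X u is absorbed into the other branches, so that the curve
  becomes X times a curve regular in Y.\<close>

lemma X_component:
  assumes "i \<in> S" "A \<subseteq> S" "i \<notin> A" "A \<noteq> {}" "at0 (f i) = 0"
  obtains u where "f i = sX * u" "u dvd 1" "f i * F A = sX * (u * F A)" "at0 (F A) \<noteq> 0"
    "at0 (u * F A) \<noteq> 0" "at0 (u * F A) $ 0 = 0" "cofin (gen2 (u * F A) (deriv_Y (u * F A)))"
proof -
  obtain u where u: "f i = sX * u" "u dvd 1" using irreducible_dvd_sX[OF irred[OF assms(1)] assms(5)] by blast
  have nz: "at0 (F A) \<noteq> 0" using not_both_X[OF cofin_single[OF assms(1-3)] assms(5)] .
  have "at0 u \<noteq> 0" using u(2) by (auto simp: series_unit_iff)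
  thus ?thesis
    using that[OF u] u nz F_nonunit[OF assms(2,4)] cofin_polar[OF assms(2) nz]
    by (simp add: mult.assoc gen2_polar_unit_mult)
qed

lemma cofin_derivs_F:
  assumes "A \<subseteq> S" "A \<noteq> {}"
  shows "cofin (gen2 (deriv_X (F A)) (deriv_Y (F A)))"
proof (cases "at0 (F A) = 0")
  case False
  thus ?thesis using cofin_derivs cofin_polar F_nonunit assms by blast
next
  case True
  then obtain i where i: "i \<in> A" "at0 (f i) = 0" using at0_F_eq_0_iff[OF assms(1)] by blast
  have iS: "i \<in> S" "A - {i} \<subseteq> S" "i \<notin> A - {i}" using i assms by auto
  have FA: "F A = f i * F (A - {i})" using F_remove[OF finite_subset_S[OF assms(1)] i(1)] .
  show ?thesis
  proof (cases "A - {i} = {}")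
    case True
    have "F (A - {i}) = 1" unfolding True by (simp add: F_def)
    moreover obtain u where "f i = sX * u" "u dvd 1" using irreducible_dvd_sX[OF irred[OF iS(1)] i(2)] by blast
    ultimately show ?thesis using milnor_X_unit(2) FA by simp
  next
    case False
    obtain u where u: "f i * F (A - {i}) = sX * (u * F (A - {i}))"
      "at0 (u * F (A - {i})) \<noteq> 0" "at0 (u * F (A - {i})) $ 0 = 0"
      "cofin (gen2 (u * F (A - {i})) (deriv_Y (u * F (A - {i}))))"
      using X_component[OF iS False i(2)] by blast
    show ?thesis using cofin_X_multiple(2)[OF u(2-4)] unfolding FA u(1)
      by (simp add: deriv_mult(1,2)[of sX] deriv_sX)
         (simp add: add.commute)
  qed
qed

lemma tjurina_union_le:
  assumes "A \<subseteq> S" "B \<subseteq> S" "A \<inter> B = {}" "A \<noteq> {}" "B \<noteq> {}"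
  shows "tjurina (F A * F B) + 1 \<le> tjurina (F A) + tjurina (F B) + 2 * intersection_mult (F A) (F B)"
proof -
  have AB: "F (A \<union> B) = F A * F B" using assms finite_subset_S by (intro F_Un) auto
  have c: "cofin (gen2 (deriv_X (F A * F B)) (deriv_Y (F A * F B)))"
    using cofin_derivs_F[of "A \<union> B"] assms unfolding AB by blast
  have c': "cofin (gen2 (F A) (F B))" "cofin (gen2 (F B) (F A))" using cofin_disjoint assms by blast+
  show ?thesis
  proof (cases "at0 (F A) = 0")
    case False
    thus ?thesis using assms c c'
      by (intro tjurina_mult_le F_nonunit cofin_polar cofin_derivs_F)
  next
    case True
    \<comment> \<open>At most one of the two curves contains the line X = 0, so the other one can be
      the parametrized factor.\<close>
    hence nz: "at0 (F B) \<noteq> 0" using not_both_X c' by blast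
    have "tjurina (F B * F A) + 1 \<le> tjurina (F B) + tjurina (F A) + 2 * intersection_mult (F B) (F A)"
      using assms nz c c' by (intro tjurina_mult_le F_nonunit cofin_polar cofin_derivs_F) (simp_all add: mult.commute)
    thus ?thesis by (simp add: mult.commute intersection_mult_commute add.commute)
  qed
qed

text \<open>For the component X let g be the other branches and d the order of g on X = 0. Then
  \<mu>(X g) = d + I(g, g_Y), Teissier's formula turns the last term into \<mu>(g) + d - 1, and d is
  I(X, g).\<close>

lemma milnor_insert:
  assumes "i \<in> S" "A \<subseteq> S" "i \<notin> A" "A \<noteq> {}" "at0 (F A) \<noteq> 0"
  shows "milnor (f i * F A) + 1 = milnor (f i) + milnor (F A) + 2 * intersection_mult (f i) (F A)"
proof (cases "at0 (f i) = 0")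
  case False
  have Fi: "F {i} = f i" by (simp add: F_def)
  have FiA: "F (insert i A) = f i * F A" using F_insert[OF finite_subset_S[OF assms(2)] assms(3)] .
  have 1: "cofin (gen2 (f i) (deriv_Y (f i)))"
    using cofin_polar[of "{i}"] assms(1) False unfolding Fi by blast
  have "at0 (f i * F A) \<noteq> 0" using False assms(5) by simp
  hence 2: "cofin (gen2 (f i * F A) (deriv_Y (f i * F A)))"
    using cofin_polar[of "insert i A"] assms(1,2) unfolding FiA by blast
  show ?thesis
    by (rule milnor_mult_regular[OF False f_nonunit[OF assms(1)] assms(5) F_nonunit[OF assms(2,4)] 1
      cofin_polar[OF assms(2,5)] 2])
next
  case True
  obtain u where u: "f i = sX * u" "u dvd 1" "f i * F A = sX * (u * F A)"
    "at0 (u * F A) \<noteq> 0" "at0 (u * F A) $ 0 = 0" "cofin (gen2 (u * F A) (deriv_Y (u * F A)))"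
    by (rule X_component[OF assms(1-4) True])
  have "subdegree (at0 u) = 0" using u(2) by (simp add: series_unit_iff)
  moreover have "at0 u \<noteq> 0" using u(4) by auto
  ultimately have v: "subdegree (at0 (u * F A)) = subdegree (at0 (F A))" using assms(5) by simp
  have "milnor (f i * F A) = subdegree (at0 (F A)) + intersection_mult (F A) (deriv_Y (F A))"
    unfolding u(3) milnor_X_mult[OF u(4-6)] v intersection_mult_eq gen2_polar_unit_mult[OF u(2)] ..
  moreover have "intersection_mult (F A) (deriv_Y (F A)) + 1 = milnor (F A) + subdegree (at0 (F A))"
    using milnor_polar[OF assms(5) F_nonunit[OF assms(2,4)] cofin_polar[OF assms(2,5)]] .
  moreover have "milnor (f i) = 0" using milnor_X_unit(1)[OF u(2)] u(1) by simp
  moreover have "intersection_mult (f i) (F A) = subdegree (at0 (F A))"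
  proof -
    have "gen2 (F A) (f i) = gen2 (F A) sX" unfolding u(1) using gen2_unit_mult[OF u(2)] by (metis mult.commute)
    hence "intersection_mult (f i) (F A) = intersection_mult sX (F A)"
      by (simp add: intersection_mult_eq gen2_commute)
    thus ?thesis using intersection_mult_sX(2)[OF assms(5)] by simp
  qed
  ultimately show ?thesis by simp
qed

definition pair_sum :: "nat set \<Rightarrow> nat" where
  "pair_sum A = (\<Sum>(i, j)\<in>{(i, j). i \<in> A \<and> j \<in> A \<and> i < j}. intersection_mult (f i) (f j))"

lemma pair_sum_insert:
  assumes "finite A" "i \<notin> A"
  shows "pair_sum (insert i A) = pair_sum A + (\<Sum>j\<in>A. intersection_mult (f i) (f j))"
proof -
  define P where "P = (\<lambda>A :: nat set. {(i, j). i \<in> A \<and> j \<in> A \<and> i < j})"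
  \<comment> \<open>The new pairs are the images of A under this map, which lists i and j in
    increasing order.\<close>
  let ?e = "\<lambda>j. if i < j then (i, j) else (j, i)"
  have fin: "finite (P A)" unfolding P_def by (rule finite_subset[of _ "A \<times> A"]) (use assms(1) in auto)
  have PU: "P (insert i A) = P A \<union> ?e ` A"
  proof (intro equalityI subsetI)
    fix p assume "p \<in> P (insert i A)"
    then obtain k l where p: "p = (k, l)" "k \<in> insert i A" "l \<in> insert i A" "k < l"
      unfolding P_def by blast
    consider "k = i" "l \<in> A" | "l = i" "k \<in> A" | "k \<in> A" "l \<in> A" using p by blast
    thus "p \<in> P A \<union> ?e ` A"
    proof cases
      case 1
      hence "p = ?e l" using p by simp
      thus ?thesis using 1 by blast
    next
      case 2
      hence "p = ?e k" using p by simp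
      thus ?thesis using 2 by blast
    next
      case 3
      thus ?thesis using p by (simp add: P_def)
    qed
  next
    fix p assume "p \<in> P A \<union> ?e ` A"
    thus "p \<in> P (insert i A)"
    proof
      assume "p \<in> ?e ` A"
      then obtain j where j: "j \<in> A" "p = ?e j" by blast
      have "i \<noteq> j" using j(1) assms(2) by blast
      thus ?thesis using j by (cases "i < j") (auto simp: P_def)
    qed (auto simp: P_def)
  qed
  have PI: "P A \<inter> ?e ` A = {}" unfolding P_def using assms(2) by (auto split: if_splits)
  have ps: "pair_sum B = (\<Sum>(i, j)\<in>P B. intersection_mult (f i) (f j))" for B
    by (simp add: pair_sum_def P_def)
  have "pair_sum (insert i A)
      = pair_sum A + (\<Sum>(i, j)\<in>?e ` A. intersection_mult (f i) (f j))"
    unfolding ps PU by (rule sum.union_disjoint[OF fin finite_imageI[OF assms(1)] PI])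
  also have "(\<Sum>(i, j)\<in>?e ` A. intersection_mult (f i) (f j)) = (\<Sum>j\<in>A. intersection_mult (f i) (f j))"
  proof (subst sum.reindex)
    show "inj_on ?e A" using assms(2) by (auto simp: inj_on_def split: if_splits)
  qed (auto intro!: sum.cong simp: intersection_mult_commute)
  finally show ?thesis .
qed

lemma intersection_mult_F:
  assumes "i \<in> S" "A \<subseteq> S" "i \<notin> A"
  shows "intersection_mult (f i) (F A) = (\<Sum>j\<in>A. intersection_mult (f i) (f j))"
  using intersection_mult_prod[OF finite_subset_S[OF assms(2)]] cofin_single[OF assms] unfolding F_def by blast

text \<open>Each of the \<open>card A\<close> - 1 unions gains one; the terms are arranged so that
  natural numbers suffice.\<close>

lemma tjurina_F_le:
  assumes "A \<subseteq> S" "A \<noteq> {}"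
  shows "tjurina (F A) + card A \<le> (\<Sum>i\<in>A. tjurina (f i)) + 2 * pair_sum A + 1"
proof -
  have "finite A" using assms finite_subset_S by blast
  from this assms(2,1) show ?thesis
  proof (induction A rule: finite_ne_induct)
    case (singleton i)
    thus ?case by (simp add: F_def)
  next
    case (insert i A)
    have "tjurina (F {i} * F A) + 1 \<le> tjurina (F {i}) + tjurina (F A) + 2 * intersection_mult (F {i}) (F A)"
      using insert by (intro tjurina_union_le) auto
    hence "tjurina (F (insert i A)) + 1 \<le> tjurina (f i) + tjurina (F A) + 2 * (\<Sum>j\<in>A. intersection_mult (f i) (f j))"
      using insert intersection_mult_F[of i A] F_insert[of A i] by (simp add: F_def)
    thus ?case using insert by (simp add: pair_sum_insert)
  qed
qed

lemma milnor_F_insert: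
  assumes "i \<in> S" "A \<subseteq> S" "i \<notin> A" "A \<noteq> {}" "at0 (F A) \<noteq> 0"
    and "milnor (F A) + card A = (\<Sum>i\<in>A. milnor (f i)) + 2 * pair_sum A + 1"
  shows "milnor (F (insert i A)) + card (insert i A)
    = (\<Sum>i\<in>insert i A. milnor (f i)) + 2 * pair_sum (insert i A) + 1"
  using milnor_insert[OF assms(1-5)] assms(3,6) intersection_mult_F[OF assms(1-3)] finite_subset_S[OF assms(2)]
  by (simp add: pair_sum_insert F_insert)

lemma milnor_F_regular:
  assumes "A \<subseteq> S" "A \<noteq> {}" "at0 (F A) \<noteq> 0"
  shows "milnor (F A) + card A = (\<Sum>i\<in>A. milnor (f i)) + 2 * pair_sum A + 1"
proof -
  have "finite A" using assms finite_subset_S by blast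
  from this assms(2,1,3) show ?thesis
  proof (induction A rule: finite_ne_induct)
    case (singleton i)
    have *: "{(k, l). k \<in> {i} \<and> l \<in> {i} \<and> k < l} = {}" by auto
    have "pair_sum {i} = 0" unfolding pair_sum_def * by simp
    thus ?case by (simp add: F_def)
  next
    case (insert i A)
    have "at0 (F A) \<noteq> 0" using insert by (auto simp: F_insert)
    thus ?case using insert by (intro milnor_F_insert) auto
  qed
qed

text \<open>A branch divisible by X is joined last, so that all earlier unions are regular in Y.
  There is at most one such branch, and \<open>card A > 1\<close> makes the rest nonempty.\<close>

lemma milnor_F:
  assumes "A \<subseteq> S" "card A > 1"
  shows "milnor (F A) + card A = (\<Sum>i\<in>A. milnor (f i)) + 2 * pair_sum A + 1"
proof (cases "at0 (F A) = 0")
  case False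
  thus ?thesis using assms by (intro milnor_F_regular) auto
next
  case True
  then obtain i where i: "i \<in> A" "at0 (f i) = 0" using at0_F_eq_0_iff[OF assms(1)] by blast
  define B where "B = A - {i}"
  have finA: "finite A" using assms finite_subset_S by blast
  have "card B = card A - 1" unfolding B_def using i finA by simp
  hence "B \<noteq> {}" using assms(2) by auto
  moreover have B: "i \<in> S" "B \<subseteq> S" "i \<notin> B" using i assms by (auto simp: B_def)
  moreover have "at0 (F B) \<noteq> 0" using not_both_X[OF cofin_single[OF B] i(2)] .
  ultimately have "milnor (F (insert i B)) + card (insert i B)
    = (\<Sum>i\<in>insert i B. milnor (f i)) + 2 * pair_sum (insert i B) + 1"
    by (intro milnor_F_insert milnor_F_regular)
  moreover have "insert i B = A" using i by (auto simp: B_def)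
  ultimately show ?thesis by simp
qed

end

theorem theorem4p3:
  fixes r :: nat and f :: "nat \<Rightarrow> conv_series"
  assumes "r > 1"
    and "\<And>i. i \<in> {1..r} \<Longrightarrow> Factorial_Ring.irreducible (f i)"
    and "\<And>i j. i \<in> {1..r} \<Longrightarrow> j \<in> {1..r} \<Longrightarrow> i \<noteq> j \<Longrightarrow> ideal_gen {f i} \<noteq> ideal_gen {f j}"
  shows "(\<forall>J K. J \<noteq> {} \<and> J \<subset> {1..r} \<and> K = {1..r} - J \<longrightarrow>
             int (tjurina (\<Prod>i\<in>{1..r}. f i))
               - (int (tjurina (\<Prod>j\<in>J. f j)) + int (tjurina (\<Prod>k\<in>K. f k)))
             \<le> 2 * int (intersection_mult (\<Prod>j\<in>J. f j) (\<Prod>k\<in>K. f k)) - 1)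
       \<and> int (tjurina (\<Prod>i\<in>{1..r}. f i)) - (\<Sum>i\<in>{1..r}. int (tjurina (f i)))
           \<le> 2 * (\<Sum>(i, j)\<in>{(i, j). 1 \<le> i \<and> i < j \<and> j \<le> r}. int (intersection_mult (f i) (f j)))
               - int r + 1
       \<and> 2 * (\<Sum>(i, j)\<in>{(i, j). 1 \<le> i \<and> i < j \<and> j \<le> r}. int (intersection_mult (f i) (f j)))
               - int r + 1
           = int (milnor (\<Prod>i\<in>{1..r}. f i)) - (\<Sum>i\<in>{1..r}. int (milnor (f i)))"
proof -
  interpret reduced_curve "{1..r}" f
    using assms by unfold_locales auto
  have pairs: "(\<Sum>(i, j)\<in>{(i, j). 1 \<le> i \<and> i < j \<and> j \<le> r}. int (intersection_mult (f i) (f j))) = int (pair_sum {1..r})"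
  proof -
    have "{(i, j). 1 \<le> i \<and> i < j \<and> j \<le> r} = {(i, j). i \<in> {1..r} \<and> j \<in> {1..r} \<and> i < j}" by auto
    thus ?thesis unfolding pair_sum_def of_nat_sum by (auto intro!: sum.cong)
  qed
  have 1: "int (tjurina (F {1..r})) - (int (tjurina (F J)) + int (tjurina (F K)))
      \<le> 2 * int (intersection_mult (F J) (F K)) - 1"
    if JK: "J \<noteq> {} \<and> J \<subset> {1..r} \<and> K = {1..r} - J" for J K
  proof -
    have "{1..r} = J \<union> K" "J \<inter> K = {}" "K \<noteq> {}" "J \<subseteq> {1..r}" "K \<subseteq> {1..r}" using JK by auto
    moreover have "F (J \<union> K) = F J * F K" using calculation finite_subset_S by (intro F_Un) auto
    ultimately have "tjurina (F {1..r}) + 1 \<le> tjurina (F J) + tjurina (F K) + 2 * intersection_mult (F J) (F K)"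
      using tjurina_union_le[of J K] JK by simp
    thus ?thesis by linarith
  qed
  have 2: "tjurina (F {1..r}) + r \<le> (\<Sum>i\<in>{1..r}. tjurina (f i)) + 2 * pair_sum {1..r} + 1"
    using tjurina_F_le[of "{1..r}"] assms(1) by simp
  have 3: "milnor (F {1..r}) + r = (\<Sum>i\<in>{1..r}. milnor (f i)) + 2 * pair_sum {1..r} + 1"
    using milnor_F[of "{1..r}"] assms(1) by simp
  have "int (tjurina (F {1..r})) - (\<Sum>i\<in>{1..r}. int (tjurina (f i))) \<le> 2 * int (pair_sum {1..r}) - int r + 1"
    using 2 unfolding of_nat_sum[symmetric] by linarith
  moreover have "2 * int (pair_sum {1..r}) - int r + 1 = int (milnor (F {1..r})) - (\<Sum>i\<in>{1..r}. int (milnor (f i)))"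
    using 3 unfolding of_nat_sum[symmetric] by linarith
  ultimately show ?thesis using 1 unfolding pairs F_def by blast
qed

end
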